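(* Let $P$ be a polynomial endofunctor represented by a diagram of groupoids $I\leftarrow E\to B\to I$, let $\mathbf T$ and $\mathbf F$ be the groupoids of $P$-trees and $P$-forests, and let $\mathbf C$ be the groupoid of $P$-trees with a cut. The canonical morphism $$(w,r):\mathbf C\longrightarrow\mathbf F\times\mathbf T$$ that sends $c:S\rightarrowtail T$ to $(P_c,S_c)$ induces an equivalence $$\mathbf C\simeq\mathbf F\times_{\widetilde I}\mathbf T ,$$ where the right-hand side is the homotopy pullback of the root functor $R:\mathbf F\to\widetilde I$ and the leaf functor $L:\mathbf T\to\widetilde I$.
   Context: Groupoids. A morphism of groupoids is a functor, and equivalence means equivalence of categories. The homotopy pullback $X\times_SY$ of functors $f:X\to S$, $g:Y\to S$ has as objects triples $(x,y,\phi:f(x)\xrightarrow{\sim}g(y))$ and as arrows pairs $(\alpha:x\to x',\beta:y\to y')$ with $g(\beta)\phi=\phi'f(\alpha)$. For a groupoid $I$, $\widetilde I$ is the groupoid whose objects are functors $N:X\to I$ with $X$ a finite set (a discrete groupoid), and whose arrows from $N:X\to I$ to $N':X'\to I$ are pairs of a bijection $f:X\to X'$ and a natural isomorphism $N\cong N'\circ f$. Trees. A tree is a diagram of finite sets $A\xleftarrow{s}M\xrightarrow{p}N\xrightarrow{t}A$ such that $t$ is injective; $s$ is injective with singleton complement $\{1\}$ (the root); and, with $\sigma:A\to A$ given by $\sigma(1)=1$ and $\sigma(s(e))=t(p(e))$, for every $x\in A$ there is $k\in\mathbb N$ with $\sigma^k(x)=1$. Elements of $A$ are edges, elements of $N$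 are nodes, $t(n)$ is the output edge of the node $n$, $p^{-1}(n)$ its set of input edges, and the leaves are the elements of $A\setminus t(N)$. A tree embedding is a triple of (necessarily injective) maps $A'\to A$, $M'\to M$, $N'\to N$ commuting with the structure maps and such that the square over $p$ is a pullback; it is root-preserving if it sends root to root. $P$-trees. A $P$-tree is a tree together with functors $\alpha:A\to I$, $M\to E$, $N\to B$ and specified natural isomorphisms making the three squares to $I\leftarrow E\to B\to I$ commute (the same $\alpha$ at both ends), with the middle square a homotopy pullback. An embedding of $P$-trees is a tree embedding together with natural isomorphisms between the decorating functors compatible with all specified isomorphisms; $\mathbf T$ is the groupoid of $P$-trees and their isomorphisms. The groupoid of $P$-forests is $\mathbf F=\widetilde{\mathbf T}$ (finite families of $P$-trees). $L:\mathbf T\to\widetilde I$ sends a $P$-tree to its set of leaves coloured by $\alpha$; $R:\mathbf F\to\widetilde I$ sends a family $(T_x)_{x\in X}$ to the family of root colours $(\alpha_{T_x}(1))_{x\in X}$. Trees with a cut. $\mathbf C$ is the groupoid whose objects are the root-preserving embeddings of $P$-trees $c:S\rightarrowtail T$ and whose arrows from $c$ to $c':S'\rightarrowtail T'$ are pairs of isomorphisms of $P$-trees $\tau:T\to T'$, $\sigma:S\to S'$ with $\tau c=c'\sigma$. The functor $r$ sends $c$ to $S_c:=S$. The functor $w$ sends $c$ to the forest $P_c$, indexed by the leaves $\ell$ of $S$, of the ideal subtrees $T_\ell\subset T$, where $T_\ell$ has root $c(\ell)$ and consists of all edges $x$ of $T$ with $\sigma^k(x)=c(\ell)$ for some $k\ge0$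 and all nodes whose output edge is such an edge. The roots of $P_c$ are canonically identified with the leaves of $S$ (compatibly with colours, via the isomorphisms that are part of $c$), giving a canonical natural isomorphism $R\circ w\cong L\circ r$. *)

theory Defs
  imports Main "HOL-Library.FuncSet"
begin

section \<open>Groupoids, functors, homotopy pullbacks\<close>

text \<open>Hom-sets are indexed by their end points and need not be disjoint. \<open>cmp C x y z g f\<close> is
  the composite of \<open>f\<close> from \<open>x\<close> to \<open>y\<close> followed by \<open>g\<close> from \<open>y\<close> to \<open>z\<close>.\<close>

record ('o, 'a) cat =
  obj :: "'o set"
  hom :: "'o \<Rightarrow> 'o \<Rightarrow> 'a set"
  cmp :: "'o \<Rightarrow> 'o \<Rightarrow> 'o \<Rightarrow> 'a \<Rightarrow> 'a \<Rightarrow> 'a"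
  idt :: "'o \<Rightarrow> 'a"

locale category =
  fixes C :: "('o, 'a) cat"
  assumes idt_hom: "x \<in> obj C \<Longrightarrow> idt C x \<in> hom C x x"
    and cmp_hom: "\<lbrakk>x \<in> obj C; y \<in> obj C; z \<in> obj C; f \<in> hom C x y; g \<in> hom C y z\<rbrakk>
      \<Longrightarrow> cmp C x y z g f \<in> hom C x z"
    and cmp_idt_right: "\<lbrakk>x \<in> obj C; y \<in> obj C; f \<in> hom C x y\<rbrakk> \<Longrightarrow> cmp C x x y f (idt C x) = f"
    and cmp_idt_left: "\<lbrakk>x \<in> obj C; y \<in> obj C; f \<in> hom C x y\<rbrakk> \<Longrightarrow> cmp C x y y (idt C y) f = f"
    and cmp_assoc: "\<lbrakk>x \<in> obj C; y \<in> obj C; z \<in> obj C; u \<in> obj C;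
        f \<in> hom C x y; g \<in> hom C y z; h \<in> hom C z u\<rbrakk>
      \<Longrightarrow> cmp C x z u h (cmp C x y z g f) = cmp C x y u (cmp C y z u h g) f"

definition inverse_arrows :: "('o, 'a) cat \<Rightarrow> 'o \<Rightarrow> 'o \<Rightarrow> 'a \<Rightarrow> 'a \<Rightarrow> bool" where
  "inverse_arrows C x y f g \<longleftrightarrow> f \<in> hom C x y \<and> g \<in> hom C y x \<and>
     cmp C x y x g f = idt C x \<and> cmp C y x y f g = idt C y"

definition is_iso :: "('o, 'a) cat \<Rightarrow> 'o \<Rightarrow> 'o \<Rightarrow> 'a \<Rightarrow> bool" where
  "is_iso C x y f \<longleftrightarrow> (\<exists>g. inverse_arrows C x y f g)"

definition inv_arr :: "('o, 'a) cat \<Rightarrow> 'o \<Rightarrow> 'o \<Rightarrow> 'a \<Rightarrow> 'a" where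
  "inv_arr C x y f = (THE g. inverse_arrows C x y f g)"

locale groupoid = category +
  assumes all_iso: "\<lbrakk>x \<in> obj C; y \<in> obj C; f \<in> hom C x y\<rbrakk> \<Longrightarrow> is_iso C x y f"

definition core :: "('o, 'a) cat \<Rightarrow> ('o, 'a) cat" where
  "core C = C\<lparr>hom := \<lambda>x y. {f. is_iso C x y f}\<rparr>"

record ('o, 'a, 'p, 'b) func =
  fob :: "'o \<Rightarrow> 'p"
  farr :: "'o \<Rightarrow> 'o \<Rightarrow> 'a \<Rightarrow> 'b"

locale gfunctor = C: groupoid C + D: groupoid D
  for C :: "('o, 'a) cat" and D :: "('p, 'b) cat" +
  fixes F :: "('o, 'a, 'p, 'b) func"
  assumes fob_obj: "x \<in> obj C \<Longrightarrow> fob F x \<in> obj D"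
    and farr_hom: "\<lbrakk>x \<in> obj C; y \<in> obj C; f \<in> hom C x y\<rbrakk>
      \<Longrightarrow> farr F x y f \<in> hom D (fob F x) (fob F y)"
    and farr_idt: "x \<in> obj C \<Longrightarrow> farr F x x (idt C x) = idt D (fob F x)"
    and farr_cmp: "\<lbrakk>x \<in> obj C; y \<in> obj C; z \<in> obj C; f \<in> hom C x y; g \<in> hom C y z\<rbrakk>
      \<Longrightarrow> farr F x z (cmp C x y z g f)
        = cmp D (fob F x) (fob F y) (fob F z) (farr F y z g) (farr F x y f)"

definition func_id :: "('o, 'a, 'o, 'a) func" where
  "func_id = \<lparr>fob = \<lambda>x. x, farr = \<lambda>x y f. f\<rparr>"

definition func_comp ::
  "('p, 'b, 'q, 'c) func \<Rightarrow> ('o, 'a, 'p, 'b) func \<Rightarrow> ('o, 'a, 'q, 'c) func" where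
  "func_comp G F = \<lparr>fob = \<lambda>x. fob G (fob F x),
     farr = \<lambda>x y f. farr G (fob F x) (fob F y) (farr F x y f)\<rparr>"

text \<open>The target of the functors is a groupoid, so the components of a natural transformation are
  automatically invertible.\<close>

definition nat_iso :: "('o, 'a) cat \<Rightarrow> ('p, 'b) cat \<Rightarrow> ('o, 'a, 'p, 'b) func \<Rightarrow>
    ('o, 'a, 'p, 'b) func \<Rightarrow> ('o \<Rightarrow> 'b) \<Rightarrow> bool" where
  "nat_iso C D F G \<eta> \<longleftrightarrow> gfunctor C D F \<and> gfunctor C D G \<and>
     (\<forall>x\<in>obj C. \<eta> x \<in> hom D (fob F x) (fob G x)) \<and>
     (\<forall>x\<in>obj C. \<forall>y\<in>obj C. \<forall>f\<in>hom C x y.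
        cmp D (fob F x) (fob F y) (fob G y) (\<eta> y) (farr F x y f)
        = cmp D (fob F x) (fob G x) (fob G y) (farr G x y f) (\<eta> x))"

definition equivalence :: "('o, 'a) cat \<Rightarrow> ('p, 'b) cat \<Rightarrow> ('o, 'a, 'p, 'b) func \<Rightarrow> bool" where
  "equivalence C D F \<longleftrightarrow> gfunctor C D F \<and>
     (\<exists>G \<eta> \<epsilon>. gfunctor D C G \<and> nat_iso C C func_id (func_comp G F) \<eta> \<and>
        nat_iso D D (func_comp F G) func_id \<epsilon>)"

definition prod_cat :: "('o, 'a) cat \<Rightarrow> ('p, 'b) cat \<Rightarrow> ('o \<times> 'p, 'a \<times> 'b) cat" where
  "prod_cat C D = \<lparr>obj = obj C \<times> obj D,
     hom = \<lambda>(x, y) (x', y'). hom C x x' \<times> hom D y y',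
     cmp = \<lambda>(x, y) (x', y') (x'', y'') (g, k) (f, h). (cmp C x x' x'' g f, cmp D y y' y'' k h),
     idt = \<lambda>(x, y). (idt C x, idt D y)\<rparr>"

definition func_pair ::
  "('o, 'a, 'p, 'b) func \<Rightarrow> ('o, 'a, 'q, 'c) func \<Rightarrow> ('o, 'a, 'p \<times> 'q, 'b \<times> 'c) func" where
  "func_pair F G = \<lparr>fob = \<lambda>x. (fob F x, fob G x), farr = \<lambda>x y f. (farr F x y f, farr G x y f)\<rparr>"

definition hpullback :: "('x, 'a) cat \<Rightarrow> ('y, 'b) cat \<Rightarrow> ('s, 'c) cat \<Rightarrow>
    ('x, 'a, 's, 'c) func \<Rightarrow> ('y, 'b, 's, 'c) func \<Rightarrow> ('x \<times> 'y \<times> 'c, 'a \<times> 'b) cat" where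
  "hpullback X Y S F G = \<lparr>
     obj = {(x, y, \<phi>). x \<in> obj X \<and> y \<in> obj Y \<and> \<phi> \<in> hom S (fob F x) (fob G y)},
     hom = \<lambda>(x, y, \<phi>) (x', y', \<phi>'). {(a, b). a \<in> hom X x x' \<and> b \<in> hom Y y y' \<and>
        cmp S (fob F x) (fob G y) (fob G y') (farr G y y' b) \<phi>
        = cmp S (fob F x) (fob F x') (fob G y') \<phi>' (farr F x x' a)},
     cmp = \<lambda>(x, y, _) (x', y', _) (x'', y'', _) (a', b') (a, b).
        (cmp X x x' x'' a' a, cmp Y y y' y'' b' b),
     idt = \<lambda>(x, y, _). (idt X x, idt Y y)\<rparr>"

text \<open>The functor into the homotopy pullback of \<open>F\<close> and \<open>G\<close> induced by functors \<open>U\<close>, \<open>V\<close> and a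
  natural isomorphism \<open>\<theta>\<close> from \<open>F \<circ> U\<close> to \<open>G \<circ> V\<close>.\<close>

definition hp_induced :: "('w, 'd, 'x, 'a) func \<Rightarrow> ('w, 'd, 'y, 'b) func \<Rightarrow> ('w \<Rightarrow> 'c) \<Rightarrow>
    ('w, 'd, 'x \<times> 'y \<times> 'c, 'a \<times> 'b) func" where
  "hp_induced U V \<theta> = \<lparr>fob = \<lambda>w. (fob U w, fob V w, \<theta> w),
     farr = \<lambda>w w' d. (farr U w w' d, farr V w w' d)\<rparr>"

definition hpullback_square :: "('w, 'd) cat \<Rightarrow> ('x, 'a) cat \<Rightarrow> ('y, 'b) cat \<Rightarrow> ('s, 'c) cat \<Rightarrow>
    ('x, 'a, 's, 'c) func \<Rightarrow> ('y, 'b, 's, 'c) func \<Rightarrow>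
    ('w, 'd, 'x, 'a) func \<Rightarrow> ('w, 'd, 'y, 'b) func \<Rightarrow> ('w \<Rightarrow> 'c) \<Rightarrow> bool" where
  "hpullback_square W X Y S F G U V \<theta> \<longleftrightarrow>
     nat_iso W S (func_comp F U) (func_comp G V) \<theta> \<and>
     equivalence W (hpullback X Y S F G) (hp_induced U V \<theta>)"

definition discrete :: "'o set \<Rightarrow> ('o, unit) cat" where
  "discrete X = \<lparr>obj = X, hom = \<lambda>x y. {u. x = y}, cmp = \<lambda>_ _ _ _ _. (), idt = \<lambda>_. ()\<rparr>"

text \<open>A functor out of a discrete groupoid amounts to a function on objects, and a natural
  isomorphism between two such functors to a family of arrows.  Such functors and transformations
  are therefore represented below by functions on the set, made extensional (\<open>\<rightarrow>\<^sub>E\<close>, \<open>\<Pi>\<^sub>E\<close>)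
  so that equality of functions is equality on the set.\<close>

definition disc_func :: "('p, 'b) cat \<Rightarrow> ('o \<Rightarrow> 'p) \<Rightarrow> ('o, unit, 'p, 'b) func" where
  "disc_func C N = \<lparr>fob = N, farr = \<lambda>x y _. idt C (N x)\<rparr>"


section \<open>Finite families\<close>

text \<open>The finite sets are the finite subsets of a type \<open>'v\<close>, which in the main result is infinite.
  The first component of an arrow is a bijection of index sets, the second a natural
  isomorphism \<open>N \<cong> N' \<circ> f\<close>.\<close>

definition families ::
  "('o, 'a) cat \<Rightarrow> ('v set \<times> ('v \<Rightarrow> 'o), ('v \<Rightarrow> 'v) \<times> ('v \<Rightarrow> 'a)) cat" where
  "families C = \<lparr>
     obj = {(X, N). finite X \<and> N \<in> X \<rightarrow>\<^sub>E obj C},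
     hom = \<lambda>(X, N) (X', N'). {(f, \<phi>). f \<in> extensional X \<and> bij_betw f X X' \<and>
        \<phi> \<in> (\<Pi>\<^sub>E x\<in>X. hom C (N x) (N' (f x)))},
     cmp = \<lambda>(X, N) (X', N') (X'', N'') (g, \<psi>) (f, \<phi>).
        (\<lambda>x\<in>X. g (f x), \<lambda>x\<in>X. cmp C (N x) (N' (f x)) (N'' (g (f x))) (\<psi> (f x)) (\<phi> x)),
     idt = \<lambda>(X, N). (\<lambda>x\<in>X. x, \<lambda>x\<in>X. idt C (N x))\<rparr>"


section \<open>Trees\<close>

text \<open>The diagram \<open>A \<leftarrow> M \<rightarrow> N \<rightarrow> A\<close> with maps \<open>sm\<close>, \<open>pm\<close>, \<open>tm\<close>.\<close>

record 'v tree =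
  edges :: "'v set"
  inputs :: "'v set"
  nodes :: "'v set"
  sm :: "'v \<Rightarrow> 'v"
  pm :: "'v \<Rightarrow> 'v"
  tm :: "'v \<Rightarrow> 'v"

definition tree_root :: "('v, 'z) tree_scheme \<Rightarrow> 'v" where
  "tree_root T = (THE r. edges T - sm T ` inputs T = {r})"

definition next_edge :: "('v, 'z) tree_scheme \<Rightarrow> 'v \<Rightarrow> 'v" where
  "next_edge T x = (if x = tree_root T then tree_root T
     else tm T (pm T (the_inv_into (inputs T) (sm T) x)))"

definition is_tree :: "('v, 'z) tree_scheme \<Rightarrow> bool" where
  "is_tree T \<longleftrightarrow> finite (edges T) \<and> finite (inputs T) \<and> finite (nodes T) \<and>
     sm T \<in> inputs T \<rightarrow>\<^sub>E edges T \<and> pm T \<in> inputs T \<rightarrow>\<^sub>E nodes T \<and> tm T \<in> nodes T \<rightarrow>\<^sub>E edges T \<and>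
     inj_on (tm T) (nodes T) \<and> inj_on (sm T) (inputs T) \<and>
     (\<exists>r. edges T - sm T ` inputs T = {r}) \<and>
     (\<forall>x\<in>edges T. \<exists>k. (next_edge T ^^ k) x = tree_root T)"

definition leaves :: "('v, 'z) tree_scheme \<Rightarrow> 'v set" where
  "leaves T = edges T - tm T ` nodes T"

definition tree_embedding :: "('v, 'z) tree_scheme \<Rightarrow> ('v, 'z) tree_scheme \<Rightarrow>
    ('v \<Rightarrow> 'v) \<Rightarrow> ('v \<Rightarrow> 'v) \<Rightarrow> ('v \<Rightarrow> 'v) \<Rightarrow> bool" where
  "tree_embedding S T a m n \<longleftrightarrow>
     a \<in> edges S \<rightarrow>\<^sub>E edges T \<and> m \<in> inputs S \<rightarrow>\<^sub>E inputs T \<and> n \<in> nodes S \<rightarrow>\<^sub>E nodes T \<and>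
     (\<forall>e\<in>inputs S. a (sm S e) = sm T (m e)) \<and>
     (\<forall>e\<in>inputs S. n (pm S e) = pm T (m e)) \<and>
     (\<forall>b\<in>nodes S. a (tm S b) = tm T (n b)) \<and>
     bij_betw (\<lambda>e. (m e, pm S e)) (inputs S)
       {(e, b). e \<in> inputs T \<and> b \<in> nodes S \<and> pm T e = n b}"


section \<open>\<open>P\<close>-trees\<close>

text \<open>The diagram of groupoids \<open>I \<leftarrow> E \<rightarrow> B \<rightarrow> I\<close>, representing a polynomial endofunctor.\<close>

record ('i, 'ia, 'e, 'ea, 'b, 'ba) poly_diagram =
  gI :: "('i, 'ia) cat"
  gE :: "('e, 'ea) cat"
  gB :: "('b, 'ba) cat"
  sP :: "('e, 'ea, 'i, 'ia) func"
  pP :: "('e, 'ea, 'b, 'ba) func"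
  tP :: "('b, 'ba, 'i, 'ia) func"

definition is_poly_diagram :: "('i, 'ia, 'e, 'ea, 'b, 'ba) poly_diagram \<Rightarrow> bool" where
  "is_poly_diagram P \<longleftrightarrow> groupoid (gI P) \<and> groupoid (gE P) \<and> groupoid (gB P) \<and>
     gfunctor (gE P) (gI P) (sP P) \<and> gfunctor (gE P) (gB P) (pP P) \<and> gfunctor (gB P) (gI P) (tP P)"

text \<open>The last three fields are the natural isomorphisms of the three squares, directed as in
  \<open>is_ptree\<close>.\<close>

record ('v, 'i, 'ia, 'e, 'b, 'ba) ptree = "'v tree" +
  alpha :: "'v \<Rightarrow> 'i"
  beta :: "'v \<Rightarrow> 'e"
  gamma :: "'v \<Rightarrow> 'b"
  iso_s :: "'v \<Rightarrow> 'ia"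
  iso_p :: "'v \<Rightarrow> 'ba"
  iso_t :: "'v \<Rightarrow> 'ia"

definition is_ptree ::
  "('i, 'ia, 'e, 'ea, 'b, 'ba) poly_diagram \<Rightarrow> ('v, 'i, 'ia, 'e, 'b, 'ba) ptree \<Rightarrow> bool" where
  "is_ptree P T \<longleftrightarrow> is_tree T \<and>
     alpha T \<in> edges T \<rightarrow>\<^sub>E obj (gI P) \<and>
     beta T \<in> inputs T \<rightarrow>\<^sub>E obj (gE P) \<and>
     gamma T \<in> nodes T \<rightarrow>\<^sub>E obj (gB P) \<and>
     iso_s T \<in> (\<Pi>\<^sub>E e\<in>inputs T. hom (gI P) (alpha T (sm T e)) (fob (sP P) (beta T e))) \<and>
     iso_p T \<in> (\<Pi>\<^sub>E e\<in>inputs T. hom (gB P) (gamma T (pm T e)) (fob (pP P) (beta T e))) \<and>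
     iso_t T \<in> (\<Pi>\<^sub>E n\<in>nodes T. hom (gI P) (alpha T (tm T n)) (fob (tP P) (gamma T n))) \<and>
     hpullback_square (discrete (inputs T)) (discrete (nodes T)) (gE P) (gB P)
       (disc_func (gB P) (gamma T)) (pP P)
       (disc_func (discrete (nodes T)) (pm T)) (disc_func (gE P) (beta T)) (iso_p T)"

text \<open>An embedding of \<open>P\<close>-trees from \<open>S\<close> to \<open>T\<close>: maps of edges, inputs and nodes, together with
  natural isomorphisms from each decoration of \<open>S\<close> to the decoration of \<open>T\<close> restricted along
  these maps.\<close>

record ('v, 'ia, 'ea, 'ba) emb =
  eA :: "'v \<Rightarrow> 'v"
  eM :: "'v \<Rightarrow> 'v"
  eN :: "'v \<Rightarrow> 'v"
  ealpha :: "'v \<Rightarrow> 'ia"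
  ebeta :: "'v \<Rightarrow> 'ea"
  egamma :: "'v \<Rightarrow> 'ba"

definition is_ptree_embedding :: "('i, 'ia, 'e, 'ea, 'b, 'ba) poly_diagram \<Rightarrow>
    ('v, 'i, 'ia, 'e, 'b, 'ba) ptree \<Rightarrow> ('v, 'i, 'ia, 'e, 'b, 'ba) ptree \<Rightarrow>
    ('v, 'ia, 'ea, 'ba) emb \<Rightarrow> bool" where
  "is_ptree_embedding P S T f \<longleftrightarrow> tree_embedding S T (eA f) (eM f) (eN f) \<and>
     ealpha f \<in> (\<Pi>\<^sub>E x\<in>edges S. hom (gI P) (alpha S x) (alpha T (eA f x))) \<and>
     ebeta f \<in> (\<Pi>\<^sub>E e\<in>inputs S. hom (gE P) (beta S e) (beta T (eM f e))) \<and>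
     egamma f \<in> (\<Pi>\<^sub>E n\<in>nodes S. hom (gB P) (gamma S n) (gamma T (eN f n))) \<and>
     (\<forall>e\<in>inputs S.
        cmp (gI P) (alpha S (sm S e)) (fob (sP P) (beta S e)) (fob (sP P) (beta T (eM f e)))
          (farr (sP P) (beta S e) (beta T (eM f e)) (ebeta f e)) (iso_s S e)
        = cmp (gI P) (alpha S (sm S e)) (alpha T (eA f (sm S e))) (fob (sP P) (beta T (eM f e)))
          (iso_s T (eM f e)) (ealpha f (sm S e))) \<and>
     (\<forall>e\<in>inputs S.
        cmp (gB P) (gamma S (pm S e)) (fob (pP P) (beta S e)) (fob (pP P) (beta T (eM f e)))
          (farr (pP P) (beta S e) (beta T (eM f e)) (ebeta f e)) (iso_p S e)
        = cmp (gB P) (gamma S (pm S e)) (gamma T (eN f (pm S e))) (fob (pP P) (beta T (eM f e)))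
          (iso_p T (eM f e)) (egamma f (pm S e))) \<and>
     (\<forall>n\<in>nodes S.
        cmp (gI P) (alpha S (tm S n)) (fob (tP P) (gamma S n)) (fob (tP P) (gamma T (eN f n)))
          (farr (tP P) (gamma S n) (gamma T (eN f n)) (egamma f n)) (iso_t S n)
        = cmp (gI P) (alpha S (tm S n)) (alpha T (eA f (tm S n))) (fob (tP P) (gamma T (eN f n)))
          (iso_t T (eN f n)) (ealpha f (tm S n)))"

definition ptree_cat :: "('i, 'ia, 'e, 'ea, 'b, 'ba) poly_diagram \<Rightarrow>
    (('v, 'i, 'ia, 'e, 'b, 'ba) ptree, ('v, 'ia, 'ea, 'ba) emb) cat" where
  "ptree_cat P = \<lparr>
     obj = {T. is_ptree P T},
     hom = \<lambda>S T. {f. is_ptree_embedding P S T f},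
     cmp = \<lambda>S T U g f. \<lparr>
       eA = \<lambda>x\<in>edges S. eA g (eA f x),
       eM = \<lambda>e\<in>inputs S. eM g (eM f e),
       eN = \<lambda>n\<in>nodes S. eN g (eN f n),
       ealpha = \<lambda>x\<in>edges S. cmp (gI P) (alpha S x) (alpha T (eA f x)) (alpha U (eA g (eA f x)))
         (ealpha g (eA f x)) (ealpha f x),
       ebeta = \<lambda>e\<in>inputs S. cmp (gE P) (beta S e) (beta T (eM f e)) (beta U (eM g (eM f e)))
         (ebeta g (eM f e)) (ebeta f e),
       egamma = \<lambda>n\<in>nodes S. cmp (gB P) (gamma S n) (gamma T (eN f n)) (gamma U (eN g (eN f n)))
         (egamma g (eN f n)) (egamma f n)\<rparr>,
     idt = \<lambda>S. \<lparr>
       eA = \<lambda>x\<in>edges S. x,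
       eM = \<lambda>e\<in>inputs S. e,
       eN = \<lambda>n\<in>nodes S. n,
       ealpha = \<lambda>x\<in>edges S. idt (gI P) (alpha S x),
       ebeta = \<lambda>e\<in>inputs S. idt (gE P) (beta S e),
       egamma = \<lambda>n\<in>nodes S. idt (gB P) (gamma S n)\<rparr>\<rparr>"

definition ptrees :: "('i, 'ia, 'e, 'ea, 'b, 'ba) poly_diagram \<Rightarrow>
    (('v, 'i, 'ia, 'e, 'b, 'ba) ptree, ('v, 'ia, 'ea, 'ba) emb) cat" where
  "ptrees P = core (ptree_cat P)"

type_synonym ('v, 'i, 'ia, 'e, 'b, 'ba) pforest =
  "'v set \<times> ('v \<Rightarrow> ('v, 'i, 'ia, 'e, 'b, 'ba) ptree)"

type_synonym ('v, 'ia, 'ea, 'ba) pforest_arr =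
  "('v \<Rightarrow> 'v) \<times> ('v \<Rightarrow> ('v, 'ia, 'ea, 'ba) emb)"

definition pforests :: "('i, 'ia, 'e, 'ea, 'b, 'ba) poly_diagram \<Rightarrow>
    (('v, 'i, 'ia, 'e, 'b, 'ba) pforest, ('v, 'ia, 'ea, 'ba) pforest_arr) cat" where
  "pforests P = families (ptrees P)"

definition leaf_func :: "(('v, 'i, 'ia, 'e, 'b, 'ba) ptree, ('v, 'ia, 'ea, 'ba) emb,
    'v set \<times> ('v \<Rightarrow> 'i), ('v \<Rightarrow> 'v) \<times> ('v \<Rightarrow> 'ia)) func" where
  "leaf_func = \<lparr>
     fob = \<lambda>T. (leaves T, \<lambda>l\<in>leaves T. alpha T l),
     farr = \<lambda>S T f. (\<lambda>l\<in>leaves S. eA f l, \<lambda>l\<in>leaves S. ealpha f l)\<rparr>"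

definition root_func :: "(('v, 'i, 'ia, 'e, 'b, 'ba) pforest, ('v, 'ia, 'ea, 'ba) pforest_arr,
    'v set \<times> ('v \<Rightarrow> 'i), ('v \<Rightarrow> 'v) \<times> ('v \<Rightarrow> 'ia)) func" where
  "root_func = \<lparr>
     fob = \<lambda>(X, N). (X, \<lambda>x\<in>X. alpha (N x) (tree_root (N x))),
     farr = \<lambda>(X, N) (X', N') (f, \<phi>). (f, \<lambda>x\<in>X. ealpha (\<phi> x) (tree_root (N x)))\<rparr>"


section \<open>Trees with a cut\<close>

text \<open>The triple \<open>(S, T, c)\<close> is the embedding \<open>c\<close> from \<open>S\<close> to \<open>T\<close>; an arrow is a pair
  \<open>(\<tau>, \<sigma>)\<close> with \<open>\<tau>\<close> between the ambient trees.\<close>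

type_synonym ('v, 'i, 'ia, 'e, 'ea, 'b, 'ba) pcut =
  "('v, 'i, 'ia, 'e, 'b, 'ba) ptree \<times> ('v, 'i, 'ia, 'e, 'b, 'ba) ptree \<times> ('v, 'ia, 'ea, 'ba) emb"

type_synonym ('v, 'ia, 'ea, 'ba) pcut_arr =
  "('v, 'ia, 'ea, 'ba) emb \<times> ('v, 'ia, 'ea, 'ba) emb"

definition pcuts :: "('i, 'ia, 'e, 'ea, 'b, 'ba) poly_diagram \<Rightarrow>
    (('v, 'i, 'ia, 'e, 'ea, 'b, 'ba) pcut, ('v, 'ia, 'ea, 'ba) pcut_arr) cat" where
  "pcuts P = \<lparr>
     obj = {(S, T, c). is_ptree P S \<and> is_ptree P T \<and> is_ptree_embedding P S T c \<and>
        eA c (tree_root S) = tree_root T},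
     hom = \<lambda>(S, T, c) (S', T', c'). {(\<tau>, \<sigma>). \<tau> \<in> hom (ptrees P) T T' \<and> \<sigma> \<in> hom (ptrees P) S S' \<and>
        cmp (ptree_cat P) S T T' \<tau> c = cmp (ptree_cat P) S S' T' c' \<sigma>},
     cmp = \<lambda>(S, T, _) (S', T', _) (S'', T'', _) (\<tau>', \<sigma>') (\<tau>, \<sigma>).
        (cmp (ptrees P) T T' T'' \<tau>' \<tau>, cmp (ptrees P) S S' S'' \<sigma>' \<sigma>),
     idt = \<lambda>(S, T, _). (idt (ptrees P) T, idt (ptrees P) S)\<rparr>"

definition ideal_edges :: "('v, 'z) tree_scheme \<Rightarrow> 'v \<Rightarrow> 'v set" where
  "ideal_edges T r = {x \<in> edges T. \<exists>k. (next_edge T ^^ k) x = r}"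

definition ideal_nodes :: "('v, 'z) tree_scheme \<Rightarrow> 'v \<Rightarrow> 'v set" where
  "ideal_nodes T r = {n \<in> nodes T. tm T n \<in> ideal_edges T r}"

definition ideal_inputs :: "('v, 'z) tree_scheme \<Rightarrow> 'v \<Rightarrow> 'v set" where
  "ideal_inputs T r = {e \<in> inputs T. pm T e \<in> ideal_nodes T r}"

definition ideal_subtree ::
  "('v, 'i, 'ia, 'e, 'b, 'ba) ptree \<Rightarrow> 'v \<Rightarrow> ('v, 'i, 'ia, 'e, 'b, 'ba) ptree" where
  "ideal_subtree T r = \<lparr>
     edges = ideal_edges T r,
     inputs = ideal_inputs T r,
     nodes = ideal_nodes T r,
     sm = restrict (sm T) (ideal_inputs T r),
     pm = restrict (pm T) (ideal_inputs T r),
     tm = restrict (tm T) (ideal_nodes T r),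
     alpha = restrict (alpha T) (ideal_edges T r),
     beta = restrict (beta T) (ideal_inputs T r),
     gamma = restrict (gamma T) (ideal_nodes T r),
     iso_s = restrict (iso_s T) (ideal_inputs T r),
     iso_p = restrict (iso_p T) (ideal_inputs T r),
     iso_t = restrict (iso_t T) (ideal_nodes T r)\<rparr>"

definition emb_restrict :: "('v, 'ia, 'ea, 'ba) emb \<Rightarrow> ('v, 'z) tree_scheme \<Rightarrow>
    ('v, 'ia, 'ea, 'ba) emb" where
  "emb_restrict f S = \<lparr>
     eA = restrict (eA f) (edges S),
     eM = restrict (eM f) (inputs S),
     eN = restrict (eN f) (nodes S),
     ealpha = restrict (ealpha f) (edges S),
     ebeta = restrict (ebeta f) (inputs S),
     egamma = restrict (egamma f) (nodes S)\<rparr>"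

definition r_func :: "(('v, 'i, 'ia, 'e, 'ea, 'b, 'ba) pcut, ('v, 'ia, 'ea, 'ba) pcut_arr,
    ('v, 'i, 'ia, 'e, 'b, 'ba) ptree, ('v, 'ia, 'ea, 'ba) emb) func" where
  "r_func = \<lparr>fob = \<lambda>(S, T, c). S, farr = \<lambda>_ _ (\<tau>, \<sigma>). \<sigma>\<rparr>"

definition w_func :: "(('v, 'i, 'ia, 'e, 'ea, 'b, 'ba) pcut, ('v, 'ia, 'ea, 'ba) pcut_arr,
    ('v, 'i, 'ia, 'e, 'b, 'ba) pforest, ('v, 'ia, 'ea, 'ba) pforest_arr) func" where
  "w_func = \<lparr>
     fob = \<lambda>(S, T, c). (leaves S, \<lambda>l\<in>leaves S. ideal_subtree T (eA c l)),
     farr = \<lambda>(S, T, c) _ (\<tau>, \<sigma>). (\<lambda>l\<in>leaves S. eA \<sigma> l,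
        \<lambda>l\<in>leaves S. emb_restrict \<tau> (ideal_subtree T (eA c l)))\<rparr>"

text \<open>The root of the tree of \<open>P\<^sub>c\<close> indexed by the leaf \<open>l\<close> has colour \<open>alpha T (eA c l)\<close>, which
  \<open>c\<close> identifies with \<open>alpha S l\<close>.\<close>

definition cut_iso :: "('i, 'ia, 'e, 'ea, 'b, 'ba) poly_diagram \<Rightarrow>
    ('v, 'i, 'ia, 'e, 'ea, 'b, 'ba) pcut \<Rightarrow> ('v \<Rightarrow> 'v) \<times> ('v \<Rightarrow> 'ia)" where
  "cut_iso P = (\<lambda>(S, T, c). (\<lambda>l\<in>leaves S. l,
     \<lambda>l\<in>leaves S. inv_arr (gI P) (alpha S l) (alpha T (eA c l)) (ealpha c l)))"

end

(* By well-foundedness of the parent function, a root-preserving embedding c : S -> T is injective,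
   and T is the union of c(S) and of the ideal subtrees at the edges c(l), l a leaf of S; each ideal
   subtree meets c(S) only in c(l), and distinct ones are disjoint. Hence T is the pushout of S and
   these subtrees along the leaves of S: a map out of T is the same as a map out of S and a map out
   of each subtree that agree, colours included, on the edges c(l). Applied to arrows of the homotopy
   pullback and to their inverses, this makes the comparison functor fully faithful. It is
   essentially surjective because a forest can be grafted onto the leaves of a tree; the trees
   grafted on are identified with the ideal subtrees since a root-preserving embedding that sends
   leaves to leaves is invertible, again by the pushout property. *)

theory Submission
  imports Defs
begin


section \<open>Groupoids\<close>

text \<open>What has to be controlled are the decorations. The homotopy pullback condition on a
  \<open>P\<close>-tree cannot be cut or glued as it stands. Since inputs and nodes form discrete
  groupoids, it splits into one condition \<open>fibre_equiv\<close> per node, on the inputs at that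
  node. Ideal subtrees keep these fibres and grafts keep them up to renaming, so both inherit the
  condition; the pullback condition on embeddings splits in the same way. The overlap of
  \<open>S\<close> with a branch is a single edge. So gluing requires an equality of edges and an
  equation between colour isomorphisms at each leaf, and nothing on nodes or inputs. The equation is
  the commuting square in an arrow of the homotopy pullback, once the inverses in
  \<open>cut_iso\<close> are moved across by \<open>inv_square_iff\<close>. In a graft, the root of
  a tree and the leaf it is attached to have isomorphic, not equal, colours. The merged edge keeps
  the colour of the leaf, and the structure isomorphisms of the attached tree are corrected by
  \<phi>. The disjoint union behind the graft has to fit into the type of vertices, which is where
  its infinity enters.\<close>

lemma (in category) inverse_arrows_unique:
  assumes "x \<in> obj C" "y \<in> obj C" "inverse_arrows C x y f g" "inverse_arrows C x y f g'"
  shows "g = g'"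
proof -
  have *: "f \<in> hom C x y" "g \<in> hom C y x" "g' \<in> hom C y x" "cmp C x y x g f = idt C x"
    "cmp C y x y f g' = idt C y"
    using assms by (auto simp: inverse_arrows_def)
  have "g = cmp C y y x g (cmp C y x y f g')"
    using * assms by (simp add: cmp_idt_right)
  also have "\<dots> = cmp C y x x (cmp C x y x g f) g'"
    using * assms by (intro cmp_assoc)
  finally show ?thesis using * assms by (simp add: cmp_idt_left)
qed

context groupoid
begin

lemma inverse_arrows_inv_arr:
  assumes "x \<in> obj C" "y \<in> obj C" "f \<in> hom C x y"
  shows "inverse_arrows C x y f (inv_arr C x y f)"
proof -
  obtain g where "inverse_arrows C x y f g" using all_iso assms unfolding is_iso_def by blast
  then show ?thesis unfolding inv_arr_def
    using inverse_arrows_unique[OF assms(1,2)] by (metis theI)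
qed

lemma inv_arr_hom: "\<lbrakk>x \<in> obj C; y \<in> obj C; f \<in> hom C x y\<rbrakk> \<Longrightarrow> inv_arr C x y f \<in> hom C y x"
  and cmp_inv_left: "\<lbrakk>x \<in> obj C; y \<in> obj C; f \<in> hom C x y\<rbrakk>
    \<Longrightarrow> cmp C x y x (inv_arr C x y f) f = idt C x"
  and cmp_inv_right: "\<lbrakk>x \<in> obj C; y \<in> obj C; f \<in> hom C x y\<rbrakk>
    \<Longrightarrow> cmp C y x y f (inv_arr C x y f) = idt C y"
  using inverse_arrows_inv_arr unfolding inverse_arrows_def by blast+

lemma cmp_inv_cancel:
  assumes "x \<in> obj C" "y \<in> obj C" "z \<in> obj C" "f \<in> hom C x y" "h \<in> hom C x z"
  shows "cmp C x y z (cmp C y x z h (inv_arr C x y f)) f = h"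
  using assms cmp_assoc[of x y x z f "inv_arr C x y f" h]
  by (simp add: inv_arr_hom cmp_inv_left cmp_idt_right)

lemma cmp_inv_cancel':
  assumes "x \<in> obj C" "y \<in> obj C" "z \<in> obj C" "f \<in> hom C x y" "h \<in> hom C y z"
  shows "cmp C y x z (cmp C x y z h f) (inv_arr C x y f) = h"
  using assms cmp_assoc[of y x y z "inv_arr C x y f" f h]
  by (simp add: inv_arr_hom cmp_inv_right cmp_idt_right)

lemma cmp_inv_cancel_left:
  assumes "x \<in> obj C" "y \<in> obj C" "z \<in> obj C" "f \<in> hom C y z" "h \<in> hom C x z"
  shows "cmp C x y z f (cmp C x z y (inv_arr C y z f) h) = h"
  using assms cmp_assoc[of x z y z h "inv_arr C y z f" f]
  by (simp add: inv_arr_hom cmp_inv_right cmp_idt_left)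

lemma cmp_inv_cancel_left':
  assumes "x \<in> obj C" "y \<in> obj C" "z \<in> obj C" "f \<in> hom C y z" "h \<in> hom C x y"
  shows "cmp C x z y (inv_arr C y z f) (cmp C x y z f h) = h"
  using assms cmp_assoc[of x y z y h f "inv_arr C y z f"]
  by (simp add: inv_arr_hom cmp_inv_left cmp_idt_left)

lemma right_cancel:
  assumes "cmp C x y z g f = cmp C x y z g' f" "x \<in> obj C" "y \<in> obj C" "z \<in> obj C"
    and "f \<in> hom C x y" "g \<in> hom C y z" "g' \<in> hom C y z"
  shows "g = g'"
  by (metis assms cmp_inv_cancel')

lemma left_cancel:
  assumes "cmp C x y z f g = cmp C x y z f g'" "x \<in> obj C" "y \<in> obj C" "z \<in> obj C"
    and "f \<in> hom C y z" "g \<in> hom C x y" "g' \<in> hom C x y"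
  shows "g = g'"
  by (metis assms cmp_inv_cancel_left')

end

section \<open>Cores, discrete groupoids and products\<close>

lemma core_simps [simp]:
  "obj (core C) = obj C" "cmp (core C) = cmp C" "idt (core C) = idt C"
  "f \<in> hom (core C) x y \<longleftrightarrow> is_iso C x y f"
  by (simp_all add: core_def)

lemma (in category) inverse_arrows_cmp:
  assumes "x \<in> obj C" "y \<in> obj C" "z \<in> obj C" "inverse_arrows C x y f f'" "inverse_arrows C y z g g'"
  shows "inverse_arrows C x z (cmp C x y z g f) (cmp C z y x f' g')"
proof -
  have *: "f \<in> hom C x y" "f' \<in> hom C y x" "g \<in> hom C y z" "g' \<in> hom C z y"
      "cmp C x y x f' f = idt C x" "cmp C y x y f f' = idt C y"
      "cmp C y z y g' g = idt C y" "cmp C z y z g g' = idt C z"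
    using assms by (auto simp: inverse_arrows_def)
  have "cmp C x z x (cmp C z y x f' g') (cmp C x y z g f)
      = cmp C x y x f' (cmp C x z y g' (cmp C x y z g f))"
    using assms * by (simp add: cmp_assoc[symmetric] cmp_hom)
  also have "cmp C x z y g' (cmp C x y z g f) = f"
    using assms * by (simp add: cmp_assoc cmp_idt_left)
  finally have 1: "cmp C x z x (cmp C z y x f' g') (cmp C x y z g f) = idt C x" using * by simp
  have "cmp C z x z (cmp C x y z g f) (cmp C z y x f' g')
      = cmp C z y z g (cmp C z x y f (cmp C z y x f' g'))"
    using assms * by (simp add: cmp_assoc[symmetric] cmp_hom)
  also have "cmp C z x y f (cmp C z y x f' g') = g'"
    using assms * by (simp add: cmp_assoc cmp_idt_left)
  finally show ?thesis unfolding inverse_arrows_def using 1 * assms by (simp add: cmp_hom)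
qed

lemma (in category) groupoid_core: "groupoid (core C)"
proof (unfold_locales, goal_cases)
  case (1 x)
  then show ?case
    by (auto simp: is_iso_def inverse_arrows_def idt_hom cmp_idt_left intro!: exI[of _ "idt C x"])
next
  case (2 x y z f g)
  then show ?case using inverse_arrows_cmp[of x y z] unfolding is_iso_def core_simps by blast
next
  case (6 x y f)
  then obtain g where g: "inverse_arrows C x y f g" unfolding core_simps is_iso_def by blast
  \<comment> \<open>The inverse must be an arrow of the core too, hence itself invertible.\<close>
  then have "inverse_arrows C y x g f" unfolding inverse_arrows_def by blast
  with g have "inverse_arrows (core C) x y f g"
    unfolding inverse_arrows_def[of "core C"] core_simps is_iso_def
    by (auto simp: inverse_arrows_def)
  then show ?case unfolding is_iso_def by blast
qed (auto simp: is_iso_def inverse_arrows_def cmp_idt_right cmp_idt_left intro!: cmp_assoc)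

lemma groupoid_discrete: "groupoid (discrete X)"
  by unfold_locales (auto simp: discrete_def is_iso_def inverse_arrows_def split: if_splits)

lemma groupoid_prod_cat:
  assumes "groupoid C" "groupoid D"
  shows "groupoid (prod_cat C D)"
proof -
  interpret C: groupoid C by fact
  interpret D: groupoid D by fact
  show ?thesis
  proof (unfold_locales, goal_cases)
    case (6 x y f)
    then show ?case
      using C.inverse_arrows_inv_arr[of "fst x" "fst y" "fst f"]
        D.inverse_arrows_inv_arr[of "snd x" "snd y" "snd f"]
      unfolding is_iso_def
      by (intro exI[of _ "(inv_arr C (fst x) (fst y) (fst f), inv_arr D (snd x) (snd y) (snd f))"])
        (auto simp: prod_cat_def inverse_arrows_def)
  qed (auto simp: prod_cat_def C.idt_hom D.idt_hom C.cmp_hom D.cmp_hom C.cmp_idt_left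
      D.cmp_idt_left C.cmp_idt_right D.cmp_idt_right C.cmp_assoc D.cmp_assoc)
qed

section \<open>Functors and their compatibility squares\<close>

lemma gfunctor_comp:
  assumes "gfunctor C D F" "gfunctor D E G"
  shows "gfunctor C E (func_comp G F)"
proof -
  interpret F: gfunctor C D F by fact
  interpret G: gfunctor D E G by fact
  show ?thesis
    by unfold_locales (auto simp: func_comp_def F.fob_obj F.farr_hom F.farr_idt F.farr_cmp
        G.fob_obj G.farr_hom G.farr_idt G.farr_cmp)
qed

lemma gfunctor_func_pair:
  assumes "gfunctor C D F" "gfunctor C E G"
  shows "gfunctor C (prod_cat D E) (func_pair F G)"
proof -
  interpret F: gfunctor C D F by fact
  interpret G: gfunctor C E G by fact
  interpret DE: groupoid "prod_cat D E"
    by (intro groupoid_prod_cat) unfold_locales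
  show ?thesis
    by unfold_locales (auto simp: func_pair_def prod_cat_def F.fob_obj F.farr_hom F.farr_idt
        F.farr_cmp G.fob_obj G.farr_hom G.farr_idt G.farr_cmp)
qed

lemma gfunctor_func_id: "groupoid C \<Longrightarrow> gfunctor C C func_id"
  by (simp add: gfunctor_def gfunctor_axioms_def func_id_def)

lemma gfunctor_disc_func:
  assumes "groupoid C" "N \<in> X \<rightarrow> obj C"
  shows "gfunctor (discrete X) C (disc_func C N)"
proof -
  interpret C: groupoid C by fact
  interpret X: groupoid "discrete X" by (rule groupoid_discrete)
  show ?thesis using assms
    by unfold_locales (auto simp: discrete_def disc_func_def C.idt_hom C.cmp_idt_left Pi_iff
        split: if_splits)
qed

text \<open>The shape of the three compatibility conditions of an embedding of \<open>P\<close>-trees.\<close>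

definition sqr :: "('p, 'b) cat \<Rightarrow> ('o, 'a, 'p, 'b) func \<Rightarrow> 'p \<Rightarrow> 'o \<Rightarrow> 'p \<Rightarrow> 'o \<Rightarrow>
    'b \<Rightarrow> 'b \<Rightarrow> 'b \<Rightarrow> 'a \<Rightarrow> bool" where
  "sqr D F d x d' x' i i' a b \<longleftrightarrow>
     cmp D d (fob F x) (fob F x') (farr F x x' b) i = cmp D d d' (fob F x') i' a"

context gfunctor
begin

text \<open>The squares are pasted along the middle structure arrow \<open>i'\<close>. This is what
  makes composites of embeddings of \<open>P\<close>-trees compatible with the decorations.\<close>

lemma sqr_cmp:
  assumes "d \<in> obj D" "d' \<in> obj D" "d'' \<in> obj D" "x \<in> obj C" "x' \<in> obj C" "x'' \<in> obj C"
    and "i \<in> hom D d (fob F x)" "i' \<in> hom D d' (fob F x')" "i'' \<in> hom D d'' (fob F x'')"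
    and "a \<in> hom D d d'" "a' \<in> hom D d' d''" "b \<in> hom C x x'" "b' \<in> hom C x' x''"
    and "sqr D F d x d' x' i i' a b" "sqr D F d' x' d'' x'' i' i'' a' b'"
  shows "sqr D F d x d'' x'' i i'' (cmp D d d' d'' a' a) (cmp C x x' x'' b' b)"
proof -
  have "cmp D d (fob F x) (fob F x'') (cmp D (fob F x) (fob F x') (fob F x'')
      (farr F x' x'' b') (farr F x x' b)) i
    = cmp D d (fob F x') (fob F x'') (farr F x' x'' b') (cmp D d d' (fob F x') i' a)"
    using assms by (simp add: D.cmp_assoc[symmetric] fob_obj farr_hom sqr_def)
  also have "\<dots> = cmp D d d' (fob F x'') (cmp D d' d'' (fob F x'') i'' a') a"
    using assms by (simp add: D.cmp_assoc fob_obj farr_hom sqr_def)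
  finally show ?thesis
    using assms by (simp add: sqr_def farr_cmp D.cmp_assoc fob_obj farr_hom)
qed

lemma sqr_idt:
  assumes "d \<in> obj D" "x \<in> obj C" "i \<in> hom D d (fob F x)"
  shows "sqr D F d x d x i i (idt D d) (idt C x)"
  using assms by (simp add: sqr_def farr_idt fob_obj D.cmp_idt_left D.cmp_idt_right)

text \<open>Since \<open>a\<close> is invertible, it can be cancelled from the pasted square, which
  leaves the second square. In a gluing this transfers compatibility from \<open>S\<close> to its
  image in \<open>T\<close>.\<close>

lemma sqr_cancel:
  assumes "d \<in> obj D" "d' \<in> obj D" "d'' \<in> obj D" "x \<in> obj C" "x' \<in> obj C" "x'' \<in> obj C"
    and "i \<in> hom D d (fob F x)" "i' \<in> hom D d' (fob F x')" "i'' \<in> hom D d'' (fob F x'')"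
    and "a \<in> hom D d d'" "a' \<in> hom D d' d''" "b \<in> hom C x x'" "b' \<in> hom C x' x''"
    and "sqr D F d x d' x' i i' a b"
    and "sqr D F d x d'' x'' i i'' (cmp D d d' d'' a' a) (cmp C x x' x'' b' b)"
  shows "sqr D F d' x' d'' x'' i' i'' a' b'"
  unfolding sqr_def
proof (rule D.right_cancel)
  have "cmp D d d' (fob F x'') (cmp D d' (fob F x') (fob F x'') (farr F x' x'' b') i') a
    = cmp D d (fob F x') (fob F x'') (farr F x' x'' b') (cmp D d (fob F x) (fob F x') (farr F x x' b) i)"
    using assms by (simp add: D.cmp_assoc[symmetric] fob_obj farr_hom sqr_def)
  also have "\<dots> = cmp D d (fob F x) (fob F x'') (farr F x x'' (cmp C x x' x'' b' b)) i"
    using assms by (simp add: D.cmp_assoc fob_obj farr_hom farr_cmp)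
  also have "\<dots> = cmp D d d' (fob F x'') (cmp D d' d'' (fob F x'') i'' a') a"
    using assms by (simp add: D.cmp_assoc fob_obj farr_hom sqr_def)
  finally show "cmp D d d' (fob F x'') (cmp D d' (fob F x') (fob F x'') (farr F x' x'' b') i') a
    = cmp D d d' (fob F x'') (cmp D d' d'' (fob F x'') i'' a') a" .
qed (use assms in \<open>auto simp: fob_obj farr_hom intro!: D.cmp_hom\<close>)

end


section \<open>Equivalences as fully faithful and essentially surjective functors\<close>

section \<open>Equivalences\<close>

definition fully_faithful :: "('o, 'a) cat \<Rightarrow> ('p, 'b) cat \<Rightarrow> ('o, 'a, 'p, 'b) func \<Rightarrow> bool" where
  "fully_faithful C D F \<longleftrightarrow>
     (\<forall>x\<in>obj C. \<forall>y\<in>obj C. bij_betw (farr F x y) (hom C x y) (hom D (fob F x) (fob F y)))"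

definition ess_surj :: "('o, 'a) cat \<Rightarrow> ('p, 'b) cat \<Rightarrow> ('o, 'a, 'p, 'b) func \<Rightarrow> bool" where
  "ess_surj C D F \<longleftrightarrow> (\<forall>d\<in>obj D. \<exists>x\<in>obj C. hom D (fob F x) d \<noteq> {})"

lemma equivalence_ess_surj:
  assumes "equivalence C D F"
  shows "ess_surj C D F"
proof -
  obtain G \<epsilon> where G: "gfunctor D C G" "nat_iso D D (func_comp F G) func_id \<epsilon>"
    using assms unfolding equivalence_def by blast
  interpret G: gfunctor D C G by fact
  have "\<epsilon> d \<in> hom D (fob F (fob G d)) d" if "d \<in> obj D" for d
    using G(2) that by (auto simp: nat_iso_def func_comp_def func_id_def)
  then show ?thesis unfolding ess_surj_def using G.fob_obj by blast
qed

text \<open>Naturality of \<epsilon> makes \<open>G\<close> faithful and naturality of \<eta> makes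
  \<open>F\<close> faithful. For fullness, \<open>G h\<close> is transported along \<eta> to an
  arrow \<open>f\<close>; then \<open>G (F f) = G h\<close>, and faithfulness of \<open>G\<close>
  gives \<open>F f = h\<close>.\<close>

lemma equivalence_fully_faithful:
  assumes "equivalence C D F"
  shows "fully_faithful C D F"
proof -
  obtain G \<eta> \<epsilon> where G: "gfunctor C D F" "gfunctor D C G"
    "nat_iso C C func_id (func_comp G F) \<eta>" "nat_iso D D (func_comp F G) func_id \<epsilon>"
    using assms unfolding equivalence_def by blast
  interpret F: gfunctor C D F by fact
  interpret G: gfunctor D C G by fact
  note simps = nat_iso_def func_comp_def func_id_def
  have \<eta>: "\<eta> x \<in> hom C x (fob G (fob F x))" if "x \<in> obj C" for x
    using G(3) that by (auto simp: simps)
  have \<eta>_nat: "cmp C x y (fob G (fob F y)) (\<eta> y) f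
      = cmp C x (fob G (fob F x)) (fob G (fob F y)) (farr G (fob F x) (fob F y) (farr F x y f)) (\<eta> x)"
    if "x \<in> obj C" "y \<in> obj C" "f \<in> hom C x y" for x y f
    using G(3) that by (auto simp: simps)
  have \<epsilon>: "\<epsilon> x \<in> hom D (fob F (fob G x)) x" if "x \<in> obj D" for x
    using G(4) that by (auto simp: simps)
  have \<epsilon>_nat: "cmp D (fob F (fob G x)) (fob F (fob G y)) y (\<epsilon> y)
        (farr F (fob G x) (fob G y) (farr G x y f))
      = cmp D (fob F (fob G x)) x y f (\<epsilon> x)"
    if "x \<in> obj D" "y \<in> obj D" "f \<in> hom D x y" for x y f
    using G(4) that by (auto simp: simps)
  note mem = F.fob_obj G.fob_obj F.farr_hom G.farr_hom \<eta> \<epsilon>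
  have G_inj: "f = g" if "x \<in> obj D" "y \<in> obj D" "f \<in> hom D x y" "g \<in> hom D x y"
    "farr G x y f = farr G x y g" for x y f g
  proof (rule F.D.right_cancel)
    show "cmp D (fob F (fob G x)) x y f (\<epsilon> x) = cmp D (fob F (fob G x)) x y g (\<epsilon> x)"
      using that \<epsilon>_nat[of x y f] \<epsilon>_nat[of x y g] by simp
  qed (use that in \<open>simp_all add: mem\<close>)
  have F_inj: "f = g" if "x \<in> obj C" "y \<in> obj C" "f \<in> hom C x y" "g \<in> hom C x y"
    "farr F x y f = farr F x y g" for x y f g
  proof (rule F.C.left_cancel)
    show "cmp C x y (fob G (fob F y)) (\<eta> y) f = cmp C x y (fob G (fob F y)) (\<eta> y) g"
      using that \<eta>_nat[of x y f] \<eta>_nat[of x y g] by simp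
  qed (use that in \<open>simp_all add: mem\<close>)
  have F_surj: "\<exists>f\<in>hom C x y. farr F x y f = h"
    if "x \<in> obj C" "y \<in> obj C" "h \<in> hom D (fob F x) (fob F y)" for x y h
  proof -
    let ?x = "fob G (fob F x)" and ?y = "fob G (fob F y)"
    define k where "k = cmp C x ?x ?y (farr G (fob F x) (fob F y) h) (\<eta> x)"
    define f where "f = cmp C x ?y y (inv_arr C y ?y (\<eta> y)) k"
    have k: "k \<in> hom C x ?y" unfolding k_def using that by (intro F.C.cmp_hom) (auto simp: mem)
    have f: "f \<in> hom C x y"
      unfolding f_def using that k by (intro F.C.cmp_hom) (auto simp: mem F.C.inv_arr_hom)
    have "cmp C x y ?y (\<eta> y) f = k"
      unfolding f_def using that k by (intro F.C.cmp_inv_cancel_left) (auto simp: mem)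
    then have "cmp C x ?x ?y (farr G (fob F x) (fob F y) (farr F x y f)) (\<eta> x)
        = cmp C x ?x ?y (farr G (fob F x) (fob F y) h) (\<eta> x)"
      using that f \<eta>_nat[of x y f] unfolding k_def by simp
    then have "farr G (fob F x) (fob F y) (farr F x y f) = farr G (fob F x) (fob F y) h"
      by (rule F.C.right_cancel) (use that f in \<open>auto simp: mem\<close>)
    then have "farr F x y f = h" using that f by (intro G_inj) (auto simp: mem)
    then show ?thesis using f by blast
  qed
  show ?thesis unfolding fully_faithful_def bij_betw_def
    using F_inj F_surj by (auto intro!: inj_onI simp: mem image_iff) metis
qed

text \<open>The quasi-inverse picks an object \<open>g d\<close> and an arrow \<epsilon> at
  \<open>d\<close> from \<open>F (g d)\<close> to \<open>d\<close>. On arrows it is the unique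
  solution \<open>l\<close> of the naturality equation for \<epsilon>, so \<epsilon> is natural by
  definition and functoriality follows from the uniqueness \<open>l_eq\<close>.\<close>

lemma equivalenceI:
  assumes "gfunctor C D F" "fully_faithful C D F" "ess_surj C D F"
  shows "equivalence C D F"
proof -
  interpret F: gfunctor C D F by fact
  obtain g where g: "\<And>d. d \<in> obj D \<Longrightarrow> g d \<in> obj C \<and> hom D (fob F (g d)) d \<noteq> {}"
    using assms(3) unfolding ess_surj_def by metis
  then have "\<forall>d\<in>obj D. \<exists>e. e \<in> hom D (fob F (g d)) d" by blast
  then obtain \<epsilon> where \<epsilon>: "\<And>d. d \<in> obj D \<Longrightarrow> \<epsilon> d \<in> hom D (fob F (g d)) d" by metis
  have F_inj: "f = f'" if "x \<in> obj C" "y \<in> obj C" "f \<in> hom C x y" "f' \<in> hom C x y"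
    "farr F x y f = farr F x y f'" for x y f f'
    using assms(2) that unfolding fully_faithful_def bij_betw_def by (meson inj_onD)
  have F_surj: "\<exists>f\<in>hom C x y. farr F x y f = h"
    if "x \<in> obj C" "y \<in> obj C" "h \<in> hom D (fob F x) (fob F y)" for x y h
  proof -
    have "h \<in> farr F x y ` hom C x y"
      using assms(2) that unfolding fully_faithful_def bij_betw_def by simp
    then show ?thesis by blast
  qed
  note mem = F.fob_obj F.farr_hom g \<epsilon>
  have ex_lift: "\<exists>f\<in>hom C (g d) (g d').
      cmp D (fob F (g d)) (fob F (g d')) d' (\<epsilon> d') (farr F (g d) (g d') f)
      = cmp D (fob F (g d)) d d' h (\<epsilon> d)"
    if "d \<in> obj D" "d' \<in> obj D" "h \<in> hom D d d'" for d d' h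
  proof -
    let ?k = "cmp D (fob F (g d)) d' (fob F (g d')) (inv_arr D (fob F (g d')) d' (\<epsilon> d'))
      (cmp D (fob F (g d)) d d' h (\<epsilon> d))"
    have "cmp D (fob F (g d)) d d' h (\<epsilon> d) \<in> hom D (fob F (g d)) d'"
      using that by (intro F.D.cmp_hom) (auto simp: mem)
    note k = this
    have "?k \<in> hom D (fob F (g d)) (fob F (g d'))"
      using that k by (intro F.D.cmp_hom) (auto simp: mem F.D.inv_arr_hom)
    then have "\<exists>f\<in>hom C (g d) (g d'). farr F (g d) (g d') f = ?k"
      using F_surj[of "g d" "g d'" ?k] g[OF that(1)] g[OF that(2)] by blast
    then obtain f where f: "f \<in> hom C (g d) (g d')" "farr F (g d) (g d') f = ?k" by blast
    have "cmp D (fob F (g d)) (fob F (g d')) d' (\<epsilon> d') ?k = cmp D (fob F (g d)) d d' h (\<epsilon> d)"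
      using that k by (intro F.D.cmp_inv_cancel_left) (auto simp: mem)
    then show ?thesis using f(2) by (intro bexI[OF _ f(1)]) simp
  qed
  define l where "l d d' h = (SOME f. f \<in> hom C (g d) (g d') \<and>
      cmp D (fob F (g d)) (fob F (g d')) d' (\<epsilon> d') (farr F (g d) (g d') f)
      = cmp D (fob F (g d)) d d' h (\<epsilon> d))" for d d' h
  have l: "l d d' h \<in> hom C (g d) (g d')"
    "cmp D (fob F (g d)) (fob F (g d')) d' (\<epsilon> d') (farr F (g d) (g d') (l d d' h))
      = cmp D (fob F (g d)) d d' h (\<epsilon> d)"
    if "d \<in> obj D" "d' \<in> obj D" "h \<in> hom D d d'" for d d' h
    using someI_ex[OF ex_lift[OF that, unfolded Bex_def]] unfolding l_def by auto
  have l_eq: "l d d' h = f"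
    if "d \<in> obj D" "d' \<in> obj D" "h \<in> hom D d d'" "f \<in> hom C (g d) (g d')"
    "cmp D (fob F (g d)) (fob F (g d')) d' (\<epsilon> d') (farr F (g d) (g d') f)
      = cmp D (fob F (g d)) d d' h (\<epsilon> d)" for d d' h f
  proof (rule F_inj[of "g d" "g d'"], goal_cases)
    case 5
    have "cmp D (fob F (g d)) (fob F (g d')) d' (\<epsilon> d') (farr F (g d) (g d') (l d d' h))
      = cmp D (fob F (g d)) (fob F (g d')) d' (\<epsilon> d') (farr F (g d) (g d') f)"
      using that l[OF that(1-3)] by simp
    then show ?case by (rule F.D.left_cancel) (use that l(1)[OF that(1-3)] in \<open>simp_all add: mem\<close>)
  qed (use that l(1)[OF that(1-3)] in \<open>simp_all add: mem\<close>)
  define G where "G = \<lparr>fob = g, farr = l\<rparr>"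
  have G: "gfunctor D C G"
  proof (unfold_locales, goal_cases)
    case (3 x)
    then show ?case unfolding G_def
      by (auto intro!: l_eq simp: F.D.idt_hom F.C.idt_hom mem F.farr_idt F.D.cmp_idt_left F.D.cmp_idt_right)
  next
    case (4 x y z f h)
    have "cmp D (fob F (g x)) (fob F (g z)) z (\<epsilon> z) (cmp D (fob F (g x)) (fob F (g y)) (fob F (g z))
        (farr F (g y) (g z) (l y z h)) (farr F (g x) (g y) (l x y f)))
      = cmp D (fob F (g x)) (fob F (g y)) z (cmp D (fob F (g y)) y z h (\<epsilon> y)) (farr F (g x) (g y) (l x y f))"
      using 4 by (simp add: F.D.cmp_assoc mem l)
    also have "\<dots> = cmp D (fob F (g x)) y z h (cmp D (fob F (g x)) x y f (\<epsilon> x))"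
      using 4 by (simp add: F.D.cmp_assoc[symmetric] mem l)
    finally show ?case using 4 unfolding G_def
      by (auto intro!: l_eq simp: F.D.cmp_hom F.C.cmp_hom mem F.farr_cmp l F.D.cmp_assoc)
  qed (auto simp: G_def mem l)
  \<comment> \<open>The unit at \<open>x\<close> is the preimage under \<open>F\<close> of the
    inverse of the counit at \<open>F x\<close>; its naturality can then be checked after applying
    the faithful functor \<open>F\<close>.\<close>
  have "\<exists>e\<in>hom C x (g (fob F x)). farr F x (g (fob F x)) e = inv_arr D (fob F (g (fob F x))) (fob F x) (\<epsilon> (fob F x))"
    if "x \<in> obj C" for x
    using that by (intro F_surj) (auto simp: mem F.D.inv_arr_hom)
  then obtain \<eta> where \<eta>: "\<And>x. x \<in> obj C \<Longrightarrow> \<eta> x \<in> hom C x (g (fob F x))"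
    "\<And>x. x \<in> obj C \<Longrightarrow> farr F x (g (fob F x)) (\<eta> x) = inv_arr D (fob F (g (fob F x))) (fob F x) (\<epsilon> (fob F x))"
    by metis
  have "nat_iso C C func_id (func_comp G F) \<eta>"
    unfolding nat_iso_def
  proof (intro conjI ballI gfunctor_func_id gfunctor_comp[OF assms(1) G], goal_cases)
    case (3 x y f)
    let ?x = "fob F x" and ?y = "fob F y"
    let ?x' = "fob F (g ?x)" and ?y' = "fob F (g ?y)" and ?f = "farr F x y f"
    let ?l = "farr F (g ?x) (g ?y) (l ?x ?y ?f)"
    let ?ix = "inv_arr D ?x' ?x (\<epsilon> ?x)" and ?iy = "inv_arr D ?y' ?y (\<epsilon> ?y)"
    have "cmp D ?x' ?x ?y' (cmp D ?x ?x' ?y' ?l ?ix) (\<epsilon> ?x) = ?l"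
      using 3 by (intro F.D.cmp_inv_cancel) (auto simp: mem l)
    also have "\<dots> = cmp D ?x' ?y ?y' ?iy (cmp D ?x' ?y' ?y (\<epsilon> ?y) ?l)"
      using 3 by (intro F.D.cmp_inv_cancel_left'[symmetric]) (auto simp: mem l)
    also have "\<dots> = cmp D ?x' ?x ?y' (cmp D ?x ?y ?y' ?iy ?f) (\<epsilon> ?x)"
      using 3 by (simp add: l mem F.D.cmp_assoc F.D.inv_arr_hom)
    finally have "cmp D ?x ?x' ?y' ?l ?ix = cmp D ?x ?y ?y' ?iy ?f"
      by (rule F.D.right_cancel)
        (use 3 in \<open>auto simp: mem l F.D.inv_arr_hom intro!: F.D.cmp_hom\<close>)
    then have "cmp C x (g ?x) (g ?y) (l ?x ?y ?f) (\<eta> x) = cmp C x y (g ?y) (\<eta> y) f"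
      by (intro F_inj[of x "g ?y"]) (use 3 in \<open>auto simp: mem l \<eta> F.farr_cmp intro!: F.C.cmp_hom\<close>)
    then show ?case by (simp add: func_id_def func_comp_def G_def)
  qed (auto simp: func_id_def func_comp_def G_def \<eta> F.C.groupoid_axioms)
  moreover have "nat_iso D D (func_comp F G) func_id \<epsilon>"
    unfolding nat_iso_def
    by (intro conjI ballI gfunctor_func_id gfunctor_comp[OF G assms(1)])
       (auto simp: func_id_def func_comp_def G_def l \<epsilon> F.D.groupoid_axioms)
  ultimately show ?thesis unfolding equivalence_def using assms(1) G by blast
qed

section \<open>Homotopy pullbacks and their fibrewise form over discrete groupoids\<close>

lemma groupoid_hpullback:
  assumes "gfunctor X S F" "gfunctor Y S G"
  shows "groupoid (hpullback X Y S F G)"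
proof -
  interpret F: gfunctor X S F by fact
  interpret G: gfunctor Y S G by fact
  let ?H = "hpullback X Y S F G"
  note mem = F.fob_obj G.fob_obj F.farr_hom G.farr_hom
  have objE: "\<exists>a b \<phi>. x = (a, b, \<phi>) \<and> a \<in> obj X \<and> b \<in> obj Y \<and> \<phi> \<in> hom S (fob F a) (fob G b)"
    if "x \<in> obj ?H" for x
    using that by (auto simp: hpullback_def)
  \<comment> \<open>Composition and inverses are taken componentwise, so the only content is that
    the compatibility squares are preserved. Here two squares are pasted.\<close>
  have cmp_closed: "cmp S (fob F x) (fob G y) (fob G y'') (farr G y y'' (cmp Y y y' y'' b' b)) \<phi>
      = cmp S (fob F x) (fob F x'') (fob G y'') \<phi>'' (farr F x x'' (cmp X x x' x'' a' a))"
    if "x \<in> obj X" "x' \<in> obj X" "x'' \<in> obj X" "y \<in> obj Y" "y' \<in> obj Y" "y'' \<in> obj Y"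
      "\<phi> \<in> hom S (fob F x) (fob G y)" "\<phi>' \<in> hom S (fob F x') (fob G y')"
      "\<phi>'' \<in> hom S (fob F x'') (fob G y'')"
      "a \<in> hom X x x'" "a' \<in> hom X x' x''" "b \<in> hom Y y y'" "b' \<in> hom Y y' y''"
      "cmp S (fob F x) (fob G y) (fob G y') (farr G y y' b) \<phi>
        = cmp S (fob F x) (fob F x') (fob G y') \<phi>' (farr F x x' a)"
      "cmp S (fob F x') (fob G y') (fob G y'') (farr G y' y'' b') \<phi>'
        = cmp S (fob F x') (fob F x'') (fob G y'') \<phi>'' (farr F x' x'' a')"
    for x x' x'' y y' y'' \<phi> \<phi>' \<phi>'' a a' b b'
  proof -
    have "cmp S (fob F x) (fob G y) (fob G y'') (farr G y y'' (cmp Y y y' y'' b' b)) \<phi>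
      = cmp S (fob F x) (fob G y') (fob G y'') (farr G y' y'' b')
        (cmp S (fob F x) (fob F x') (fob G y') \<phi>' (farr F x x' a))"
      using that by (simp add: G.farr_cmp F.D.cmp_assoc[symmetric] mem)
    also have "\<dots> = cmp S (fob F x) (fob F x') (fob G y'')
        (cmp S (fob F x') (fob F x'') (fob G y'') \<phi>'' (farr F x' x'' a')) (farr F x x' a)"
      using that by (simp add: F.D.cmp_assoc mem)
    also have "\<dots> = cmp S (fob F x) (fob F x'') (fob G y'') \<phi>'' (farr F x x'' (cmp X x x' x'' a' a))"
      using that by (simp add: F.farr_cmp F.D.cmp_assoc mem)
    finally show ?thesis .
  qed
  \<comment> \<open>After composition with the invertible arrow \<open>F a\<close>, both sides
    reduce to \<phi>.\<close>
  have inv_closed: "cmp S (fob F x') (fob G y') (fob G y) (farr G y' y (inv_arr Y y y' b)) \<phi>'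
      = cmp S (fob F x') (fob F x) (fob G y) \<phi> (farr F x' x (inv_arr X x x' a))"
    if "x \<in> obj X" "x' \<in> obj X" "y \<in> obj Y" "y' \<in> obj Y"
      "\<phi> \<in> hom S (fob F x) (fob G y)" "\<phi>' \<in> hom S (fob F x') (fob G y')"
      "a \<in> hom X x x'" "b \<in> hom Y y y'"
      "cmp S (fob F x) (fob G y) (fob G y') (farr G y y' b) \<phi>
        = cmp S (fob F x) (fob F x') (fob G y') \<phi>' (farr F x x' a)"
    for x x' y y' \<phi> \<phi>' a b
  proof (rule F.D.right_cancel[of "fob F x" "fob F x'" "fob G y" _ "farr F x x' a"])
    let ?b = "farr G y' y (inv_arr Y y y' b)" and ?a = "farr F x' x (inv_arr X x x' a)"
    have "cmp S (fob F x) (fob F x') (fob G y) (cmp S (fob F x') (fob G y') (fob G y) ?b \<phi>')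
        (farr F x x' a)
      = cmp S (fob F x) (fob G y') (fob G y) ?b
          (cmp S (fob F x) (fob G y) (fob G y') (farr G y y' b) \<phi>)"
      using that by (simp add: F.D.cmp_assoc mem G.C.inv_arr_hom)
    also have "\<dots> = cmp S (fob F x) (fob G y) (fob G y)
        (cmp S (fob G y) (fob G y') (fob G y) ?b (farr G y y' b)) \<phi>"
      using that(1-8) by (simp add: F.D.cmp_assoc mem G.C.inv_arr_hom)
    also have "\<dots> = \<phi>"
      using that(1-8) by (simp add: G.farr_cmp[symmetric] G.C.inv_arr_hom G.C.cmp_inv_left
          G.farr_idt F.D.cmp_idt_left mem)
    also have "\<dots> = cmp S (fob F x) (fob F x) (fob G y) \<phi>
        (cmp S (fob F x) (fob F x') (fob F x) ?a (farr F x x' a))"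
      using that(1-8) by (simp add: F.farr_cmp[symmetric] F.C.inv_arr_hom F.C.cmp_inv_left
          F.farr_idt F.D.cmp_idt_right mem)
    also have "\<dots> = cmp S (fob F x) (fob F x') (fob G y)
        (cmp S (fob F x') (fob F x) (fob G y) \<phi> ?a) (farr F x x' a)"
      using that(1-8) by (simp add: F.D.cmp_assoc mem F.C.inv_arr_hom)
    finally show "cmp S (fob F x) (fob F x') (fob G y)
        (cmp S (fob F x') (fob G y') (fob G y) ?b \<phi>') (farr F x x' a)
      = cmp S (fob F x) (fob F x') (fob G y)
        (cmp S (fob F x') (fob F x) (fob G y) \<phi> ?a) (farr F x x' a)" .
  qed (use that in \<open>auto simp: mem F.C.inv_arr_hom G.C.inv_arr_hom intro!: F.D.cmp_hom\<close>)
  show ?thesis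
  proof (unfold_locales, goal_cases)
    case (1 x)
    then show ?case
      by (auto simp: hpullback_def F.C.idt_hom G.C.idt_hom F.farr_idt G.farr_idt
          F.D.cmp_idt_left F.D.cmp_idt_right mem)
  next
    case (2 x y z f g)
    then show ?case
      by (auto simp: hpullback_def intro!: F.C.cmp_hom G.C.cmp_hom cmp_closed)
  next
    case (6 x y f)
    obtain a b \<phi> where x: "x = (a, b, \<phi>)" "a \<in> obj X" "b \<in> obj Y" "\<phi> \<in> hom S (fob F a) (fob G b)"
      using objE 6 by blast
    obtain a' b' \<phi>' where y: "y = (a', b', \<phi>')" "a' \<in> obj X" "b' \<in> obj Y"
      "\<phi>' \<in> hom S (fob F a') (fob G b')"
      using objE 6 by blast
    obtain u v where uv: "f = (u, v)" by fastforce
    then have f: "u \<in> hom X a a'" "v \<in> hom Y b b'"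
      "cmp S (fob F a) (fob G b) (fob G b') (farr G b b' v) \<phi>
        = cmp S (fob F a) (fob F a') (fob G b') \<phi>' (farr F a a' u)"
      using 6 x y by (auto simp: hpullback_def)
    have "inverse_arrows ?H x y f (inv_arr X a a' u, inv_arr Y b b' v)"
      using inv_closed[OF x(2) y(2) x(3) y(3) x(4) y(4) f] f x y uv
      by (auto simp: inverse_arrows_def hpullback_def F.C.inv_arr_hom G.C.inv_arr_hom
          F.C.cmp_inv_left G.C.cmp_inv_left F.C.cmp_inv_right G.C.cmp_inv_right)
    then show ?case unfolding is_iso_def by blast
  qed (auto simp: hpullback_def F.C.cmp_idt_left G.C.cmp_idt_left F.C.cmp_idt_right
      G.C.cmp_idt_right F.C.cmp_assoc G.C.cmp_assoc)
qed

lemma gfunctor_hp_induced: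
  assumes "gfunctor X S F" "gfunctor Y S G" "gfunctor W X U" "gfunctor W Y V"
    "nat_iso W S (func_comp F U) (func_comp G V) \<theta>"
  shows "gfunctor W (hpullback X Y S F G) (hp_induced U V \<theta>)"
proof -
  interpret U: gfunctor W X U by fact
  interpret V: gfunctor W Y V by fact
  interpret H: groupoid "hpullback X Y S F G" using assms(1,2) by (rule groupoid_hpullback)
  show ?thesis
    using assms(5)
    by unfold_locales (auto simp: hpullback_def hp_induced_def nat_iso_def func_comp_def
        U.fob_obj V.fob_obj U.farr_hom V.farr_hom U.farr_idt V.farr_idt U.farr_cmp V.farr_cmp)
qed

text \<open>The functor from the discrete groupoid \<open>M\<close> to the homotopy fibre of \<open>p\<close> over \<open>g\<close>, with
  structure arrows \<open>\<phi>\<close>, is an equivalence.\<close>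

definition fibre_equiv :: "('e, 'ea) cat \<Rightarrow> ('b, 'ba) cat \<Rightarrow> ('e, 'ea, 'b, 'ba) func \<Rightarrow> 'b \<Rightarrow>
    'v set \<Rightarrow> ('v \<Rightarrow> 'e) \<Rightarrow> ('v \<Rightarrow> 'ba) \<Rightarrow> bool" where
  "fibre_equiv E B p g M \<beta> \<phi> \<longleftrightarrow>
     (\<forall>y\<in>obj E. \<forall>k\<in>hom B g (fob p y). \<exists>e\<in>M. \<exists>b\<in>hom E (\<beta> e) y.
        cmp B g (fob p (\<beta> e)) (fob p y) (farr p (\<beta> e) y b) (\<phi> e) = k) \<and>
     (\<forall>e\<in>M. \<forall>e'\<in>M. \<forall>b\<in>hom E (\<beta> e) (\<beta> e').
        cmp B g (fob p (\<beta> e)) (fob p (\<beta> e')) (farr p (\<beta> e) (\<beta> e') b) (\<phi> e) = \<phi> e'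
        \<longrightarrow> e = e' \<and> b = idt E (\<beta> e))"

lemma fibre_equiv_cong:
  assumes "\<And>e. e \<in> M \<Longrightarrow> \<beta> e = \<beta>' e" "\<And>e. e \<in> M \<Longrightarrow> \<phi> e = \<phi>' e"
  shows "fibre_equiv E B p g M \<beta> \<phi> \<longleftrightarrow> fibre_equiv E B p g M \<beta>' \<phi>'"
  using assms unfolding fibre_equiv_def by simp

text \<open>Grafting renames the inputs injectively; this moves the fibre condition along the
  renaming.\<close>

lemma fibre_equiv_image:
  assumes "inj_on h M"
  shows "fibre_equiv E B p g (h ` M) \<beta> \<phi> \<longleftrightarrow> fibre_equiv E B p g M (\<beta> \<circ> h) (\<phi> \<circ> h)"
  using assms unfolding fibre_equiv_def by (simp add: inj_on_eq_iff)

text \<open>The component in \<open>N\<close> of an arrow of the homotopy pullback is an equality,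
  so everything decomposes over the elements \<open>n\<close> of \<open>N\<close>. In each fibre,
  essential surjectivity is the first clause of \<open>fibre_equiv\<close> and full faithfulness the
  second.\<close>

lemma hpullback_square_discrete_iff:
  assumes "gfunctor E B p" "q \<in> M \<rightarrow> N" "\<gamma> \<in> N \<rightarrow> obj B" "\<beta> \<in> M \<rightarrow> obj E"
    and \<phi>: "\<And>e. e \<in> M \<Longrightarrow> \<phi> e \<in> hom B (\<gamma> (q e)) (fob p (\<beta> e))"
  shows "hpullback_square (discrete M) (discrete N) E B (disc_func B \<gamma>) p
      (disc_func (discrete N) q) (disc_func E \<beta>) \<phi>
    \<longleftrightarrow> (\<forall>n\<in>N. fibre_equiv E B p (\<gamma> n) {e \<in> M. q e = n} \<beta> \<phi>)" (is "?L \<longleftrightarrow> ?R")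
proof -
  interpret p: gfunctor E B p by fact
  let ?F = "disc_func B \<gamma>" and ?H = "hpullback (discrete N) E B (disc_func B \<gamma>) p"
  let ?K = "hp_induced (disc_func (discrete N) q) (disc_func E \<beta>) \<phi>"
  have F: "gfunctor (discrete N) B ?F"
    using assms by (intro gfunctor_disc_func) (auto intro: p.D.groupoid_axioms)
  have U: "gfunctor (discrete M) (discrete N) (disc_func (discrete N) q)"
    using assms by (intro gfunctor_disc_func groupoid_discrete) (auto simp: discrete_def)
  have V: "gfunctor (discrete M) E (disc_func E \<beta>)"
    using assms by (intro gfunctor_disc_func) (auto intro: p.C.groupoid_axioms)
  have mem: "\<And>e. e \<in> M \<Longrightarrow> \<beta> e \<in> obj E" "\<And>e. e \<in> M \<Longrightarrow> q e \<in> N" "\<And>e. e \<in> M \<Longrightarrow> \<gamma> (q e) \<in> obj B"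
    "\<And>n. n \<in> N \<Longrightarrow> \<gamma> n \<in> obj B" "\<And>e. e \<in> M \<Longrightarrow> fob p (\<beta> e) \<in> obj B"
    using assms(2-4) p.fob_obj by (auto simp: Pi_iff)
  have nat: "nat_iso (discrete M) B (func_comp ?F (disc_func (discrete N) q))
      (func_comp p (disc_func E \<beta>)) \<phi>"
    unfolding nat_iso_def using gfunctor_comp[OF U F] gfunctor_comp[OF V assms(1)] \<phi> mem
    by (auto simp: func_comp_def disc_func_def discrete_def p.farr_idt p.D.cmp_idt_left
        p.D.cmp_idt_right split: if_splits)
  have K: "gfunctor (discrete M) ?H ?K"
    using F assms(1) U V nat by (rule gfunctor_hp_induced)
  have "?L \<longleftrightarrow> fully_faithful (discrete M) ?H ?K \<and> ess_surj (discrete M) ?H ?K"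
    unfolding hpullback_square_def using nat K equivalenceI equivalence_ess_surj
      equivalence_fully_faithful by blast
  also have "ess_surj (discrete M) ?H ?K \<longleftrightarrow> (\<forall>n\<in>N. \<forall>y\<in>obj E. \<forall>k\<in>hom B (\<gamma> n) (fob p y).
      \<exists>e\<in>M. q e = n \<and> (\<exists>b\<in>hom E (\<beta> e) y.
        cmp B (\<gamma> n) (fob p (\<beta> e)) (fob p y) (farr p (\<beta> e) y b) (\<phi> e) = k))"
  proof -
    have "hom ?H (fob ?K e) (n, y, k) \<noteq> {} \<longleftrightarrow> q e = n \<and> (\<exists>b\<in>hom E (\<beta> e) y.
        cmp B (\<gamma> n) (fob p (\<beta> e)) (fob p y) (farr p (\<beta> e) y b) (\<phi> e) = k)"
      if "e \<in> M" "n \<in> N" "y \<in> obj E" "k \<in> hom B (\<gamma> n) (fob p y)" for e n y k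
      using that mem by (auto simp: hpullback_def hp_induced_def disc_func_def discrete_def
          p.D.cmp_idt_right p.fob_obj)
    moreover have "obj ?H = {(n, y, k). n \<in> N \<and> y \<in> obj E \<and> k \<in> hom B (\<gamma> n) (fob p y)}"
      by (simp add: hpullback_def disc_func_def discrete_def)
    moreover have "obj (discrete M) = M" by (simp add: discrete_def)
    ultimately show ?thesis unfolding ess_surj_def by simp blast
  qed
  \<comment> \<open>There is one arrow from \<open>e\<close> to \<open>e'\<close> in the discrete
    groupoid if they are equal and none otherwise. So bijectivity on arrows says that an arrow
    between the images exists only for \<open>e = e'\<close> and is then the identity. The premise
    \<open>q e = q e'\<close> is the component of such an arrow in \<open>N\<close>.\<close>
  also have "fully_faithful (discrete M) ?H ?K \<longleftrightarrow> (\<forall>e\<in>M. \<forall>e'\<in>M. \<forall>b\<in>hom E (\<beta> e) (\<beta> e'). q e = q e' \<longrightarrow>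
        cmp B (\<gamma> (q e)) (fob p (\<beta> e)) (fob p (\<beta> e')) (farr p (\<beta> e) (\<beta> e') b) (\<phi> e) = \<phi> e'
        \<longrightarrow> e = e' \<and> b = idt E (\<beta> e))"
  proof -
    have "bij_betw (farr ?K e e') (hom (discrete M) e e') (hom ?H (fob ?K e) (fob ?K e')) \<longleftrightarrow>
      (\<forall>b\<in>hom E (\<beta> e) (\<beta> e'). q e = q e' \<longrightarrow>
        cmp B (\<gamma> (q e)) (fob p (\<beta> e)) (fob p (\<beta> e')) (farr p (\<beta> e) (\<beta> e') b) (\<phi> e) = \<phi> e'
        \<longrightarrow> e = e' \<and> b = idt E (\<beta> e))" if e: "e \<in> M" "e' \<in> M" for e e'
    proof -
      have "hom ?H (fob ?K e) (fob ?K e') = {(u, b). q e = q e' \<and> b \<in> hom E (\<beta> e) (\<beta> e') \<and>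
        cmp B (\<gamma> (q e)) (fob p (\<beta> e)) (fob p (\<beta> e')) (farr p (\<beta> e) (\<beta> e') b) (\<phi> e) = \<phi> e'}"
        using e mem \<phi>[of e'] by (auto simp: hpullback_def hp_induced_def disc_func_def discrete_def
          p.D.cmp_idt_right p.fob_obj)
      moreover have "farr ?K e e' u = (u, idt E (\<beta> e))" for u
        by (simp add: hp_induced_def disc_func_def discrete_def)
      moreover have "hom (discrete M) e e' = {u. e = e'}" by (simp add: discrete_def)
      moreover have "cmp B (\<gamma> (q e)) (fob p (\<beta> e)) (fob p (\<beta> e))
          (farr p (\<beta> e) (\<beta> e) (idt E (\<beta> e))) (\<phi> e) = \<phi> e"
        using e mem \<phi>[of e] by (simp add: p.farr_idt p.D.cmp_idt_left)
      ultimately show ?thesis using p.C.idt_hom[of "\<beta> e"] mem(1)[OF e(1)]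
        by (auto simp: bij_betw_def inj_on_def image_iff)
    qed
    moreover have "obj (discrete M) = M" by (simp add: discrete_def)
    ultimately show ?thesis unfolding fully_faithful_def by simp
  qed
  also have "(\<forall>e\<in>M. \<forall>e'\<in>M. \<forall>b\<in>hom E (\<beta> e) (\<beta> e'). q e = q e' \<longrightarrow>
        cmp B (\<gamma> (q e)) (fob p (\<beta> e)) (fob p (\<beta> e')) (farr p (\<beta> e) (\<beta> e') b) (\<phi> e) = \<phi> e'
        \<longrightarrow> e = e' \<and> b = idt E (\<beta> e)) \<and> (\<forall>n\<in>N. \<forall>y\<in>obj E. \<forall>k\<in>hom B (\<gamma> n) (fob p y).
      \<exists>e\<in>M. q e = n \<and> (\<exists>b\<in>hom E (\<beta> e) y.
        cmp B (\<gamma> n) (fob p (\<beta> e)) (fob p y) (farr p (\<beta> e) y b) (\<phi> e) = k)) \<longleftrightarrow> ?R"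
    unfolding fibre_equiv_def using mem(2) by (auto 0 3) meson+
  finally show ?thesis .
qed


section \<open>Families\<close>

lemma families_obj [simp]: "(X, N) \<in> obj (families C) \<longleftrightarrow> finite X \<and> N \<in> X \<rightarrow>\<^sub>E obj C"
  and families_hom [simp]: "(f, \<phi>) \<in> hom (families C) (X, N) (Y, N') \<longleftrightarrow>
    f \<in> extensional X \<and> bij_betw f X Y \<and> \<phi> \<in> (\<Pi>\<^sub>E x\<in>X. hom C (N x) (N' (f x)))"
  and families_cmp [simp]: "cmp (families C) (X, N) (Y, N') (Z, N'') (g, \<psi>) (f, \<phi>) =
    (\<lambda>x\<in>X. g (f x), \<lambda>x\<in>X. cmp C (N x) (N' (f x)) (N'' (g (f x))) (\<psi> (f x)) (\<phi> x))"
  and families_idt [simp]: "idt (families C) (X, N) = (\<lambda>x\<in>X. x, \<lambda>x\<in>X. idt C (N x))"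
  by (simp_all add: families_def)

lemma groupoid_families:
  assumes "groupoid C"
  shows "groupoid (families C :: ('v set \<times> ('v \<Rightarrow> 'o), ('v \<Rightarrow> 'v) \<times> ('v \<Rightarrow> 'a)) cat)"
    (is "groupoid ?F")
proof -
  interpret C: groupoid C by fact
  show ?thesis
  proof (unfold_locales, goal_cases)
    case (1 x)
    obtain X N where x: "x = (X, N)" by fastforce
    have "bij_betw (\<lambda>x\<in>X. x) X X" by (simp add: bij_betw_def inj_on_def)
    then show ?case using 1 unfolding x by (auto simp: C.idt_hom PiE_iff)
  next
    case (2 x y z f g)
    obtain X N Y N' Z N'' a \<phi> b \<psi> where eq: "x = (X, N)" "y = (Y, N')" "z = (Z, N'')"
      "f = (a, \<phi>)" "g = (b, \<psi>)" by (metis surj_pair)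
    from 2 have ab: "bij_betw a X Y" "bij_betw b Y Z" by (auto simp: eq)
    then have "bij_betw (\<lambda>x\<in>X. b (a x)) X Z"
      using bij_betw_trans[OF ab] by (simp add: bij_betw_def inj_on_def image_comp comp_def)
    moreover have "a x \<in> Y" if "x \<in> X" for x using ab that by (auto dest: bij_betw_apply)
    ultimately show ?case using 2 bij_betw_apply[OF ab(2)] unfolding eq
      by (auto simp: PiE_iff intro!: C.cmp_hom)
  next
    case (3 x y f)
    then show ?case by (cases x; cases y; cases f) (auto simp: PiE_iff fun_eq_iff extensional_def
          intro!: C.cmp_idt_right dest: bij_betw_apply)
  next
    case (4 x y f)
    then show ?case by (cases x; cases y; cases f) (auto simp: PiE_iff fun_eq_iff extensional_def
          intro!: C.cmp_idt_left dest: bij_betw_apply)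
  next
    case (5 x y z u f g h)
    then show ?case by (cases x; cases y; cases z; cases u; cases f; cases g; cases h)
        (auto simp: PiE_iff fun_eq_iff intro!: C.cmp_assoc dest: bij_betw_apply)
  next
    case (6 x y f)
    obtain X N Y N' b \<phi> where eq: "x = (X, N)" "y = (Y, N')" "f = (b, \<phi>)" by (metis surj_pair)
    from 6 have *: "\<And>x. x \<in> X \<Longrightarrow> N x \<in> obj C" "\<And>y. y \<in> Y \<Longrightarrow> N' y \<in> obj C"
      "b \<in> extensional X" "bij_betw b X Y" "\<And>x. x \<in> X \<Longrightarrow> \<phi> x \<in> hom C (N x) (N' (b x))"
      unfolding eq by auto
    define c where "c = (\<lambda>y\<in>Y. inv_into X b y)"
    have c: "\<And>y. y \<in> Y \<Longrightarrow> c y \<in> X" "\<And>y. y \<in> Y \<Longrightarrow> b (c y) = y" "\<And>x. x \<in> X \<Longrightarrow> c (b x) = x"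
      "\<And>x. x \<in> X \<Longrightarrow> b x \<in> Y"
      using *(4) unfolding c_def bij_betw_def by (auto simp: inv_into_into f_inv_into_f)
    have bij: "bij_betw c Y X" by (intro bij_betw_byWitness[where f'=b]) (auto simp: c)
    have hom: "\<phi> (c y) \<in> hom C (N (c y)) (N' y)" if "y \<in> Y" for y
      using *(5)[of "c y"] c(1,2) that by simp
    have "inverse_arrows ?F x y f (c, \<lambda>y\<in>Y. inv_arr C (N (c y)) (N' y) (\<phi> (c y)))"
      unfolding inverse_arrows_def
    proof (intro conjI, goal_cases)
      case 2
      have "c \<in> extensional Y" by (simp add: c_def)
      then show ?case using * c bij hom by (auto simp: eq intro!: C.inv_arr_hom)
    next
      case 3
      then show ?case using * c by (auto simp: eq fun_eq_iff intro!: C.cmp_inv_left)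
    next
      case 4
      then show ?case using * c hom by (auto simp: eq fun_eq_iff intro!: C.cmp_inv_right)
    qed (use 6 in auto)
    then show ?case unfolding is_iso_def by blast
  qed
qed


section \<open>Trees\<close>

text \<open>These fibres of \<open>p\<close> are the pieces into which both pullback conditions, the
  strict one for embeddings and the homotopy one for decorations, are decomposed.\<close>

definition inputs_at :: "('v, 'z) tree_scheme \<Rightarrow> 'v \<Rightarrow> 'v set" where
  "inputs_at T n = {e \<in> inputs T. pm T e = n}"

text \<open>Stated from bare hypotheses on \<open>T\<close> because \<open>is_treeI\<close> uses it
  before \<open>T\<close> is known to be a tree.\<close>

lemma next_edge_sm:
  assumes "inj_on (sm T) (inputs T)" "edges T - sm T ` inputs T = {r}" "e \<in> inputs T"
  shows "next_edge T (sm T e) = tm T (pm T e)"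
proof -
  have "tree_root T = r" unfolding tree_root_def using assms(2) by auto
  then have "sm T e \<noteq> tree_root T" using assms by auto
  then show ?thesis using assms by (simp add: next_edge_def the_inv_into_f_f)
qed

lemma next_edge_root [simp]: "next_edge T (tree_root T) = tree_root T"
  by (simp add: next_edge_def)

text \<open>The last premise is induction from the root. Applied to the predicate that some iterate
  of \<open>next_edge\<close> reaches \<open>r\<close>, it yields well-foundedness, so constructed
  trees never have to exhibit a number of steps.\<close>

lemma is_treeI:
  assumes "finite (edges T)" "finite (inputs T)" "finite (nodes T)"
    and "sm T \<in> inputs T \<rightarrow>\<^sub>E edges T" "pm T \<in> inputs T \<rightarrow>\<^sub>E nodes T" "tm T \<in> nodes T \<rightarrow>\<^sub>E edges T"
    and "inj_on (tm T) (nodes T)" "inj_on (sm T) (inputs T)"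
    and root: "edges T - sm T ` inputs T = {r}"
    and induct: "\<And>Q x. \<lbrakk>x \<in> edges T; Q r; \<And>e. \<lbrakk>e \<in> inputs T; Q (tm T (pm T e))\<rbrakk> \<Longrightarrow> Q (sm T e)\<rbrakk> \<Longrightarrow> Q x"
  shows "is_tree T"
proof -
  have "tree_root T = r" unfolding tree_root_def using root by auto
  moreover have "\<exists>k. (next_edge T ^^ k) x = r" if "x \<in> edges T" for x
    using that
  proof (rule induct)
    show "\<exists>k. (next_edge T ^^ k) r = r" by (rule exI[of _ 0]) simp
  next
    fix e assume e: "e \<in> inputs T" and "\<exists>k. (next_edge T ^^ k) (tm T (pm T e)) = r"
    then obtain k where "(next_edge T ^^ k) (tm T (pm T e)) = r" by blast
    then have "(next_edge T ^^ Suc k) (sm T e) = r"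
      using next_edge_sm[OF assms(8) root e] by (simp add: funpow_Suc_right del: funpow.simps)
    then show "\<exists>k. (next_edge T ^^ k) (sm T e) = r" by blast
  qed
  ultimately show ?thesis unfolding is_tree_def using assms by blast
qed

locale tree =
  fixes T :: "('v, 'z) tree_scheme"
  assumes is_tree: "is_tree T"
begin

lemma finite_edges: "finite (edges T)"
  and finite_inputs: "finite (inputs T)"
  and finite_nodes: "finite (nodes T)"
  and sm_inj: "inj_on (sm T) (inputs T)"
  and tm_inj: "inj_on (tm T) (nodes T)"
  using is_tree unfolding is_tree_def by (auto simp: PiE_iff)

lemma sm_edge [simp, intro]: "e \<in> inputs T \<Longrightarrow> sm T e \<in> edges T"
  and pm_node [simp, intro]: "e \<in> inputs T \<Longrightarrow> pm T e \<in> nodes T"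
  and tm_edge [simp, intro]: "n \<in> nodes T \<Longrightarrow> tm T n \<in> edges T"
  using is_tree unfolding is_tree_def by auto

lemma edges_minus_sm: "edges T - sm T ` inputs T = {tree_root T}"
proof -
  obtain r where "edges T - sm T ` inputs T = {r}"
    using is_tree unfolding is_tree_def by blast
  then show ?thesis unfolding tree_root_def by simp
qed

lemma root_edge [simp, intro]: "tree_root T \<in> edges T"
  using edges_minus_sm by blast

lemma sm_neq_root [simp]: "e \<in> inputs T \<Longrightarrow> sm T e \<noteq> tree_root T"
  using edges_minus_sm by blast

lemma sm_eq_iff: "\<lbrakk>e \<in> inputs T; e' \<in> inputs T\<rbrakk> \<Longrightarrow> sm T e = sm T e' \<longleftrightarrow> e = e'"
  using sm_inj by (auto dest: inj_onD)

lemma tm_eq_iff: "\<lbrakk>n \<in> nodes T; n' \<in> nodes T\<rbrakk> \<Longrightarrow> tm T n = tm T n' \<longleftrightarrow> n = n'"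
  using tm_inj by (auto dest: inj_onD)

lemma edge_cases:
  assumes "x \<in> edges T"
  obtains "x = tree_root T" | e where "e \<in> inputs T" "x = sm T e"
  using assms edges_minus_sm by blast

lemma next_edge_sm [simp]: "e \<in> inputs T \<Longrightarrow> next_edge T (sm T e) = tm T (pm T e)"
  using next_edge_sm[OF sm_inj edges_minus_sm] .

text \<open>Induction on the number of steps down to the root. From here on iterates of
  \<open>next_edge\<close> are replaced by induction up the tree.\<close>

lemma tree_induct [consumes 1, case_names root input]:
  assumes "x \<in> edges T" "Q (tree_root T)"
    and "\<And>e. \<lbrakk>e \<in> inputs T; Q (tm T (pm T e))\<rbrakk> \<Longrightarrow> Q (sm T e)"
  shows "Q x"
proof -
  have "Q x" if "x \<in> edges T" "(next_edge T ^^ k) x = tree_root T" for k x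
    using that
  proof (induction k arbitrary: x)
    case 0
    then show ?case using assms(2) by simp
  next
    case (Suc k)
    from Suc.prems(1) show ?case
    proof (cases rule: edge_cases)
      case 1
      then show ?thesis using assms(2) by simp
    next
      case (2 e)
      then have "(next_edge T ^^ k) (tm T (pm T e)) = tree_root T"
        using Suc.prems(2) by (simp add: funpow_Suc_right del: funpow.simps)
      then show ?thesis using 2 assms(3) Suc.IH by simp
    qed
  qed
  moreover obtain k where "(next_edge T ^^ k) x = tree_root T"
    using is_tree assms(1) unfolding is_tree_def by blast
  ultimately show ?thesis using assms(1) by blast
qed

section \<open>The edges above a given edge\<close>

lemma ideal_edges_sub: "x \<in> ideal_edges T r \<Longrightarrow> x \<in> edges T"
  by (simp add: ideal_edges_def)

lemma ideal_edges_self [simp]: "r \<in> ideal_edges T r \<longleftrightarrow> r \<in> edges T"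
  unfolding ideal_edges_def by (auto intro: exI[of _ 0])

lemma root_ideal_iff [simp]: "tree_root T \<in> ideal_edges T r \<longleftrightarrow> r = tree_root T"
proof -
  have "(next_edge T ^^ k) (tree_root T) = tree_root T" for k by (induction k) auto
  then show ?thesis by (auto simp: ideal_edges_def)
qed

text \<open>Either zero steps or one step followed by the rest: this recursion is the working
  definition of an ideal subtree.\<close>

lemma sm_ideal_iff:
  assumes "e \<in> inputs T"
  shows "sm T e \<in> ideal_edges T r \<longleftrightarrow> sm T e = r \<or> tm T (pm T e) \<in> ideal_edges T r"
proof -
  have "(\<exists>k. (next_edge T ^^ k) (sm T e) = r)
      \<longleftrightarrow> sm T e = r \<or> (\<exists>k. (next_edge T ^^ Suc k) (sm T e) = r)" (is "?L \<longleftrightarrow> ?R")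
  proof
    assume ?L
    then obtain k where "(next_edge T ^^ k) (sm T e) = r" by blast
    then show ?R by (cases k) auto
  next
    assume ?R
    then show ?L by (metis funpow_0)
  qed
  then show ?thesis using assms
    by (simp add: ideal_edges_def funpow_Suc_right del: funpow.simps)
qed

lemma ideal_base_edge:
  assumes "x \<in> ideal_edges T r"
  shows "r \<in> edges T"
proof -
  have "x \<in> edges T" using assms by (rule ideal_edges_sub)
  then have "x \<in> ideal_edges T r \<longrightarrow> r \<in> edges T"
    by (induction rule: tree_induct) (auto simp: sm_ideal_iff)
  then show ?thesis using assms by blast
qed

text \<open>Induction inside an ideal subtree is \<open>tree_induct\<close> for an implication: by
  \<open>sm_ideal_iff\<close> an edge above \<open>r\<close> is \<open>r\<close> or has its parent
  above \<open>r\<close>.\<close>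

lemma ideal_induct [consumes 1, case_names root input]:
  assumes "x \<in> ideal_edges T r" "Q r"
    and "\<And>e. \<lbrakk>e \<in> inputs T; tm T (pm T e) \<in> ideal_edges T r; Q (tm T (pm T e))\<rbrakk> \<Longrightarrow> Q (sm T e)"
  shows "Q x"
proof -
  have "x \<in> edges T" using assms(1) by (rule ideal_edges_sub)
  then have "x \<in> ideal_edges T r \<longrightarrow> Q x"
  proof (induction rule: tree_induct)
    case root
    then show ?case using assms(2) by auto
  next
    case (input e)
    then show ?case using assms(2,3) by (auto simp: sm_ideal_iff)
  qed
  then show ?thesis using assms(1) by blast
qed

lemma ideal_trans:
  assumes "x \<in> ideal_edges T y" "y \<in> ideal_edges T r"
  shows "x \<in> ideal_edges T r"
  using assms(1) by (induction rule: ideal_induct) (auto simp: assms(2) sm_ideal_iff)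

text \<open>Suppose the parent \<open>y\<close> of the edge \<open>x\<close> lies above
  \<open>x\<close>. Then \<open>y\<close> is not the root, and the parent of \<open>y\<close> lies
  above \<open>y\<close>, so the cycle has moved one step towards the root. The root ends the
  descent, since it is not of the form \<open>sm T e\<close> and the claim is vacuous there.\<close>

lemma ideal_acyclic:
  assumes "e \<in> inputs T"
  shows "tm T (pm T e) \<notin> ideal_edges T (sm T e)"
proof -
  have "\<forall>e\<in>inputs T. x = sm T e \<longrightarrow> tm T (pm T e) \<notin> ideal_edges T x" if "x \<in> edges T" for x
    using that
  proof (induction rule: tree_induct)
    case root
    then show ?case using sm_neq_root by metis
  next
    case (input e)
    let ?x = "sm T e" and ?y = "tm T (pm T e)"
    have "?y \<notin> ideal_edges T ?x"
    proof
      assume y: "?y \<in> ideal_edges T ?x"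
      have x: "?x \<in> ideal_edges T ?y" using input(1) by (simp add: sm_ideal_iff)
      have "?y \<in> edges T" using input(1) by simp
      then show False
      proof (cases rule: edge_cases)
        case 1
        then show False using y input(1) by auto
      next
        case (2 e')
        then have "?x = ?y \<or> tm T (pm T e') \<in> ideal_edges T ?x"
          using y by (auto simp: sm_ideal_iff)
        then have "tm T (pm T e') \<in> ideal_edges T ?y"
        proof
          assume "?x = ?y"
          then have "e = e'" using 2 input(1) by (simp add: sm_eq_iff)
          then show ?thesis using 2 y \<open>?x = ?y\<close> by simp
        next
          assume "tm T (pm T e') \<in> ideal_edges T ?x"
          then show ?thesis using x by (rule ideal_trans)
        qed
        then show False using 2 input(2) by auto
      qed
    qed
    then show ?case using input(1) by (auto simp: sm_eq_iff)
  qed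
  then show ?thesis using assms by auto
qed

lemma ideal_leaf:
  assumes "l \<in> leaves T"
  shows "ideal_edges T l = {l}"
proof -
  have "x = l" if "x \<in> ideal_edges T l" for x
    using that assms by (induction rule: ideal_induct) (auto simp: leaves_def)
  moreover have "l \<in> ideal_edges T l" using assms by (simp add: leaves_def)
  ultimately show ?thesis by auto
qed

lemma tm_ideal_iff [simp]: "n \<in> nodes T \<Longrightarrow> tm T n \<in> ideal_edges T r \<longleftrightarrow> n \<in> ideal_nodes T r"
  by (simp add: ideal_nodes_def)

lemma pm_ideal_iff [simp]: "e \<in> inputs T \<Longrightarrow> pm T e \<in> ideal_nodes T r \<longleftrightarrow> e \<in> ideal_inputs T r"
  by (simp add: ideal_inputs_def)

lemma sm_ideal: "e \<in> ideal_inputs T r \<Longrightarrow> sm T e \<in> ideal_edges T r"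
  by (auto simp: ideal_inputs_def sm_ideal_iff ideal_nodes_def)

end

lemma ideal_subsets:
  "ideal_edges T r \<subseteq> edges T" "ideal_nodes T r \<subseteq> nodes T" "ideal_inputs T r \<subseteq> inputs T"
  by (auto simp: ideal_edges_def ideal_nodes_def ideal_inputs_def)

lemma ideal_subtree_simps [simp]:
  "edges (ideal_subtree T r) = ideal_edges T r"
  "inputs (ideal_subtree T r) = ideal_inputs T r"
  "nodes (ideal_subtree T r) = ideal_nodes T r"
  "sm (ideal_subtree T r) = restrict (sm T) (ideal_inputs T r)"
  "pm (ideal_subtree T r) = restrict (pm T) (ideal_inputs T r)"
  "tm (ideal_subtree T r) = restrict (tm T) (ideal_nodes T r)"
  "alpha (ideal_subtree T r) = restrict (alpha T) (ideal_edges T r)"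
  "beta (ideal_subtree T r) = restrict (beta T) (ideal_inputs T r)"
  "gamma (ideal_subtree T r) = restrict (gamma T) (ideal_nodes T r)"
  "iso_s (ideal_subtree T r) = restrict (iso_s T) (ideal_inputs T r)"
  "iso_p (ideal_subtree T r) = restrict (iso_p T) (ideal_inputs T r)"
  "iso_t (ideal_subtree T r) = restrict (iso_t T) (ideal_nodes T r)"
  by (simp_all add: ideal_subtree_def)

lemma inputs_at_ideal [simp]:
  "n \<in> ideal_nodes T r \<Longrightarrow> inputs_at (ideal_subtree T r) n = inputs_at T n"
  by (auto simp: inputs_at_def ideal_inputs_def)

lemma ideal_subtree_minus_sm:
  assumes "is_tree T" "r \<in> edges T"
  shows "ideal_edges T r - sm (ideal_subtree T r) ` ideal_inputs T r = {r}"
proof -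
  interpret tree T using assms(1) by unfold_locales
  have "x = r \<or> x \<in> sm T ` ideal_inputs T r" if "x \<in> ideal_edges T r" for x
    using that
  proof (induction rule: ideal_induct)
    case (input e)
    then have "e \<in> ideal_inputs T r" by simp
    then show ?case by blast
  qed simp
  \<comment> \<open>Otherwise the parent of \<open>r\<close> would lie above \<open>r\<close>, which
    \<open>ideal_acyclic\<close> excludes.\<close>
  moreover have "r \<notin> sm T ` ideal_inputs T r"
  proof
    assume "r \<in> sm T ` ideal_inputs T r"
    then obtain e where "e \<in> ideal_inputs T r" "r = sm T e" by blast
    then show False using ideal_acyclic[of e] by (auto simp: ideal_inputs_def ideal_nodes_def)
  qed
  ultimately show ?thesis using assms(2) by auto
qed

lemma tree_root_ideal_subtree [simp]:
  "is_tree T \<Longrightarrow> r \<in> edges T \<Longrightarrow> tree_root (ideal_subtree T r) = r"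
  using ideal_subtree_minus_sm[of T r] unfolding tree_root_def by auto

text \<open>\<open>ideal_induct\<close> is exactly the induction that \<open>is_treeI\<close>
  requires.\<close>

lemma is_tree_ideal_subtree:
  assumes "is_tree T" "r \<in> edges T"
  shows "is_tree (ideal_subtree T r)"
proof -
  interpret tree T using assms(1) by unfold_locales
  show ?thesis
  proof (rule is_treeI)
    show "edges (ideal_subtree T r) - sm (ideal_subtree T r) ` inputs (ideal_subtree T r) = {r}"
      using ideal_subtree_minus_sm[OF assms] by simp
  next
    fix Q x
    assume "x \<in> edges (ideal_subtree T r)" "Q r"
      "\<And>e. \<lbrakk>e \<in> inputs (ideal_subtree T r);
        Q (tm (ideal_subtree T r) (pm (ideal_subtree T r) e))\<rbrakk> \<Longrightarrow> Q (sm (ideal_subtree T r) e)"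
    then have "x \<in> ideal_edges T r" "Q r"
      "\<And>e. \<lbrakk>e \<in> ideal_inputs T r; Q (tm T (pm T e))\<rbrakk> \<Longrightarrow> Q (sm T e)"
      by (auto simp: ideal_inputs_def)
    then show "Q x"
      by (induction rule: ideal_induct) simp_all
  qed (use sm_inj tm_inj finite_edges finite_inputs finite_nodes ideal_subsets[of T r]
      in \<open>auto simp: sm_ideal inj_on_def finite_subset subset_iff ideal_inputs_def ideal_nodes_def\<close>)
qed


lemma leaf_edge [simp, intro]: "l \<in> leaves T \<Longrightarrow> l \<in> edges T"
  by (simp add: leaves_def)


section \<open>Tree embeddings\<close>

text \<open>The pullback is the disjoint union, over the nodes \<open>b\<close> of \<open>S\<close>,
  of the fibres of \<open>pm T\<close> over \<open>n b\<close>, and the comparison map respects this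
  decomposition. So it is bijective iff \<open>m\<close> is bijective on each fibre, a condition
  local enough to be glued.\<close>

lemma tree_embedding_iff:
  assumes "pm S \<in> inputs S \<rightarrow> nodes S"
  shows "tree_embedding S T a m n \<longleftrightarrow>
     a \<in> edges S \<rightarrow>\<^sub>E edges T \<and> m \<in> inputs S \<rightarrow>\<^sub>E inputs T \<and> n \<in> nodes S \<rightarrow>\<^sub>E nodes T \<and>
     (\<forall>e\<in>inputs S. a (sm S e) = sm T (m e)) \<and>
     (\<forall>e\<in>inputs S. n (pm S e) = pm T (m e)) \<and>
     (\<forall>b\<in>nodes S. a (tm S b) = tm T (n b)) \<and>
     (\<forall>b\<in>nodes S. bij_betw m (inputs_at S b) (inputs_at T (n b)))" (is "?L \<longleftrightarrow> ?M \<and> ?B")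
proof -
  have "bij_betw (\<lambda>e. (m e, pm S e)) (inputs S)
       {(e, b). e \<in> inputs T \<and> b \<in> nodes S \<and> pm T e = n b} \<longleftrightarrow>
     (\<forall>b\<in>nodes S. bij_betw m (inputs_at S b) (inputs_at T (n b)))" if ?M
  proof -
    have "inj_on (\<lambda>e. (m e, pm S e)) (inputs S) \<longleftrightarrow> (\<forall>b\<in>nodes S. inj_on m (inputs_at S b))"
      using assms unfolding inj_on_def inputs_at_def by auto
    moreover have "(\<lambda>e. (m e, pm S e)) ` inputs S = {(e, b). e \<in> inputs T \<and> b \<in> nodes S \<and> pm T e = n b}
      \<longleftrightarrow> (\<forall>b\<in>nodes S. m ` inputs_at S b = inputs_at T (n b))" (is "?X \<longleftrightarrow> ?Y")
    proof
      assume ?X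
      then show ?Y using that assms unfolding set_eq_iff inputs_at_def by (auto simp: image_iff) metis+
    next
      assume ?Y
      then show ?X using that assms unfolding set_eq_iff inputs_at_def by (auto simp: image_iff) metis
    qed
    ultimately show ?thesis unfolding bij_betw_def by blast
  qed
  then show ?thesis unfolding tree_embedding_def by blast
qed

locale tree_emb = S: tree S + T: tree T for S T :: "('v, 'z) tree_scheme" +
  fixes a m n
  assumes emb: "tree_embedding S T a m n"
begin

lemma emb_facts:
  "a \<in> edges S \<rightarrow>\<^sub>E edges T \<and> m \<in> inputs S \<rightarrow>\<^sub>E inputs T \<and> n \<in> nodes S \<rightarrow>\<^sub>E nodes T \<and>
   (\<forall>e\<in>inputs S. a (sm S e) = sm T (m e)) \<and>
   (\<forall>e\<in>inputs S. n (pm S e) = pm T (m e)) \<and>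
   (\<forall>b\<in>nodes S. a (tm S b) = tm T (n b)) \<and>
   (\<forall>b\<in>nodes S. bij_betw m (inputs_at S b) (inputs_at T (n b)))"
proof -
  have "pm S \<in> inputs S \<rightarrow> nodes S" by auto
  from iffD1[OF tree_embedding_iff[OF this] emb] show ?thesis .
qed

lemma map_edge [simp, intro]: "x \<in> edges S \<Longrightarrow> a x \<in> edges T"
  and map_input [simp, intro]: "e \<in> inputs S \<Longrightarrow> m e \<in> inputs T"
  and map_node [simp, intro]: "b \<in> nodes S \<Longrightarrow> n b \<in> nodes T"
  and map_sm [simp]: "e \<in> inputs S \<Longrightarrow> a (sm S e) = sm T (m e)"
  and map_pm [simp]: "e \<in> inputs S \<Longrightarrow> n (pm S e) = pm T (m e)"
  and map_tm [simp]: "b \<in> nodes S \<Longrightarrow> a (tm S b) = tm T (n b)"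
  using emb_facts by auto

lemma bij_inputs_at: "b \<in> nodes S \<Longrightarrow> bij_betw m (inputs_at S b) (inputs_at T (n b))"
  using emb_facts by auto

lemma lift_input:
  assumes "b \<in> nodes S" "e \<in> inputs T" "pm T e = n b"
  obtains e' where "e' \<in> inputs S" "pm S e' = b" "m e' = e"
proof -
  have "e \<in> m ` inputs_at S b"
    using assms bij_inputs_at[of b] by (auto simp: bij_betw_def inputs_at_def)
  then show thesis using that by (auto simp: inputs_at_def)
qed

lemma map_ideal:
  assumes "x \<in> ideal_edges S r"
  shows "a x \<in> ideal_edges T (a r)"
  using assms
proof (induction rule: S.ideal_induct)
  case root
  show ?case using S.ideal_base_edge[OF assms] by simp
next
  case (input e)
  then show ?case by (simp add: T.sm_ideal_iff del: T.tm_ideal_iff)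
qed

end

section \<open>Root-preserving embeddings and the decomposition of the ambient tree\<close>

locale root_emb = tree_emb +
  assumes root_preserving: "a (tree_root S) = tree_root T"
begin

text \<open>Two edges with the same image have parents with the same image; these coincide by
  induction, so both edges are inputs of one node. The pullback condition makes the embedding
  injective on the inputs of a node.\<close>

lemma inj_edges: "inj_on a (edges S)"
proof -
  have "\<forall>y\<in>edges S. a x = a y \<longrightarrow> x = y" if "x \<in> edges S" for x
    using that
  proof (induction rule: S.tree_induct)
    case root
    then show ?case
      by (metis S.edge_cases T.sm_neq_root map_input map_sm root_preserving)
  next
    case (input e)
    show ?case
    proof (intro ballI impI)
      fix y assume y: "y \<in> edges S" "a (sm S e) = a y"
      from y(1) show "sm S e = y"
      proof (cases rule: S.edge_cases)
        case 1
        then show ?thesis using y input(1) root_preserving by simp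
      next
        case (2 e')
        then have me: "m e = m e'" using y(2) input(1) by (simp add: T.sm_eq_iff)
        then have "n (pm S e) = n (pm S e')" using input(1) 2 by simp
        then have "a (tm S (pm S e)) = a (tm S (pm S e'))" using input(1) 2 by simp
        then have "tm S (pm S e) = tm S (pm S e')"
          using input(2) 2(1) S.tm_edge S.pm_node by blast
        then have "pm S e = pm S e'" using input(1) 2 by (simp add: S.tm_eq_iff)
        then have "e = e'"
          using bij_inputs_at[of "pm S e"] me input(1) 2(1)
          by (auto simp: bij_betw_def inputs_at_def inj_on_def)
        then show ?thesis using 2 by simp
      qed
    qed
  qed
  then show ?thesis by (auto simp: inj_on_def)
qed

lemma edge_eq_iff: "\<lbrakk>x \<in> edges S; y \<in> edges S\<rbrakk> \<Longrightarrow> a x = a y \<longleftrightarrow> x = y"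
  using inj_edges by (auto dest: inj_onD)

lemma node_eq_iff: "\<lbrakk>b \<in> nodes S; b' \<in> nodes S\<rbrakk> \<Longrightarrow> n b = n b' \<longleftrightarrow> b = b'"
  by (metis S.tm_edge S.tm_eq_iff edge_eq_iff map_tm)

lemma input_eq_iff: "\<lbrakk>e \<in> inputs S; e' \<in> inputs S\<rbrakk> \<Longrightarrow> m e = m e' \<longleftrightarrow> e = e'"
  by (metis S.sm_edge S.sm_eq_iff edge_eq_iff map_sm)

text \<open>Climbing from the root, one leaves the image of \<open>S\<close> only at a leaf: above
  any other edge of \<open>S\<close> sits a node of \<open>S\<close>, and the pullback condition
  puts all its inputs in the image.\<close>

lemma edge_decomp:
  assumes "x \<in> edges T"
  obtains y where "y \<in> edges S" "x = a y" | l where "l \<in> leaves S" "x \<in> ideal_edges T (a l)"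
proof -
  have "(\<exists>y\<in>edges S. x = a y) \<or> (\<exists>l\<in>leaves S. x \<in> ideal_edges T (a l))"
    using assms
  proof (induction rule: T.tree_induct)
    case root
    then show ?case using root_preserving by (metis S.root_edge)
  next
    case (input e)
    from input(2) show ?case
    proof (elim disjE bexE)
      fix y assume y: "y \<in> edges S" "tm T (pm T e) = a y"
      show ?thesis
      proof (cases "y \<in> leaves S")
        case True
        then show ?thesis using y input(1) T.sm_ideal_iff[of e "a y"] by (auto simp del: T.tm_ideal_iff)
      next
        \<comment> \<open>The edge \<open>y\<close> is the output of a node \<open>b\<close> of
          \<open>S\<close>, so by injectivity of \<open>tm T\<close> the node below
          \<open>sm T e\<close> is the image of \<open>b\<close>, and \<open>e\<close> lifts to an
          input at \<open>b\<close>.\<close>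
        case False
        then obtain b where b: "b \<in> nodes S" "y = tm S b" using y by (auto simp: leaves_def)
        then have "pm T e = n b" using y input(1) by (simp add: T.tm_eq_iff)
        then obtain e' where "e' \<in> inputs S" "m e' = e" using b(1) input(1) lift_input by blast
        then show ?thesis by (metis S.sm_edge map_sm)
      qed
    next
      fix l assume "l \<in> leaves S" "tm T (pm T e) \<in> ideal_edges T (a l)"
      then show ?thesis using input(1) by (auto simp: T.sm_ideal_iff)
    qed
  qed
  then show thesis using that by blast
qed

text \<open>If an edge of \<open>S\<close> were strictly above the leaf \<open>l\<close> in
  \<open>T\<close>, its parent would be above \<open>l\<close> as well, hence equal to
  \<open>l\<close> by induction; but a leaf is not the output of a node.\<close>

lemma map_edge_ideal_iff:
  assumes "x \<in> edges S" "l \<in> leaves S"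
  shows "a x \<in> ideal_edges T (a l) \<longleftrightarrow> x = l"
proof -
  have "a x \<in> ideal_edges T (a l) \<longrightarrow> x = l"
    using assms(1)
  proof (induction rule: S.tree_induct)
    case root
    then show ?case using root_preserving assms(2) by (metis T.root_ideal_iff edge_eq_iff S.root_edge leaf_edge)
  next
    case (input e)
    show ?case
    proof
      assume "a (sm S e) \<in> ideal_edges T (a l)"
      then have "a (sm S e) = a l \<or> a (tm S (pm S e)) \<in> ideal_edges T (a l)"
        using input(1) by (simp add: T.sm_ideal_iff del: T.tm_ideal_iff)
      then have "a (sm S e) = a l \<or> tm S (pm S e) = l" using input(2) by blast
      then show "sm S e = l" using input(1) assms(2) edge_eq_iff[of "sm S e" l]
        by (auto simp: leaves_def)
    qed
  qed
  then show ?thesis using assms by auto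
qed

text \<open>Descend from \<open>x\<close> towards \<open>a l\<close>: as soon as one of the base
  edges \<open>a l\<close>, \<open>a l'\<close> is met, it lies in the other ideal, and
  \<open>map_edge_ideal_iff\<close> identifies the leaves.\<close>

lemma ideals_disjoint:
  assumes "l \<in> leaves S" "l' \<in> leaves S" "x \<in> ideal_edges T (a l)" "x \<in> ideal_edges T (a l')"
  shows "l = l'"
proof -
  have "x \<in> ideal_edges T (a l') \<longrightarrow> l = l'"
    using assms(3)
  proof (induction rule: T.ideal_induct)
    case root
    then show ?case using assms map_edge_ideal_iff[of l l'] by auto
  next
    case (input e)
    show ?case
    proof
      assume "sm T e \<in> ideal_edges T (a l')"
      then consider "sm T e = a l'" | "tm T (pm T e) \<in> ideal_edges T (a l')"
        using input(1) by (auto simp: T.sm_ideal_iff)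
      then show "l = l'"
      proof cases
        case 1
        have "sm T e \<in> ideal_edges T (a l)" using input by (auto simp: T.sm_ideal_iff)
        then show ?thesis using 1 assms map_edge_ideal_iff[of l' l] by auto
      next
        case 2
        then show ?thesis using input by blast
      qed
    qed
  qed
  then show ?thesis using assms(4) by blast
qed

text \<open>A node is located by its output edge. If this is the image of a leaf of
  \<open>S\<close>, the node belongs to the branch. Inputs are then located by their nodes.\<close>

lemma node_decomp:
  assumes "b \<in> nodes T"
  obtains b' where "b' \<in> nodes S" "b = n b'" | l where "l \<in> leaves S" "b \<in> ideal_nodes T (a l)"
proof -
  have "tm T b \<in> edges T" using assms by simp
  then show thesis
  proof (cases rule: edge_decomp)
    case (1 y)
    show thesis
    proof (cases "y \<in> leaves S")
      case True
      then show thesis using 1 assms that(2)[of y] by (simp add: ideal_nodes_def)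
    next
      case False
      then obtain b' where "b' \<in> nodes S" "y = tm S b'" using 1 by (auto simp: leaves_def)
      then show thesis using 1 assms that(1)[of b'] by (simp add: T.tm_eq_iff)
    qed
  next
    case (2 l)
    then show thesis using assms that(2)[of l] by simp
  qed
qed

lemma input_decomp:
  assumes "e \<in> inputs T"
  obtains e' where "e' \<in> inputs S" "e = m e'" | l where "l \<in> leaves S" "e \<in> ideal_inputs T (a l)"
proof -
  have "pm T e \<in> nodes T" using assms by simp
  then show thesis
  proof (cases rule: node_decomp)
    case (1 b)
    then show thesis using assms that(1) lift_input by metis
  next
    case (2 l)
    then show thesis using assms that(2)[of l] by simp
  qed
qed

text \<open>Unlike edges, nodes and inputs are divided without overlap between \<open>S\<close> and
  the branches; this is why gluing needs compatibility on edges only.\<close>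

lemma map_node_not_ideal:
  assumes "b \<in> nodes S" "l \<in> leaves S"
  shows "n b \<notin> ideal_nodes T (a l)"
proof
  assume "n b \<in> ideal_nodes T (a l)"
  then have "a (tm S b) \<in> ideal_edges T (a l)" using assms by simp
  then have "tm S b = l" using assms map_edge_ideal_iff by blast
  then show False using assms by (auto simp: leaves_def)
qed

lemma map_input_not_ideal:
  assumes "e \<in> inputs S" "l \<in> leaves S"
  shows "m e \<notin> ideal_inputs T (a l)"
proof
  assume "m e \<in> ideal_inputs T (a l)"
  then have "n (pm S e) \<in> ideal_nodes T (a l)" using assms by simp
  then show False using assms map_node_not_ideal[of "pm S e" l] by blast
qed

lemma ideal_nodes_disjoint:
  "\<lbrakk>l \<in> leaves S; l' \<in> leaves S; b \<in> ideal_nodes T (a l); b \<in> ideal_nodes T (a l')\<rbrakk> \<Longrightarrow> l = l'"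
  using ideals_disjoint[of l l' "tm T b"] by (simp add: ideal_nodes_def del: T.tm_ideal_iff)

lemma ideal_inputs_disjoint:
  "\<lbrakk>l \<in> leaves S; l' \<in> leaves S; e \<in> ideal_inputs T (a l); e \<in> ideal_inputs T (a l')\<rbrakk> \<Longrightarrow> l = l'"
  using ideal_nodes_disjoint[of l l' "pm T e"] by (simp add: ideal_inputs_def del: T.pm_ideal_iff)

end


section \<open>\<open>P\<close>-trees\<close>

locale poly =
  fixes P :: "('i, 'ia, 'e, 'ea, 'b, 'ba) poly_diagram"
  assumes is_poly_diagram: "is_poly_diagram P"
begin

sublocale I: groupoid "gI P" using is_poly_diagram by (simp add: is_poly_diagram_def)
sublocale E: groupoid "gE P" using is_poly_diagram by (simp add: is_poly_diagram_def)
sublocale B: groupoid "gB P" using is_poly_diagram by (simp add: is_poly_diagram_def)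
sublocale s: gfunctor "gE P" "gI P" "sP P" using is_poly_diagram by (simp add: is_poly_diagram_def)
sublocale p: gfunctor "gE P" "gB P" "pP P" using is_poly_diagram by (simp add: is_poly_diagram_def)
sublocale t: gfunctor "gB P" "gI P" "tP P" using is_poly_diagram by (simp add: is_poly_diagram_def)

text \<open>The homotopy pullback condition in the form that can be verified at one node at a
  time.\<close>

lemma is_ptree_iff: "is_ptree P T \<longleftrightarrow> is_tree T \<and>
     alpha T \<in> edges T \<rightarrow>\<^sub>E obj (gI P) \<and>
     beta T \<in> inputs T \<rightarrow>\<^sub>E obj (gE P) \<and>
     gamma T \<in> nodes T \<rightarrow>\<^sub>E obj (gB P) \<and>
     iso_s T \<in> (\<Pi>\<^sub>E e\<in>inputs T. hom (gI P) (alpha T (sm T e)) (fob (sP P) (beta T e))) \<and>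
     iso_p T \<in> (\<Pi>\<^sub>E e\<in>inputs T. hom (gB P) (gamma T (pm T e)) (fob (pP P) (beta T e))) \<and>
     iso_t T \<in> (\<Pi>\<^sub>E n\<in>nodes T. hom (gI P) (alpha T (tm T n)) (fob (tP P) (gamma T n))) \<and>
     (\<forall>n\<in>nodes T. fibre_equiv (gE P) (gB P) (pP P) (gamma T n) (inputs_at T n) (beta T) (iso_p T))"
  (is "?L \<longleftrightarrow> is_tree T \<and> ?D \<and> ?C \<and> ?A \<and> ?S \<and> ?p \<and> ?T \<and> ?F")
proof -
  have "hpullback_square (discrete (inputs T)) (discrete (nodes T)) (gE P) (gB P)
       (disc_func (gB P) (gamma T)) (pP P)
       (disc_func (discrete (nodes T)) (pm T)) (disc_func (gE P) (beta T)) (iso_p T) \<longleftrightarrow> ?F"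
    if "is_tree T" ?C ?A ?p
  proof -
    interpret tree T using that(1) by unfold_locales
    show ?thesis unfolding inputs_at_def
      by (rule hpullback_square_discrete_iff[OF p.gfunctor_axioms]) (use that(2-) in auto)
  qed
  then show ?thesis unfolding is_ptree_def by blast
qed

end

locale poly_tree = poly P for P :: "('i, 'ia, 'e, 'ea, 'b, 'ba) poly_diagram" +
  fixes T :: "('v, 'i, 'ia, 'e, 'b, 'ba) ptree"
  assumes is_ptree: "is_ptree P T"
begin

sublocale tree T using is_ptree by unfold_locales (simp add: is_ptree_iff)

lemma alpha_obj [simp, intro]: "x \<in> edges T \<Longrightarrow> alpha T x \<in> obj (gI P)"
  and beta_obj [simp, intro]: "e \<in> inputs T \<Longrightarrow> beta T e \<in> obj (gE P)"
  and gamma_obj [simp, intro]: "n \<in> nodes T \<Longrightarrow> gamma T n \<in> obj (gB P)"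
  and iso_s_hom [simp, intro]:
    "e \<in> inputs T \<Longrightarrow> iso_s T e \<in> hom (gI P) (alpha T (sm T e)) (fob (sP P) (beta T e))"
  and iso_p_hom [simp, intro]:
    "e \<in> inputs T \<Longrightarrow> iso_p T e \<in> hom (gB P) (gamma T (pm T e)) (fob (pP P) (beta T e))"
  and iso_t_hom [simp, intro]:
    "n \<in> nodes T \<Longrightarrow> iso_t T n \<in> hom (gI P) (alpha T (tm T n)) (fob (tP P) (gamma T n))"
  and fibre: "n \<in> nodes T \<Longrightarrow>
    fibre_equiv (gE P) (gB P) (pP P) (gamma T n) (inputs_at T n) (beta T) (iso_p T)"
  using is_ptree unfolding is_ptree_iff by (auto simp: PiE_iff)

end

locale poly_emb = poly P + S: poly_tree P S + T: poly_tree P T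
  for P :: "('i, 'ia, 'e, 'ea, 'b, 'ba) poly_diagram"
    and S T :: "('v, 'i, 'ia, 'e, 'b, 'ba) ptree" +
  fixes f :: "('v, 'ia, 'ea, 'ba) emb"
  assumes is_emb: "is_ptree_embedding P S T f"
begin

sublocale tree_emb S T "eA f" "eM f" "eN f"
  using is_emb by unfold_locales (simp add: is_ptree_embedding_def)

lemma emb_ext: "eA f \<in> extensional (edges S)" "eM f \<in> extensional (inputs S)"
    "eN f \<in> extensional (nodes S)" "ealpha f \<in> extensional (edges S)"
    "ebeta f \<in> extensional (inputs S)" "egamma f \<in> extensional (nodes S)"
  and ealpha_hom [simp, intro]:
    "x \<in> edges S \<Longrightarrow> ealpha f x \<in> hom (gI P) (alpha S x) (alpha T (eA f x))"
  and ebeta_hom [simp, intro]: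
    "e \<in> inputs S \<Longrightarrow> ebeta f e \<in> hom (gE P) (beta S e) (beta T (eM f e))"
  and egamma_hom [simp, intro]:
    "n \<in> nodes S \<Longrightarrow> egamma f n \<in> hom (gB P) (gamma S n) (gamma T (eN f n))"
  using is_emb unfolding is_ptree_embedding_def tree_embedding_def by (auto simp: PiE_iff)

lemma ealpha_sm_hom [simp, intro]:
    "e \<in> inputs S \<Longrightarrow> ealpha f (sm S e) \<in> hom (gI P) (alpha S (sm S e)) (alpha T (sm T (eM f e)))"
  and ealpha_tm_hom [simp, intro]:
    "n \<in> nodes S \<Longrightarrow> ealpha f (tm S n) \<in> hom (gI P) (alpha S (tm S n)) (alpha T (tm T (eN f n)))"
  and egamma_pm_hom [simp, intro]:
    "e \<in> inputs S \<Longrightarrow> egamma f (pm S e) \<in> hom (gB P) (gamma S (pm S e)) (gamma T (pm T (eM f e)))"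
  using ealpha_hom[of "sm S e"] ealpha_hom[of "tm S n"] egamma_hom[of "pm S e"] by auto

lemma sqr_s: "e \<in> inputs S \<Longrightarrow> sqr (gI P) (sP P) (alpha S (sm S e)) (beta S e)
    (alpha T (sm T (eM f e))) (beta T (eM f e)) (iso_s S e) (iso_s T (eM f e))
    (ealpha f (sm S e)) (ebeta f e)"
  and sqr_p: "e \<in> inputs S \<Longrightarrow> sqr (gB P) (pP P) (gamma S (pm S e)) (beta S e)
    (gamma T (pm T (eM f e))) (beta T (eM f e)) (iso_p S e) (iso_p T (eM f e))
    (egamma f (pm S e)) (ebeta f e)"
  and sqr_t: "n \<in> nodes S \<Longrightarrow> sqr (gI P) (tP P) (alpha S (tm S n)) (gamma S n)
    (alpha T (tm T (eN f n))) (gamma T (eN f n)) (iso_t S n) (iso_t T (eN f n))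
    (ealpha f (tm S n)) (egamma f n)"
  using is_emb unfolding is_ptree_embedding_def sqr_def by auto

end

text \<open>Later proofs refer to the premises by number: 8 is the pullback condition on fibres, 9
  to 11 are the decorations, and 12 to 14 the squares over \<open>s\<close>, \<open>p\<close> and
  \<open>t\<close>.\<close>

lemma is_ptree_embeddingI:
  assumes "is_tree S"
    and "eA f \<in> edges S \<rightarrow>\<^sub>E edges T" "eM f \<in> inputs S \<rightarrow>\<^sub>E inputs T" "eN f \<in> nodes S \<rightarrow>\<^sub>E nodes T"
    and struct: "\<And>e. e \<in> inputs S \<Longrightarrow> eA f (sm S e) = sm T (eM f e)"
      "\<And>e. e \<in> inputs S \<Longrightarrow> eN f (pm S e) = pm T (eM f e)"
      "\<And>b. b \<in> nodes S \<Longrightarrow> eA f (tm S b) = tm T (eN f b)"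
    and "\<And>b. b \<in> nodes S \<Longrightarrow> bij_betw (eM f) (inputs_at S b) (inputs_at T (eN f b))"
    and "ealpha f \<in> (\<Pi>\<^sub>E x\<in>edges S. hom (gI P) (alpha S x) (alpha T (eA f x)))"
      "ebeta f \<in> (\<Pi>\<^sub>E e\<in>inputs S. hom (gE P) (beta S e) (beta T (eM f e)))"
      "egamma f \<in> (\<Pi>\<^sub>E n\<in>nodes S. hom (gB P) (gamma S n) (gamma T (eN f n)))"
    and "\<And>e. e \<in> inputs S \<Longrightarrow> sqr (gI P) (sP P) (alpha S (sm S e)) (beta S e)
      (alpha T (sm T (eM f e))) (beta T (eM f e)) (iso_s S e) (iso_s T (eM f e))
      (ealpha f (sm S e)) (ebeta f e)"
    and "\<And>e. e \<in> inputs S \<Longrightarrow> sqr (gB P) (pP P) (gamma S (pm S e)) (beta S e)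
      (gamma T (pm T (eM f e))) (beta T (eM f e)) (iso_p S e) (iso_p T (eM f e))
      (egamma f (pm S e)) (ebeta f e)"
    and "\<And>n. n \<in> nodes S \<Longrightarrow> sqr (gI P) (tP P) (alpha S (tm S n)) (gamma S n)
      (alpha T (tm T (eN f n))) (gamma T (eN f n)) (iso_t S n) (iso_t T (eN f n))
      (ealpha f (tm S n)) (egamma f n)"
  shows "is_ptree_embedding P S T f"
proof -
  interpret tree S using assms(1) by unfold_locales
  have "pm S \<in> inputs S \<rightarrow> nodes S" by auto
  from tree_embedding_iff[OF this, of T "eA f" "eM f" "eN f"]
  have "tree_embedding S T (eA f) (eM f) (eN f)" using assms(2-8) by simp
  then show ?thesis using assms(9-) unfolding is_ptree_embedding_def sqr_def by (simp add: struct)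
qed

text \<open>All fields are extensional on the domain, so values there decide equality.\<close>

lemma emb_eqI:
  assumes "is_ptree_embedding P S T f" "is_ptree_embedding P S T' g"
    and "\<And>x. x \<in> edges S \<Longrightarrow> eA f x = eA g x" "\<And>x. x \<in> inputs S \<Longrightarrow> eM f x = eM g x"
      "\<And>x. x \<in> nodes S \<Longrightarrow> eN f x = eN g x" "\<And>x. x \<in> edges S \<Longrightarrow> ealpha f x = ealpha g x"
      "\<And>x. x \<in> inputs S \<Longrightarrow> ebeta f x = ebeta g x" "\<And>x. x \<in> nodes S \<Longrightarrow> egamma f x = egamma g x"
  shows "f = g"
proof (rule emb.equality)
  have *: "eA h \<in> extensional (edges S)" "eM h \<in> extensional (inputs S)"
    "eN h \<in> extensional (nodes S)" "ealpha h \<in> extensional (edges S)"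
    "ebeta h \<in> extensional (inputs S)" "egamma h \<in> extensional (nodes S)"
    if "is_ptree_embedding P S U h" for U h
    using that unfolding is_ptree_embedding_def tree_embedding_def by (auto simp: PiE_iff)
  show "eA f = eA g" "eM f = eM g" "eN f = eN g" "ealpha f = ealpha g" "ebeta f = ebeta g"
    "egamma f = egamma g"
    using *[OF assms(1)] *[OF assms(2)] assms(3-) by (auto intro: extensionalityI)
qed simp

lemma ptree_cat_simps [simp]:
  "obj (ptree_cat P) = {T. is_ptree P T}"
  "f \<in> hom (ptree_cat P) S T \<longleftrightarrow> is_ptree_embedding P S T f"
  "eA (cmp (ptree_cat P) S T U g f) = (\<lambda>x\<in>edges S. eA g (eA f x))"
  "eM (cmp (ptree_cat P) S T U g f) = (\<lambda>x\<in>inputs S. eM g (eM f x))"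
  "eN (cmp (ptree_cat P) S T U g f) = (\<lambda>x\<in>nodes S. eN g (eN f x))"
  "ealpha (cmp (ptree_cat P) S T U g f) = (\<lambda>x\<in>edges S. cmp (gI P) (alpha S x) (alpha T (eA f x))
    (alpha U (eA g (eA f x))) (ealpha g (eA f x)) (ealpha f x))"
  "ebeta (cmp (ptree_cat P) S T U g f) = (\<lambda>e\<in>inputs S. cmp (gE P) (beta S e) (beta T (eM f e))
    (beta U (eM g (eM f e))) (ebeta g (eM f e)) (ebeta f e))"
  "egamma (cmp (ptree_cat P) S T U g f) = (\<lambda>n\<in>nodes S. cmp (gB P) (gamma S n) (gamma T (eN f n))
    (gamma U (eN g (eN f n))) (egamma g (eN f n)) (egamma f n))"
  "eA (idt (ptree_cat P) S) = (\<lambda>x\<in>edges S. x)"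
  "eM (idt (ptree_cat P) S) = (\<lambda>x\<in>inputs S. x)"
  "eN (idt (ptree_cat P) S) = (\<lambda>x\<in>nodes S. x)"
  "ealpha (idt (ptree_cat P) S) = (\<lambda>x\<in>edges S. idt (gI P) (alpha S x))"
  "ebeta (idt (ptree_cat P) S) = (\<lambda>x\<in>inputs S. idt (gE P) (beta S x))"
  "egamma (idt (ptree_cat P) S) = (\<lambda>x\<in>nodes S. idt (gB P) (gamma S x))"
  by (simp_all add: ptree_cat_def)

lemma ptrees_simps [simp]:
  "obj (ptrees P) = {T. is_ptree P T}"
  "f \<in> hom (ptrees P) S T \<longleftrightarrow> is_iso (ptree_cat P) S T f"
  "cmp (ptrees P) = cmp (ptree_cat P)" "idt (ptrees P) = idt (ptree_cat P)"
  by (simp_all add: ptrees_def)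

context poly
begin

abbreviation pcmp where
  "pcmp \<equiv> cmp (ptree_cat P)"

lemma is_ptree_embedding_cmp:
  assumes "is_ptree P S" "is_ptree P T" "is_ptree P U"
    "is_ptree_embedding P S T f" "is_ptree_embedding P T U g"
  shows "is_ptree_embedding P S U (pcmp S T U g f)"
proof -
  interpret S: poly_tree P S by unfold_locales fact
  interpret T: poly_tree P T by unfold_locales fact
  interpret U: poly_tree P U by unfold_locales fact
  interpret f: poly_emb P S T f by unfold_locales fact
  interpret g: poly_emb P T U g by unfold_locales fact
  show ?thesis
  proof (rule is_ptree_embeddingI, goal_cases)
    case (8 b)
    have "bij_betw (eM g \<circ> eM f) (inputs_at S b) (inputs_at U (eN g (eN f b)))"
      using 8 by (intro bij_betw_trans[OF f.bij_inputs_at g.bij_inputs_at]) auto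
    then show ?case using 8
      by (subst bij_betw_cong[where g = "eM g \<circ> eM f"]) (auto simp: inputs_at_def)
  next
    case (12 e)
    then show ?case
      by simp (rule s.sqr_cmp[where i' = "iso_s T (eM f e)"], auto intro: f.sqr_s g.sqr_s)
  next
    case (13 e)
    then show ?case
      by simp (rule p.sqr_cmp[where i' = "iso_p T (eM f e)"], auto intro: f.sqr_p g.sqr_p)
  next
    case (14 n)
    then show ?case
      by simp (rule t.sqr_cmp[where i' = "iso_t T (eN f n)"], auto intro: f.sqr_t g.sqr_t)
  qed (auto intro!: I.cmp_hom E.cmp_hom B.cmp_hom S.is_tree)
qed

lemma is_ptree_embedding_idt:
  assumes "is_ptree P S"
  shows "is_ptree_embedding P S S (idt (ptree_cat P) S)"
proof -
  interpret S: poly_tree P S by unfold_locales fact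
  show ?thesis
  proof (rule is_ptree_embeddingI, goal_cases)
    case (8 b)
    have "bij_betw id (inputs_at S b) (inputs_at S b)" by simp
    then show ?case using 8
      by (subst bij_betw_cong[where g = id]) (auto simp: inputs_at_def)
  qed (auto intro!: I.idt_hom E.idt_hom B.idt_hom S.is_tree s.sqr_idt p.sqr_idt t.sqr_idt)
qed

lemma category_ptree_cat: "category (ptree_cat P)"
proof (unfold_locales, goal_cases)
  case (1 x)
  then show ?case by (simp add: is_ptree_embedding_idt)
next
  case (2 x y z f g)
  then show ?case by (simp add: is_ptree_embedding_cmp)
next
  case (3 S T f)
  then interpret f: poly_emb P S T f by unfold_locales simp_all
  show ?case
    by (rule emb_eqI[of P S T _ T]) (simp_all add: is_ptree_embedding_cmp is_ptree_embedding_idt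
      f.S.is_ptree f.T.is_ptree f.is_emb I.cmp_idt_right E.cmp_idt_right B.cmp_idt_right)
next
  case (4 S T f)
  then interpret f: poly_emb P S T f by unfold_locales simp_all
  show ?case
    by (rule emb_eqI[of P S T _ T]) (simp_all add: is_ptree_embedding_cmp is_ptree_embedding_idt
      f.S.is_ptree f.T.is_ptree f.is_emb I.cmp_idt_left E.cmp_idt_left B.cmp_idt_left)
next
  case (5 S T U V f g h)
  then interpret f: poly_emb P S T f by unfold_locales simp_all
  interpret g: poly_emb P T U g using 5 by unfold_locales simp_all
  interpret h: poly_emb P U V h using 5 by unfold_locales simp_all
  have "is_ptree_embedding P S V (pcmp S U V h (pcmp S T U g f))"
    "is_ptree_embedding P S V (pcmp S T V (pcmp T U V h g) f)"
    using 5 by (auto intro!: is_ptree_embedding_cmp)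
  then show ?case
    by (rule emb_eqI) (simp_all add: I.cmp_assoc E.cmp_assoc B.cmp_assoc)
qed

sublocale PT: category "ptree_cat P" by (rule category_ptree_cat)

lemma groupoid_ptrees: "groupoid (ptrees P)"
  unfolding ptrees_def by (rule PT.groupoid_core)

end


section \<open>Ideal subtrees of \<open>P\<close>-trees and restriction of embeddings to
  them\<close>

lemma emb_restrict_simps [simp]:
  "eA (emb_restrict f S) = restrict (eA f) (edges S)"
  "eM (emb_restrict f S) = restrict (eM f) (inputs S)"
  "eN (emb_restrict f S) = restrict (eN f) (nodes S)"
  "ealpha (emb_restrict f S) = restrict (ealpha f) (edges S)"
  "ebeta (emb_restrict f S) = restrict (ebeta f) (inputs S)"
  "egamma (emb_restrict f S) = restrict (egamma f) (nodes S)"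
  by (simp_all add: emb_restrict_def)

context tree
begin

lemma ideal_edges_root [simp]: "ideal_edges T (tree_root T) = edges T"
proof -
  have "x \<in> ideal_edges T (tree_root T)" if "x \<in> edges T" for x
    using that by (induction rule: tree_induct) (auto simp: sm_ideal_iff)
  then show ?thesis using ideal_edges_sub by blast
qed

lemma ideal_node: "n \<in> ideal_nodes T r \<Longrightarrow> n \<in> nodes T"
  and ideal_input: "e \<in> ideal_inputs T r \<Longrightarrow> e \<in> inputs T"
  and tm_ideal: "n \<in> ideal_nodes T r \<Longrightarrow> tm T n \<in> ideal_edges T r"
  and pm_ideal: "e \<in> ideal_inputs T r \<Longrightarrow> pm T e \<in> ideal_nodes T r"
  by (simp_all add: ideal_nodes_def ideal_inputs_def)

lemmas ideal_closed = ideal_edges_sub ideal_node ideal_input sm_ideal tm_ideal pm_ideal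

lemma inputs_at_ideal_sub: "n \<in> ideal_nodes T r \<Longrightarrow> inputs_at T n \<subseteq> ideal_inputs T r"
  by (auto simp: inputs_at_def ideal_inputs_def)

end

context poly
begin

text \<open>A node of the ideal subtree keeps all its inputs, so the fibre conditions are those of
  \<open>T\<close>.\<close>

lemma is_ptree_ideal_subtree:
  assumes "is_ptree P T" "r \<in> edges T"
  shows "is_ptree P (ideal_subtree T r)"
proof -
  interpret poly_tree P T by unfold_locales fact
  have "fibre_equiv (gE P) (gB P) (pP P) (gamma T n) (inputs_at T n)
      (restrict (beta T) (ideal_inputs T r)) (restrict (iso_p T) (ideal_inputs T r))"
    if "n \<in> ideal_nodes T r" for n
    using fibre[of n] that inputs_at_ideal_sub[OF that] ideal_node[OF that]
    by (subst fibre_equiv_cong[where \<beta>' = "beta T" and \<phi>' = "iso_p T"]) auto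
  then show ?thesis
    unfolding is_ptree_iff using is_tree_ideal_subtree[OF is_tree assms(2)]
    by (auto simp: ideal_closed)
qed

text \<open>Every edge of \<open>U\<close> lies above its root and embeddings preserve this
  relation, so the image lies above \<open>r\<close>.\<close>

lemma is_ptree_embedding_into_ideal:
  assumes "is_ptree P U" "is_ptree P T" "is_ptree_embedding P U T f" "eA f (tree_root U) = r"
  shows "is_ptree_embedding P U (ideal_subtree T r) f"
proof -
  interpret U: poly_tree P U by unfold_locales fact
  interpret T: poly_tree P T by unfold_locales fact
  interpret f: poly_emb P U T f by unfold_locales fact
  have A: "eA f x \<in> ideal_edges T r" if "x \<in> edges U" for x
    using f.map_ideal[of x "tree_root U"] assms(4) that by simp
  have N: "eN f n \<in> ideal_nodes T r" if "n \<in> nodes U" for n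
    using A[of "tm U n"] that by simp
  have M: "eM f e \<in> ideal_inputs T r" if "e \<in> inputs U" for e
    using N[of "pm U e"] that by simp
  have sm: "sm T (eM f e) \<in> ideal_edges T r" if "e \<in> inputs U" for e
    using M T.sm_ideal that by blast
  show ?thesis
    using f.bij_inputs_at f.sqr_s f.sqr_p f.sqr_t
    by (intro is_ptree_embeddingI)
      (auto simp: A N M sm extensional_arb[OF f.emb_ext(1)] extensional_arb[OF f.emb_ext(2)]
        extensional_arb[OF f.emb_ext(3)] extensional_arb[OF f.emb_ext(4)]
        extensional_arb[OF f.emb_ext(5)] extensional_arb[OF f.emb_ext(6)] PiE_iff extensional_def U.is_tree)
qed

text \<open>Arrows of forests land in branches, whereas the gluing lemma takes maps into a whole
  tree; this passes from one to the other.\<close>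

lemma is_ptree_embedding_from_ideal:
  assumes "is_ptree P U" "is_ptree P T" "r \<in> edges T"
    "is_ptree_embedding P U (ideal_subtree T r) f"
  shows "is_ptree_embedding P U T f"
proof -
  interpret U: poly_tree P U by unfold_locales fact
  interpret T: poly_tree P T by unfold_locales fact
  interpret f: poly_emb P U "ideal_subtree T r" f
    using assms is_ptree_ideal_subtree by unfold_locales
  have A: "eA f x \<in> ideal_edges T r" if "x \<in> edges U" for x
    using f.map_edge[of x] that by simp
  have N: "eN f n \<in> ideal_nodes T r" if "n \<in> nodes U" for n
    using f.map_node[of n] that by simp
  have M: "eM f e \<in> ideal_inputs T r" if "e \<in> inputs U" for e
    using f.map_input[of e] that by simp
  note mem = A N M A[THEN T.ideal_edges_sub] N[THEN T.ideal_node] M[THEN T.ideal_input]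
    M[THEN T.sm_ideal] N[THEN T.tm_ideal] M[THEN T.pm_ideal]
  show ?thesis
  proof (rule is_ptree_embeddingI, goal_cases)
    case (8 b)
    then show ?case using f.bij_inputs_at[of b] by (simp add: mem)
  next
    case (9)
    show ?case using f.ealpha_hom f.emb_ext mem by (auto simp: PiE_iff)
  next
    case (10)
    show ?case using f.ebeta_hom f.emb_ext mem by (auto simp: PiE_iff)
  next
    case (11)
    show ?case using f.egamma_hom f.emb_ext mem by (auto simp: PiE_iff)
  next
    case (12 e)
    then show ?case using f.sqr_s[of e] by (simp add: mem)
  next
    case (13 e)
    then show ?case using f.sqr_p[of e] by (simp add: mem)
  next
    case (14 n)
    then show ?case using f.sqr_t[of n] by (simp add: mem)
  qed (use f.emb_ext in \<open>auto simp: mem PiE_iff U.is_tree\<close>)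
qed

lemma is_ptree_embedding_restrict:
  assumes "is_ptree P T" "is_ptree P U" "is_ptree_embedding P T U f" "r \<in> edges T"
  shows "is_ptree_embedding P (ideal_subtree T r) U (emb_restrict f (ideal_subtree T r))"
proof -
  interpret T: poly_tree P T by unfold_locales fact
  interpret U: poly_tree P U by unfold_locales fact
  interpret f: poly_emb P T U f by unfold_locales fact
  show ?thesis
  proof (rule is_ptree_embeddingI, goal_cases)
    case (8 b)
    then have b: "b \<in> nodes T" "inputs_at T b \<subseteq> ideal_inputs T r"
      using T.inputs_at_ideal_sub[of b r] by (auto simp: T.ideal_closed)
    then show ?case using f.bij_inputs_at[of b] 8
      by (subst bij_betw_cong[where g = "eM f"]) auto
  next
    case (12 e)
    then show ?case using f.sqr_s[of e] by (simp add: T.ideal_closed)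
  next
    case (13 e)
    then show ?case using f.sqr_p[of e] by (simp add: T.ideal_closed)
  next
    case (14 n)
    then show ?case using f.sqr_t[of n] by (simp add: T.ideal_closed)
  qed (use is_tree_ideal_subtree[OF T.is_tree assms(4)] in \<open>auto simp: T.ideal_closed\<close>)
qed

lemma is_ptree_embedding_ideal:
  assumes "is_ptree P T" "is_ptree P U" "is_ptree_embedding P T U f" "r \<in> edges T"
  shows "is_ptree_embedding P (ideal_subtree T r) (ideal_subtree U (eA f r))
    (emb_restrict f (ideal_subtree T r))"
proof -
  interpret T: poly_tree P T by unfold_locales fact
  show ?thesis
    using assms is_ptree_embedding_restrict[OF assms] is_ptree_ideal_subtree T.is_tree
    by (intro is_ptree_embedding_into_ideal) auto
qed

text \<open>Together with \<open>emb_restrict_idt\<close> this is the functoriality of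
  \<open>w\<close> on each branch. The middle object has to be the ideal subtree at
  \<open>eA f r\<close>, where the restriction of \<open>f\<close> lands.\<close>

lemma emb_restrict_cmp:
  assumes "is_ptree P T" "is_ptree P U" "is_ptree P V" "is_ptree_embedding P T U f"
    "is_ptree_embedding P U V g" "r \<in> edges T"
  shows "emb_restrict (pcmp T U V g f) (ideal_subtree T r) =
    pcmp (ideal_subtree T r) (ideal_subtree U (eA f r)) (ideal_subtree V (eA g (eA f r)))
      (emb_restrict g (ideal_subtree U (eA f r))) (emb_restrict f (ideal_subtree T r))"
proof -
  interpret T: poly_tree P T by unfold_locales fact
  interpret f: poly_emb P T U f using assms by unfold_locales
  interpret g: poly_emb P U V g using assms by unfold_locales
  interpret F: poly_emb P "ideal_subtree T r" "ideal_subtree U (eA f r)" "emb_restrict f (ideal_subtree T r)"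
    by unfold_locales (use assms in \<open>auto intro!: is_ptree_embedding_ideal is_ptree_ideal_subtree\<close>)
  interpret G: poly_emb P "ideal_subtree U (eA f r)" "ideal_subtree V (eA g (eA f r))"
    "emb_restrict g (ideal_subtree U (eA f r))"
    by unfold_locales (use assms in \<open>auto intro!: is_ptree_embedding_ideal is_ptree_ideal_subtree\<close>)
  have mem: "eA f x \<in> ideal_edges U (eA f r)" "eA g (eA f x) \<in> ideal_edges V (eA g (eA f r))"
    if "x \<in> ideal_edges T r" for x
    using that F.map_edge[of x] G.map_edge[of "eA f x"] by auto
  have mem': "eM f x \<in> ideal_inputs U (eA f r)" "eM g (eM f x) \<in> ideal_inputs V (eA g (eA f r))"
    if "x \<in> ideal_inputs T r" for x
    using that F.map_input[of x] G.map_input[of "eM f x"] by auto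
  have mem'': "eN f x \<in> ideal_nodes U (eA f r)" "eN g (eN f x) \<in> ideal_nodes V (eA g (eA f r))"
    if "x \<in> ideal_nodes T r" for x
    using that F.map_node[of x] G.map_node[of "eN f x"] by auto
  show ?thesis
    by (rule emb.equality) (auto simp: T.ideal_closed mem mem' mem'' intro!: restrict_ext)
qed

lemma emb_restrict_idt:
  assumes "is_ptree P T"
  shows "emb_restrict (idt (ptree_cat P) T) (ideal_subtree T r) = idt (ptree_cat P) (ideal_subtree T r)"
proof -
  interpret T: poly_tree P T by unfold_locales fact
  show ?thesis
    by (rule emb.equality) (auto simp: T.ideal_closed intro!: restrict_ext)
qed

end

section \<open>Isomorphisms of \<open>P\<close>-trees\<close>

locale ptree_iso = poly_emb P S T f + inv: poly_emb P T S g
  for P :: "('i, 'ia, 'e, 'ea, 'b, 'ba) poly_diagram"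
    and S T :: "('v, 'i, 'ia, 'e, 'b, 'ba) ptree" and f g :: "('v, 'ia, 'ea, 'ba) emb" +
  assumes left_inv: "pcmp S T S g f = idt (ptree_cat P) S"
    and right_inv: "pcmp T S T f g = idt (ptree_cat P) T"
begin

lemma edge_inv [simp]: "x \<in> edges S \<Longrightarrow> eA g (eA f x) = x"
  and edge_inv' [simp]: "y \<in> edges T \<Longrightarrow> eA f (eA g y) = y"
  and node_inv' [simp]: "n \<in> nodes T \<Longrightarrow> eN f (eN g n) = n"
  using fun_cong[OF arg_cong[OF left_inv, of eA], of x] fun_cong[OF arg_cong[OF right_inv, of eA], of y]
    fun_cong[OF arg_cong[OF right_inv, of eN], of n]
  by simp_all

text \<open>An embedding may send the root to an interior edge. An invertible one cannot: if the
  inverse sent the root of \<open>T\<close> to \<open>sm S e\<close>, then the root of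
  \<open>T\<close> would be \<open>sm T (eM f e)\<close>.\<close>

lemma map_root [simp]: "eA f (tree_root S) = tree_root T"
proof -
  have "eA g (tree_root T) \<in> edges S" by simp
  then show ?thesis
  proof (cases rule: S.edge_cases)
    case 1
    then show ?thesis using edge_inv'[of "tree_root T"] by simp
  next
    case (2 e)
    then have "tree_root T = sm T (eM f e)" using edge_inv'[of "tree_root T"] by simp
    then show ?thesis using 2 by (metis T.sm_neq_root map_input)
  qed
qed

text \<open>If the image were the output of a node of \<open>T\<close>, the inverse would exhibit
  \<open>l\<close> as the output of a node of \<open>S\<close>.\<close>

lemma map_leaf [simp]:
  assumes "l \<in> leaves S"
  shows "eA f l \<in> leaves T"
proof -
  have "eA f l \<noteq> tm T n" if "n \<in> nodes T" for n
  proof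
    assume "eA f l = tm T n"
    then have "eA f l = eA f (tm S (eN g n))" using that by simp
    then have "l = tm S (eN g n)" using assms that by (metis DiffD1 S.tm_edge edge_inv inv.map_node leaves_def)
    then show False using assms that by (auto simp: leaves_def)
  qed
  then show ?thesis using assms by (auto simp: leaves_def)
qed

end

context poly
begin

lemma ptree_isoE:
  assumes "is_iso (ptree_cat P) S T f" "is_ptree P S" "is_ptree P T"
  obtains g where "ptree_iso P S T f g" "ptree_iso P T S g f"
proof -
  obtain g where "inverse_arrows (ptree_cat P) S T f g" using assms(1) unfolding is_iso_def by blast
  then have "ptree_iso P S T f g" "ptree_iso P T S g f"
    using assms(2,3) unfolding inverse_arrows_def by (unfold_locales; simp)+
  then show thesis by (rule that)
qed

lemma is_iso_embedding: "is_iso (ptree_cat P) S T f \<Longrightarrow> is_ptree_embedding P S T f"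
  by (auto simp: is_iso_def inverse_arrows_def)

lemma is_iso_map_root:
  "\<lbrakk>is_iso (ptree_cat P) S T f; is_ptree P S; is_ptree P T\<rbrakk> \<Longrightarrow> eA f (tree_root S) = tree_root T"
  by (metis ptree_isoE ptree_iso.map_root)

lemma is_iso_bij_leaves:
  assumes "is_iso (ptree_cat P) S T f" "is_ptree P S" "is_ptree P T"
  shows "bij_betw (eA f) (leaves S) (leaves T)"
proof -
  obtain g where g: "ptree_iso P S T f g" "ptree_iso P T S g f" using assms by (rule ptree_isoE)
  interpret ptree_iso P S T f g by (rule g(1))
  interpret g: ptree_iso P T S g f by (rule g(2))
  show ?thesis by (intro bij_betw_byWitness[where f' = "eA g"]) auto
qed

lemma is_iso_ideal:
  assumes "is_iso (ptree_cat P) S T f" "is_ptree P S" "is_ptree P T" "r \<in> edges S"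
  shows "is_iso (ptree_cat P) (ideal_subtree S r) (ideal_subtree T (eA f r))
    (emb_restrict f (ideal_subtree S r))"
proof -
  obtain g where g: "ptree_iso P S T f g" using assms(1-3) by (rule ptree_isoE)
  interpret ptree_iso P S T f g by (rule g)
  have "inverse_arrows (ptree_cat P) (ideal_subtree S r) (ideal_subtree T (eA f r))
    (emb_restrict f (ideal_subtree S r)) (emb_restrict g (ideal_subtree T (eA f r)))"
    unfolding inverse_arrows_def
    using assms is_ptree_embedding_ideal[OF assms(2,3) is_emb assms(4)]
      is_ptree_embedding_ideal[OF assms(3,2) inv.is_emb, of "eA f r"]
      emb_restrict_cmp[OF assms(2,3,2) is_emb inv.is_emb assms(4)]
      emb_restrict_cmp[OF assms(3,2,3) inv.is_emb is_emb, of "eA f r"]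
    by (simp add: left_inv right_inv emb_restrict_idt)
  then show ?thesis unfolding is_iso_def by blast
qed

end


section \<open>The pushout property of the ambient tree\<close>

section \<open>Gluing along a cut\<close>

locale cut = poly_emb P S T c
  for P :: "('i, 'ia, 'e, 'ea, 'b, 'ba) poly_diagram"
    and S T :: "('v, 'i, 'ia, 'e, 'b, 'ba) ptree" and c :: "('v, 'ia, 'ea, 'ba) emb" +
  assumes root_preserving: "eA c (tree_root S) = tree_root T"
begin

sublocale root_emb S T "eA c" "eM c" "eN c"
  by unfold_locales (rule root_preserving)

abbreviation branch :: "'v \<Rightarrow> ('v, 'i, 'ia, 'e, 'b, 'ba) ptree" where
  "branch l \<equiv> ideal_subtree T (eA c l)"

text \<open>Each edge, input and node of \<open>T\<close> comes from \<open>S\<close> or lies in a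
  branch. In a branch the restrictions decide; over \<open>S\<close> the composites with
  \<open>c\<close> decide, because the isomorphisms belonging to \<open>c\<close> can be
  cancelled.\<close>

lemma glue_unique:
  assumes "is_ptree P U" "is_ptree_embedding P T U \<tau>" "is_ptree_embedding P T U \<tau>'"
    and c: "pcmp S T U \<tau> c = pcmp S T U \<tau>' c"
    and r: "\<And>l. l \<in> leaves S \<Longrightarrow> emb_restrict \<tau> (branch l) = emb_restrict \<tau>' (branch l)"
  shows "\<tau> = \<tau>'"
proof -
  interpret U: poly_tree P U by unfold_locales fact
  interpret \<tau>: poly_emb P T U \<tau> by unfold_locales fact
  interpret \<tau>': poly_emb P T U \<tau>' by unfold_locales fact
  note rl = arg_cong[OF r, of _ eA] arg_cong[OF r, of _ eM] arg_cong[OF r, of _ eN]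
    arg_cong[OF r, of _ ealpha] arg_cong[OF r, of _ ebeta] arg_cong[OF r, of _ egamma]
  have A: "eA \<tau> x = eA \<tau>' x \<and> ealpha \<tau> x = ealpha \<tau>' x" if "x \<in> edges T" for x
    using that
  proof (cases rule: edge_decomp)
    case (1 y)
    have eq: "eA \<tau> x = eA \<tau>' x" using 1 fun_cong[OF arg_cong[OF c, of eA], of y] by simp
    have "cmp (gI P) (alpha S y) (alpha T x) (alpha U (eA \<tau>' x)) (ealpha \<tau> x) (ealpha c y)
        = cmp (gI P) (alpha S y) (alpha T x) (alpha U (eA \<tau>' x)) (ealpha \<tau>' x) (ealpha c y)"
      using 1 eq fun_cong[OF arg_cong[OF c, of ealpha], of y] by simp
    then have "ealpha \<tau> x = ealpha \<tau>' x"
      by (rule I.right_cancel) (use 1 eq \<tau>.ealpha_hom[of x] in auto)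
    then show ?thesis using eq by simp
  next
    case (2 l)
    then show ?thesis using fun_cong[OF rl(1), of l x] fun_cong[OF rl(4), of l x] by simp
  qed
  have M: "eM \<tau> x = eM \<tau>' x \<and> ebeta \<tau> x = ebeta \<tau>' x" if "x \<in> inputs T" for x
    using that
  proof (cases rule: input_decomp)
    case (1 y)
    have eq: "eM \<tau> x = eM \<tau>' x" using 1 fun_cong[OF arg_cong[OF c, of eM], of y] by simp
    have "cmp (gE P) (beta S y) (beta T x) (beta U (eM \<tau>' x)) (ebeta \<tau> x) (ebeta c y)
        = cmp (gE P) (beta S y) (beta T x) (beta U (eM \<tau>' x)) (ebeta \<tau>' x) (ebeta c y)"
      using 1 eq fun_cong[OF arg_cong[OF c, of ebeta], of y] by simp
    then have "ebeta \<tau> x = ebeta \<tau>' x"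
      by (rule E.right_cancel) (use 1 eq \<tau>.ebeta_hom[of x] in auto)
    then show ?thesis using eq by simp
  next
    case (2 l)
    then show ?thesis using fun_cong[OF rl(2), of l x] fun_cong[OF rl(5), of l x] by simp
  qed
  have N: "eN \<tau> x = eN \<tau>' x \<and> egamma \<tau> x = egamma \<tau>' x" if "x \<in> nodes T" for x
    using that
  proof (cases rule: node_decomp)
    case (1 y)
    have eq: "eN \<tau> x = eN \<tau>' x" using 1 fun_cong[OF arg_cong[OF c, of eN], of y] by simp
    have "cmp (gB P) (gamma S y) (gamma T x) (gamma U (eN \<tau>' x)) (egamma \<tau> x) (egamma c y)
        = cmp (gB P) (gamma S y) (gamma T x) (gamma U (eN \<tau>' x)) (egamma \<tau>' x) (egamma c y)"
      using 1 eq fun_cong[OF arg_cong[OF c, of egamma], of y] by simp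
    then have "egamma \<tau> x = egamma \<tau>' x"
      by (rule B.right_cancel) (use 1 eq \<tau>.egamma_hom[of x] in auto)
    then show ?thesis using eq by simp
  next
    case (2 l)
    then show ?thesis using fun_cong[OF rl(3), of l x] fun_cong[OF rl(6), of l x] by simp
  qed
  show ?thesis
    by (rule emb_eqI[OF assms(2,3)]) (simp_all add: A M N)
qed

text \<open>The premises \<open>base\<close> and \<open>colour\<close> express agreement on the
  edges \<open>eA c l\<close>, the only overlap. Each vertex of \<open>T\<close> has its value and
  its isomorphism prescribed by \<open>S\<close>, by a branch, or by both; a solution exists at each
  vertex, and choosing one there defines \<tau>.\<close>

lemma glue_exists:
  assumes U: "is_ptree P U" and g: "is_ptree_embedding P S U g"
    and h: "\<And>l. l \<in> leaves S \<Longrightarrow> is_ptree_embedding P (branch l) U (h l)"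
    and base: "\<And>l. l \<in> leaves S \<Longrightarrow> eA (h l) (eA c l) = eA g l"
    and colour: "\<And>l. l \<in> leaves S \<Longrightarrow> cmp (gI P) (alpha S l) (alpha T (eA c l)) (alpha U (eA g l))
      (ealpha (h l) (eA c l)) (ealpha c l) = ealpha g l"
  obtains \<tau> where "is_ptree_embedding P T U \<tau>" "pcmp S T U \<tau> c = g"
    "\<And>l. l \<in> leaves S \<Longrightarrow> emb_restrict \<tau> (branch l) = h l"
proof -
  interpret U: poly_tree P U by unfold_locales fact
  interpret g: poly_emb P S U g by unfold_locales fact
  have br: "is_ptree P (branch l)" if "l \<in> leaves S" for l
    using that by (intro is_ptree_ideal_subtree T.is_ptree) auto
  have h': "poly_emb P (branch l) U (h l)" if "l \<in> leaves S" for l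
    using that h br U by unfold_locales auto
  have h_edge: "eA (h l) x \<in> edges U"
      "ealpha (h l) x \<in> hom (gI P) (alpha T x) (alpha U (eA (h l) x))"
    if "l \<in> leaves S" "x \<in> ideal_edges T (eA c l)" for l x
  proof -
    interpret h: poly_emb P "branch l" U "h l" using h'[OF that(1)] .
    show "eA (h l) x \<in> edges U" "ealpha (h l) x \<in> hom (gI P) (alpha T x) (alpha U (eA (h l) x))"
      using that h.map_edge[of x] h.ealpha_hom[of x] by simp_all
  qed
  have h_input: "eM (h l) e \<in> inputs U"
      "ebeta (h l) e \<in> hom (gE P) (beta T e) (beta U (eM (h l) e))"
      "eA (h l) (sm T e) = sm U (eM (h l) e)" "eN (h l) (pm T e) = pm U (eM (h l) e)"
    if "l \<in> leaves S" "e \<in> ideal_inputs T (eA c l)" for l e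
  proof -
    interpret h: poly_emb P "branch l" U "h l" using h'[OF that(1)] .
    show "eM (h l) e \<in> inputs U" "ebeta (h l) e \<in> hom (gE P) (beta T e) (beta U (eM (h l) e))"
      "eA (h l) (sm T e) = sm U (eM (h l) e)" "eN (h l) (pm T e) = pm U (eM (h l) e)"
      using that h.map_input[of e] h.ebeta_hom[of e] h.map_sm[of e] h.map_pm[of e] by simp_all
  qed
  have h_node: "eN (h l) b \<in> nodes U"
      "egamma (h l) b \<in> hom (gB P) (gamma T b) (gamma U (eN (h l) b))"
      "eA (h l) (tm T b) = tm U (eN (h l) b)"
      "bij_betw (eM (h l)) (inputs_at T b) (inputs_at U (eN (h l) b))"
    if "l \<in> leaves S" "b \<in> ideal_nodes T (eA c l)" for l b
  proof -
    interpret h: poly_emb P "branch l" U "h l" using h'[OF that(1)] .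
    show "eN (h l) b \<in> nodes U" "egamma (h l) b \<in> hom (gB P) (gamma T b) (gamma U (eN (h l) b))"
      "eA (h l) (tm T b) = tm U (eN (h l) b)"
      "bij_betw (eM (h l)) (inputs_at T b) (inputs_at U (eN (h l) b))"
      using that h.map_node[of b] h.egamma_hom[of b] h.map_tm[of b] h.bij_inputs_at[of b]
      by simp_all
  qed
  \<comment> \<open>The value \<open>u\<close> and isomorphism \<open>w\<close> at \<open>x\<close>
    are specified by all constraints at once, from \<open>S\<close> and from each branch, so that no
    case distinction enters the definition of the glued map.\<close>
  define QA where "QA x u w \<longleftrightarrow> u \<in> edges U \<and> w \<in> hom (gI P) (alpha T x) (alpha U u) \<and>
      (\<forall>y\<in>edges S. x = eA c y \<longrightarrow> u = eA g y \<and>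
        cmp (gI P) (alpha S y) (alpha T x) (alpha U u) w (ealpha c y) = ealpha g y) \<and>
      (\<forall>l\<in>leaves S. x \<in> ideal_edges T (eA c l) \<longrightarrow> u = eA (h l) x \<and> w = ealpha (h l) x)" for x u w
  have "\<exists>u w. QA x u w" if "x \<in> edges T" for x
    using that
  proof (cases rule: edge_decomp)
    case (1 y)
    \<comment> \<open>This is the only arrow whose composite with \<open>ealpha c y\<close> is
      \<open>ealpha g y\<close>.\<close>
    define w where "w = cmp (gI P) (alpha T x) (alpha S y) (alpha U (eA g y)) (ealpha g y)
      (inv_arr (gI P) (alpha S y) (alpha T x) (ealpha c y))"
    have w: "w \<in> hom (gI P) (alpha T x) (alpha U (eA g y))"
      unfolding w_def by (rule I.cmp_hom) (use 1 in \<open>auto intro: I.inv_arr_hom\<close>)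
    have w_cmp: "cmp (gI P) (alpha S y) (alpha T x) (alpha U (eA g y)) w (ealpha c y) = ealpha g y"
      unfolding w_def by (rule I.cmp_inv_cancel) (use 1 in auto)
    \<comment> \<open>The overlap: an edge \<open>eA c y\<close> lies in the branch at
      \<open>l\<close> only for \<open>y = l\<close>, and there \<open>base\<close> and
      \<open>colour\<close> reconcile the two prescriptions.\<close>
    have "eA g y = eA (h l) x \<and> w = ealpha (h l) x"
      if l: "l \<in> leaves S" "x \<in> ideal_edges T (eA c l)" for l
    proof -
      have y: "y = l" using map_edge_ideal_iff 1 l by blast
      then have eq: "eA g y = eA (h l) x" using base[OF l(1)] 1 by simp
      have "cmp (gI P) (alpha S y) (alpha T x) (alpha U (eA g y)) w (ealpha c y)
        = cmp (gI P) (alpha S y) (alpha T x) (alpha U (eA g y)) (ealpha (h l) x) (ealpha c y)"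
        using w_cmp colour[OF l(1)] y 1 by simp
      then have "w = ealpha (h l) x"
        by (rule I.right_cancel) (use 1 w h_edge[OF l] eq in auto)
      then show ?thesis using eq by simp
    qed
    then show ?thesis unfolding QA_def using 1 w w_cmp edge_eq_iff
      by (intro exI[of _ "eA g y"] exI[of _ w]) auto
  next
    case (2 l)
    have "eA (h l) x = eA (h l') x \<and> ealpha (h l) x = ealpha (h l') x"
      if "l' \<in> leaves S" "x \<in> ideal_edges T (eA c l')" for l'
      using that 2 ideals_disjoint by metis
    moreover have "eA (h l) x = eA g y \<and> cmp (gI P) (alpha S y) (alpha T x)
        (alpha U (eA (h l) x)) (ealpha (h l) x) (ealpha c y) = ealpha g y"
      if "y \<in> edges S" "x = eA c y" for y
    proof -
      have "y = l" using that 2 map_edge_ideal_iff by blast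
      then show ?thesis using that(2) base[OF 2(1)] colour[OF 2(1)] by simp
    qed
    ultimately show ?thesis unfolding QA_def using h_edge[OF 2]
      by (intro exI[of _ "eA (h l) x"] exI[of _ "ealpha (h l) x"]) blast
  qed
  then obtain a w where Q: "\<And>x. x \<in> edges T \<Longrightarrow> QA x (a x) (w x)" by metis
  have a: "a x \<in> edges U \<and> w x \<in> hom (gI P) (alpha T x) (alpha U (a x))" if "x \<in> edges T" for x
    using Q that unfolding QA_def by blast
  have ac: "a (eA c y) = eA g y \<and> cmp (gI P) (alpha S y) (alpha T (eA c y))
      (alpha U (eA g y)) (w (eA c y)) (ealpha c y) = ealpha g y"
    if "y \<in> edges S" for y
    using Q[OF map_edge[OF that]] that unfolding QA_def by metis
  have al: "a x = eA (h l) x \<and> w x = ealpha (h l) x"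
    if "l \<in> leaves S" "x \<in> ideal_edges T (eA c l)" for l x
    using Q[OF T.ideal_edges_sub[OF that(2)]] that unfolding QA_def by blast
  \<comment> \<open>Inputs, and likewise nodes below, have no overlap, so the two kinds of
    constraint never meet.\<close>
  define QM where "QM x u w \<longleftrightarrow> u \<in> inputs U \<and> w \<in> hom (gE P) (beta T x) (beta U u) \<and>
      (\<forall>y\<in>inputs S. x = eM c y \<longrightarrow> u = eM g y \<and>
        cmp (gE P) (beta S y) (beta T x) (beta U u) w (ebeta c y) = ebeta g y) \<and>
      (\<forall>l\<in>leaves S. x \<in> ideal_inputs T (eA c l) \<longrightarrow> u = eM (h l) x \<and> w = ebeta (h l) x)" for x u w
  have "\<exists>u w. QM x u w" if "x \<in> inputs T" for x
    using that
  proof (cases rule: input_decomp)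
    case (1 y)
    define w where "w = cmp (gE P) (beta T x) (beta S y) (beta U (eM g y)) (ebeta g y)
      (inv_arr (gE P) (beta S y) (beta T x) (ebeta c y))"
    have w: "w \<in> hom (gE P) (beta T x) (beta U (eM g y))"
      unfolding w_def by (rule E.cmp_hom) (use 1 in \<open>auto intro: E.inv_arr_hom\<close>)
    have "cmp (gE P) (beta S y) (beta T x) (beta U (eM g y)) w (ebeta c y) = ebeta g y"
      unfolding w_def by (rule E.cmp_inv_cancel) (use 1 in auto)
    then show ?thesis unfolding QM_def using 1 w input_eq_iff map_input_not_ideal
      by (intro exI[of _ "eM g y"] exI[of _ w]) auto
  next
    case (2 l)
    have "eM (h l) x = eM (h l') x \<and> ebeta (h l) x = ebeta (h l') x"
      if "l' \<in> leaves S" "x \<in> ideal_inputs T (eA c l')" for l'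
      using that 2 ideal_inputs_disjoint by metis
    then show ?thesis unfolding QM_def using h_input(1,2)[OF 2] 2 map_input_not_ideal
      by (intro exI[of _ "eM (h l) x"] exI[of _ "ebeta (h l) x"]) blast
  qed
  then obtain m v where Q: "\<And>x. x \<in> inputs T \<Longrightarrow> QM x (m x) (v x)" by metis
  have m: "m x \<in> inputs U \<and> v x \<in> hom (gE P) (beta T x) (beta U (m x))" if "x \<in> inputs T" for x
    using Q that unfolding QM_def by blast
  have mc: "m (eM c y) = eM g y \<and> cmp (gE P) (beta S y) (beta T (eM c y))
      (beta U (eM g y)) (v (eM c y)) (ebeta c y) = ebeta g y"
    if "y \<in> inputs S" for y
    using Q[OF map_input[OF that]] that unfolding QM_def by metis
  have ml: "m x = eM (h l) x \<and> v x = ebeta (h l) x"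
    if "l \<in> leaves S" "x \<in> ideal_inputs T (eA c l)" for l x
    using Q[OF T.ideal_input[OF that(2)]] that unfolding QM_def by blast
  define QN where "QN x u w \<longleftrightarrow> u \<in> nodes U \<and> w \<in> hom (gB P) (gamma T x) (gamma U u) \<and>
      (\<forall>y\<in>nodes S. x = eN c y \<longrightarrow> u = eN g y \<and>
        cmp (gB P) (gamma S y) (gamma T x) (gamma U u) w (egamma c y) = egamma g y) \<and>
      (\<forall>l\<in>leaves S. x \<in> ideal_nodes T (eA c l) \<longrightarrow> u = eN (h l) x \<and> w = egamma (h l) x)" for x u w
  have "\<exists>u w. QN x u w" if "x \<in> nodes T" for x
    using that
  proof (cases rule: node_decomp)
    case (1 y)
    define w where "w = cmp (gB P) (gamma T x) (gamma S y) (gamma U (eN g y)) (egamma g y)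
      (inv_arr (gB P) (gamma S y) (gamma T x) (egamma c y))"
    have w: "w \<in> hom (gB P) (gamma T x) (gamma U (eN g y))"
      unfolding w_def by (rule B.cmp_hom) (use 1 in \<open>auto intro: B.inv_arr_hom\<close>)
    have "cmp (gB P) (gamma S y) (gamma T x) (gamma U (eN g y)) w (egamma c y) = egamma g y"
      unfolding w_def by (rule B.cmp_inv_cancel) (use 1 in auto)
    then show ?thesis unfolding QN_def using 1 w node_eq_iff map_node_not_ideal
      by (intro exI[of _ "eN g y"] exI[of _ w]) auto
  next
    case (2 l)
    have "eN (h l) x = eN (h l') x \<and> egamma (h l) x = egamma (h l') x"
      if "l' \<in> leaves S" "x \<in> ideal_nodes T (eA c l')" for l'
      using that 2 ideal_nodes_disjoint by metis
    then show ?thesis unfolding QN_def using h_node(1,2)[OF 2] 2 map_node_not_ideal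
      by (intro exI[of _ "eN (h l) x"] exI[of _ "egamma (h l) x"]) blast
  qed
  then obtain n u where Q: "\<And>x. x \<in> nodes T \<Longrightarrow> QN x (n x) (u x)" by metis
  have n: "n x \<in> nodes U \<and> u x \<in> hom (gB P) (gamma T x) (gamma U (n x))" if "x \<in> nodes T" for x
    using Q that unfolding QN_def by blast
  have nc: "n (eN c y) = eN g y \<and> cmp (gB P) (gamma S y) (gamma T (eN c y))
      (gamma U (eN g y)) (u (eN c y)) (egamma c y) = egamma g y"
    if "y \<in> nodes S" for y
    using Q[OF map_node[OF that]] that unfolding QN_def by metis
  have nl: "n x = eN (h l) x \<and> u x = egamma (h l) x"
    if "l \<in> leaves S" "x \<in> ideal_nodes T (eA c l)" for l x
    using Q[OF T.ideal_node[OF that(2)]] that unfolding QN_def by blast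
  define \<tau> where "\<tau> = \<lparr>eA = restrict a (edges T), eM = restrict m (inputs T),
    eN = restrict n (nodes T), ealpha = restrict w (edges T), ebeta = restrict v (inputs T),
    egamma = restrict u (nodes T)\<rparr>"
  have \<tau>_simps [simp]: "eA \<tau> = restrict a (edges T)" "eM \<tau> = restrict m (inputs T)"
    "eN \<tau> = restrict n (nodes T)" "ealpha \<tau> = restrict w (edges T)"
    "ebeta \<tau> = restrict v (inputs T)" "egamma \<tau> = restrict u (nodes T)"
    by (simp_all add: \<tau>_def)
  have sm: "a (sm T e) = sm U (m e)" if "e \<in> inputs T" for e
    using that
  proof (cases rule: input_decomp)
    case (1 e')
    then show ?thesis using ac[of "sm S e'"] mc[of e'] by simp
  next
    case (2 l)
    then show ?thesis using al[OF 2(1), of "sm T e"] ml[OF 2] h_input[OF 2] T.sm_ideal by simp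
  qed
  have pm: "n (pm T e) = pm U (m e)" if "e \<in> inputs T" for e
    using that
  proof (cases rule: input_decomp)
    case (1 e')
    then show ?thesis using nc[of "pm S e'"] mc[of e'] by simp
  next
    case (2 l)
    then show ?thesis using nl[OF 2(1), of "pm T e"] ml[OF 2] h_input[OF 2] T.pm_ideal by simp
  qed
  have tm: "a (tm T b) = tm U (n b)" if "b \<in> nodes T" for b
    using that
  proof (cases rule: node_decomp)
    case (1 b')
    then show ?thesis using ac[of "tm S b'"] nc[of b'] by simp
  next
    case (2 l)
    then show ?thesis using al[OF 2(1), of "tm T b"] nl[OF 2] h_node[OF 2] T.tm_ideal by simp
  qed
  have bij: "bij_betw m (inputs_at T b) (inputs_at U (n b))" if "b \<in> nodes T" for b
    using that
  proof (cases rule: node_decomp)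
    case (1 b')
    have "bij_betw (eM g) (inputs_at S b') (inputs_at U (n b))"
      using g.bij_inputs_at[of b'] nc[of b'] 1 by simp
    \<comment> \<open>On the fibre over \<open>b'\<close> the map \<open>eM g\<close> factors as
      \<open>m\<close> after \<open>eM c\<close>; since \<open>eM c\<close> is bijective onto the
      inputs at \<open>b\<close>, so is \<open>m\<close> from there.\<close>
    then have "bij_betw (m \<circ> eM c) (inputs_at S b') (inputs_at U (n b))"
      using mc by (subst bij_betw_cong[where g = "eM g"]) (auto simp: inputs_at_def)
    with bij_betw_comp_iff[OF bij_inputs_at[OF 1(1)]] show ?thesis unfolding 1(2) by blast
  next
    case (2 l)
    then show ?thesis using h_node(4)[OF 2] nl[OF 2] ml[OF 2(1)] T.inputs_at_ideal_sub[OF 2(2)]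
      by (subst bij_betw_cong[where g = "eM (h l)"]) auto
  qed
  \<comment> \<open>Over \<open>S\<close> the squares of \<open>c\<close> and of \<open>g\<close>
    commute, and \<open>sqr_cancel\<close> leaves the square of \<tau>; in a branch the square is
    one of \<open>h l\<close>. The squares over \<open>p\<close> and \<open>t\<close> follow the
    same pattern.\<close>
  have sqr_s': "sqr (gI P) (sP P) (alpha T (sm T e)) (beta T e) (alpha U (sm U (m e)))
      (beta U (m e)) (iso_s T e) (iso_s U (m e)) (w (sm T e)) (v e)" if "e \<in> inputs T" for e
    using that
  proof (cases rule: input_decomp)
    case (1 e')
    show ?thesis unfolding 1(2)
    proof (rule s.sqr_cancel)
      show "sqr (gI P) (sP P) (alpha S (sm S e')) (beta S e') (alpha T (sm T (eM c e')))
        (beta T (eM c e')) (iso_s S e') (iso_s T (eM c e')) (ealpha c (sm S e')) (ebeta c e')"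
        using 1 by (intro sqr_s)
      show "sqr (gI P) (sP P) (alpha S (sm S e')) (beta S e') (alpha U (sm U (m (eM c e'))))
        (beta U (m (eM c e'))) (iso_s S e') (iso_s U (m (eM c e')))
        (cmp (gI P) (alpha S (sm S e')) (alpha T (sm T (eM c e'))) (alpha U (sm U (m (eM c e'))))
          (w (sm T (eM c e'))) (ealpha c (sm S e')))
        (cmp (gE P) (beta S e') (beta T (eM c e')) (beta U (m (eM c e'))) (v (eM c e')) (ebeta c e'))"
        using g.sqr_s[of e'] ac[of "sm S e'"] mc[of e'] 1 by simp
    qed (use 1 a[of "sm T e"] m[of e] sm[of e] in auto)
  next
    case (2 l)
    then show ?thesis using poly_emb.sqr_s[OF h'[OF 2(1)], of e] al[OF 2(1), of "sm T e"] ml[OF 2]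
      by (simp add: T.sm_ideal)
  qed
  have sqr_p': "sqr (gB P) (pP P) (gamma T (pm T e)) (beta T e) (gamma U (pm U (m e)))
      (beta U (m e)) (iso_p T e) (iso_p U (m e)) (u (pm T e)) (v e)" if "e \<in> inputs T" for e
    using that
  proof (cases rule: input_decomp)
    case (1 e')
    show ?thesis unfolding 1(2)
    proof (rule p.sqr_cancel)
      show "sqr (gB P) (pP P) (gamma S (pm S e')) (beta S e') (gamma T (pm T (eM c e')))
        (beta T (eM c e')) (iso_p S e') (iso_p T (eM c e')) (egamma c (pm S e')) (ebeta c e')"
        using 1 by (intro sqr_p)
      show "sqr (gB P) (pP P) (gamma S (pm S e')) (beta S e') (gamma U (pm U (m (eM c e'))))
        (beta U (m (eM c e'))) (iso_p S e') (iso_p U (m (eM c e')))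
        (cmp (gB P) (gamma S (pm S e')) (gamma T (pm T (eM c e'))) (gamma U (pm U (m (eM c e'))))
          (u (pm T (eM c e'))) (egamma c (pm S e')))
        (cmp (gE P) (beta S e') (beta T (eM c e')) (beta U (m (eM c e'))) (v (eM c e')) (ebeta c e'))"
        using g.sqr_p[of e'] nc[of "pm S e'"] mc[of e'] 1 by simp
    qed (use 1 n[of "pm T e"] m[of e] pm[of e] in auto)
  next
    case (2 l)
    then show ?thesis using poly_emb.sqr_p[OF h'[OF 2(1)], of e] nl[OF 2(1), of "pm T e"] ml[OF 2]
      by (simp add: T.pm_ideal)
  qed
  have sqr_t': "sqr (gI P) (tP P) (alpha T (tm T b)) (gamma T b) (alpha U (tm U (n b)))
      (gamma U (n b)) (iso_t T b) (iso_t U (n b)) (w (tm T b)) (u b)" if "b \<in> nodes T" for b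
    using that
  proof (cases rule: node_decomp)
    case (1 b')
    show ?thesis unfolding 1(2)
    proof (rule t.sqr_cancel)
      show "sqr (gI P) (tP P) (alpha S (tm S b')) (gamma S b') (alpha T (tm T (eN c b')))
        (gamma T (eN c b')) (iso_t S b') (iso_t T (eN c b')) (ealpha c (tm S b')) (egamma c b')"
        using 1 by (intro sqr_t)
      show "sqr (gI P) (tP P) (alpha S (tm S b')) (gamma S b') (alpha U (tm U (n (eN c b'))))
        (gamma U (n (eN c b'))) (iso_t S b') (iso_t U (n (eN c b')))
        (cmp (gI P) (alpha S (tm S b')) (alpha T (tm T (eN c b'))) (alpha U (tm U (n (eN c b'))))
          (w (tm T (eN c b'))) (ealpha c (tm S b')))
        (cmp (gB P) (gamma S b') (gamma T (eN c b')) (gamma U (n (eN c b'))) (u (eN c b')) (egamma c b'))"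
        using g.sqr_t[of b'] ac[of "tm S b'"] nc[of b'] 1 by simp
    qed (use 1 a[of "tm T b"] n[of b] tm[of b] in auto)
  next
    case (2 l)
    then show ?thesis using poly_emb.sqr_t[OF h'[OF 2(1)], of b] al[OF 2(1), of "tm T b"] nl[OF 2]
      by (simp add: T.tm_ideal del: T.tm_ideal_iff)
  qed
  have "is_ptree_embedding P T U \<tau>"
  proof (rule is_ptree_embeddingI, goal_cases)
    case (8 b)
    then show ?case using bij[of b] by (subst bij_betw_cong[where g = m]) (auto simp: inputs_at_def)
  qed (use a m n in \<open>auto simp: sm pm tm T.is_tree sqr_s' sqr_p' sqr_t'\<close>)
  moreover from this have "pcmp S T U \<tau> c = g"
    using is_ptree_embedding_cmp[OF S.is_ptree T.is_ptree U is_emb] g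
    by (intro emb_eqI[of P S U _ U]) (auto simp: ac mc nc)
  moreover from calculation(1) have "emb_restrict \<tau> (branch l) = h l" if "l \<in> leaves S" for l
    using is_ptree_embedding_restrict[OF T.is_ptree U, of \<tau> "eA c l"] h[OF that] that
    by (intro emb_eqI[of P "branch l" U _ U]) (auto simp: al ml nl T.ideal_closed)
  ultimately show thesis by (rule that)
qed

text \<open>The inverse is glued from the identity of \<open>S\<close> and the edges \<open>branch l\<close>.\<close>

lemma is_iso_if_leaves:
  assumes leaf: "\<And>l. l \<in> leaves S \<Longrightarrow> eA c l \<in> leaves T"
  shows "is_iso (ptree_cat P) S T c"
proof -
  \<comment> \<open>The branch above a leaf of \<open>T\<close> is a single edge without nodes or
    inputs. The functions on the empty set only supply the extensional values required of an
    embedding, and the colour isomorphism is forced by \<tau> being a left inverse of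
    \<open>c\<close>.\<close>
  define h :: "'v \<Rightarrow> ('v, 'ia, 'ea, 'ba) emb" where "h l = \<lparr>eA = (\<lambda>x\<in>{eA c l}. l), eM = (\<lambda>x\<in>{}. undefined), eN = (\<lambda>x\<in>{}. undefined),
    ealpha = (\<lambda>x\<in>{eA c l}. inv_arr (gI P) (alpha S l) (alpha T (eA c l)) (ealpha c l)),
    ebeta = (\<lambda>x\<in>{}. undefined), egamma = (\<lambda>x\<in>{}. undefined)\<rparr>" for l
  have trivial: "ideal_edges T (eA c l) = {eA c l}" "ideal_nodes T (eA c l) = {}"
    "ideal_inputs T (eA c l) = {}" if "l \<in> leaves S" for l
  proof -
    show *: "ideal_edges T (eA c l) = {eA c l}" using T.ideal_leaf[OF leaf[OF that]] .
    have "tm T n \<noteq> eA c l" if "n \<in> nodes T" for n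
      using leaf[OF \<open>l \<in> leaves S\<close>] that unfolding leaves_def by (metis DiffD2 imageI)
    then show N: "ideal_nodes T (eA c l) = {}" unfolding ideal_nodes_def * by auto
    show "ideal_inputs T (eA c l) = {}" unfolding ideal_inputs_def N by simp
  qed
  have h: "is_ptree_embedding P (branch l) S (h l)" if "l \<in> leaves S" for l
  proof (rule is_ptree_embeddingI)
    show "is_tree (branch l)" using that by (intro is_tree_ideal_subtree T.is_tree) auto
  qed (use that in \<open>auto simp: trivial h_def intro!: I.inv_arr_hom\<close>)
  note emb_id = is_ptree_embedding_idt[OF S.is_ptree]
  obtain \<tau> where \<tau>: "is_ptree_embedding P T S \<tau>" "pcmp S T S \<tau> c = idt (ptree_cat P) S"
    "\<And>l. l \<in> leaves S \<Longrightarrow> emb_restrict \<tau> (branch l) = h l"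
  proof (rule glue_exists[OF S.is_ptree emb_id h])
    show "cmp (gI P) (alpha S l) (alpha T (eA c l)) (alpha S (eA (idt (ptree_cat P) S) l))
      (ealpha (h l) (eA c l)) (ealpha c l) = ealpha (idt (ptree_cat P) S) l"
      if "l \<in> leaves S" for l
      using that by (simp add: h_def I.cmp_inv_left)
  qed (auto simp: h_def)
  interpret \<tau>: poly_emb P T S \<tau> using \<tau>(1) by unfold_locales
  have A: "eA \<tau> (eA c l) = l"
    "ealpha \<tau> (eA c l) = inv_arr (gI P) (alpha S l) (alpha T (eA c l)) (ealpha c l)"
    if "l \<in> leaves S" for l
    using arg_cong[OF \<tau>(3)[OF that], of eA, THEN fun_cong, of "eA c l"]
      arg_cong[OF \<tau>(3)[OF that], of ealpha, THEN fun_cong, of "eA c l"] that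
    by (simp_all add: trivial h_def)
  \<comment> \<open>The other composite is the identity by uniqueness of gluing: both sides become
    \<open>c\<close> after composition with \<open>c\<close>, and they agree on the single-edge
    branches.\<close>
  have "pcmp T S T c \<tau> = idt (ptree_cat P) T"
  proof (rule glue_unique[OF T.is_ptree])
    show "is_ptree_embedding P T T (pcmp T S T c \<tau>)"
      by (rule is_ptree_embedding_cmp) (auto intro: S.is_ptree T.is_ptree is_emb \<tau>(1))
    show "is_ptree_embedding P T T (idt (ptree_cat P) T)"
      by (rule is_ptree_embedding_idt[OF T.is_ptree])
    have "pcmp S T T (pcmp T S T c \<tau>) c
        = pcmp S S T c (pcmp S T S \<tau> c)"
      using S.is_ptree T.is_ptree is_emb \<tau>(1) by (intro PT.cmp_assoc[symmetric]) auto
    also have "\<dots> = pcmp S T T (idt (ptree_cat P) T) c"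
      using S.is_ptree T.is_ptree is_emb by (simp add: \<tau>(2) PT.cmp_idt_right PT.cmp_idt_left)
    finally show "pcmp S T T (pcmp T S T c \<tau>) c
        = pcmp S T T (idt (ptree_cat P) T) c" .
    show "emb_restrict (pcmp T S T c \<tau>) (branch l)
        = emb_restrict (idt (ptree_cat P) T) (branch l)" if "l \<in> leaves S" for l
      using that by (intro emb.equality) (auto simp: trivial A I.cmp_inv_right intro!: restrict_ext)
  qed
  then have "inverse_arrows (ptree_cat P) S T c \<tau>"
    using \<tau> is_emb by (simp add: inverse_arrows_def)
  then show ?thesis unfolding is_iso_def by blast
qed

end


text \<open>\<open>cut_iso\<close> is built from inverses of the colour isomorphisms of a cut, while
  arrows of cuts and gluing data involve these isomorphisms themselves. This translates between the
  two squares.\<close>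

lemma (in groupoid) inv_square_iff:
  assumes "x \<in> obj C" "y \<in> obj C" "x' \<in> obj C" "y' \<in> obj C"
    and "p \<in> hom C x y" "q \<in> hom C x' y'" "g \<in> hom C x x'" "a \<in> hom C y y'"
  shows "cmp C y x x' g (inv_arr C x y p) = cmp C y y' x' (inv_arr C x' y' q) a
    \<longleftrightarrow> cmp C x y y' a p = cmp C x x' y' q g" (is "?L \<longleftrightarrow> ?R")
proof
  assume ?R
  have "cmp C x y x' (cmp C y x x' g (inv_arr C x y p)) p = g"
    by (rule cmp_inv_cancel) (use assms in auto)
  also have "\<dots> = cmp C x y' x' (inv_arr C x' y' q) (cmp C x x' y' q g)"
    by (rule cmp_inv_cancel_left'[symmetric]) (use assms in auto)
  also have "\<dots> = cmp C x y x' (cmp C y y' x' (inv_arr C x' y' q) a) p"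
    unfolding \<open>?R\<close>[symmetric] by (rule cmp_assoc) (use assms in \<open>auto intro: inv_arr_hom\<close>)
  finally show ?L
    by (rule right_cancel) (use assms in \<open>auto intro!: cmp_hom inv_arr_hom\<close>)
next
  assume ?L
  have "cmp C x x' y' q g = cmp C x x' y' q (cmp C x y x' (cmp C y x x' g (inv_arr C x y p)) p)"
    using assms by (simp add: cmp_inv_cancel)
  also have "\<dots> = cmp C x x' y' q (cmp C x y' x' (inv_arr C x' y' q) (cmp C x y y' a p))"
    unfolding \<open>?L\<close> using assms by (simp add: cmp_assoc inv_arr_hom)
  also have "\<dots> = cmp C x y y' a p"
    by (rule cmp_inv_cancel_left) (use assms in \<open>auto intro: cmp_hom\<close>)
  finally show ?R by simp
qed


section \<open>The functors\<close>

lemma leaf_func_simps [simp]: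
  "fob leaf_func T = (leaves T, \<lambda>l\<in>leaves T. alpha T l)"
  "farr leaf_func S T f = (\<lambda>l\<in>leaves S. eA f l, \<lambda>l\<in>leaves S. ealpha f l)"
  by (simp_all add: leaf_func_def)

lemma root_func_simps [simp]:
  "fob root_func (X, N) = (X, \<lambda>x\<in>X. alpha (N x) (tree_root (N x)))"
  "farr root_func (X, N) (X', N') (f, \<phi>) = (f, \<lambda>x\<in>X. ealpha (\<phi> x) (tree_root (N x)))"
  by (simp_all add: root_func_def)

lemma r_func_simps [simp]:
  "fob r_func (S, T, c) = S" "farr r_func x y (\<tau>, \<sigma>) = \<sigma>"
  by (simp_all add: r_func_def)

lemma w_func_simps [simp]:
  "fob w_func (S, T, c) = (leaves S, \<lambda>l\<in>leaves S. ideal_subtree T (eA c l))"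
  "farr w_func (S, T, c) y (\<tau>, \<sigma>) = (\<lambda>l\<in>leaves S. eA \<sigma> l,
        \<lambda>l\<in>leaves S. emb_restrict \<tau> (ideal_subtree T (eA c l)))"
  by (simp_all add: w_func_def)

lemma cut_iso_simp [simp]: "cut_iso P (S, T, c) = (\<lambda>l\<in>leaves S. l,
     \<lambda>l\<in>leaves S. inv_arr (gI P) (alpha S l) (alpha T (eA c l)) (ealpha c l))"
  by (simp add: cut_iso_def)

context poly
begin

lemma finite_leaves: "is_ptree P T \<Longrightarrow> finite (leaves T)"
  by (auto simp: is_ptree_iff is_tree_def leaves_def)

lemma is_iso_ealpha:
  "\<lbrakk>is_iso (ptree_cat P) S T f; x \<in> edges S\<rbrakk> \<Longrightarrow> ealpha f x \<in> hom (gI P) (alpha S x) (alpha T (eA f x))"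
  using is_iso_embedding[of S T f] unfolding is_ptree_embedding_def by auto

lemma gfunctor_leaf_func: "gfunctor (ptrees P) (families (gI P)) leaf_func"
proof -
  interpret T: groupoid "ptrees P" by (rule groupoid_ptrees)
  interpret F: groupoid "families (gI P)" by (rule groupoid_families) unfold_locales
  show ?thesis
  proof (unfold_locales, goal_cases)
    case (1 S)
    then interpret poly_tree P S by unfold_locales simp
    show ?case by (auto simp: finite_leaves is_ptree leaf_edge)
  next
    case (2 S T f)
    then have f: "is_iso (ptree_cat P) S T f" "is_ptree P S" "is_ptree P T" by auto
    then have bij: "bij_betw (eA f) (leaves S) (leaves T)" by (rule is_iso_bij_leaves)
    then have "bij_betw (\<lambda>l\<in>leaves S. eA f l) (leaves S) (leaves T)"
      by (subst bij_betw_cong[where g = "eA f"]) auto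
    then show ?case using bij_betw_apply[OF bij] f
      by (auto simp: leaf_edge is_iso_ealpha)
  next
    case (3 S)
    then show ?case by (auto simp: leaf_edge intro!: restrict_ext)
  next
    case (4 S T U f g)
    then have f: "is_iso (ptree_cat P) S T f" "is_ptree P S" "is_ptree P T"
      and g: "is_iso (ptree_cat P) T U g" "is_ptree P T" "is_ptree P U" by auto
    show ?case
      using bij_betw_apply[OF is_iso_bij_leaves[OF f]] bij_betw_apply[OF is_iso_bij_leaves[OF g]]
      by (auto simp: leaf_edge intro!: restrict_ext)
  qed
qed

lemma groupoid_pforests: "groupoid (pforests P)"
  unfolding pforests_def by (rule groupoid_families[OF groupoid_ptrees])

lemma gfunctor_root_func: "gfunctor (pforests P) (families (gI P)) root_func"
proof -
  interpret T: groupoid "pforests P" by (rule groupoid_pforests)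
  interpret F: groupoid "families (gI P)" by (rule groupoid_families) unfold_locales
  have root: "tree_root S \<in> edges S" if "is_ptree P S" for S
  proof -
    interpret poly_tree P S by unfold_locales fact
    show ?thesis by simp
  qed
  have alpha: "alpha S x \<in> obj (gI P)" if "is_ptree P S" "x \<in> edges S" for S x
    using that by (auto simp: is_ptree_iff)
  show ?thesis
  proof (unfold_locales, goal_cases)
    case (1 x)
    then show ?case by (cases x) (auto simp: pforests_def root alpha PiE_iff)
  next
    case (2 x y f)
    obtain X N Y N' b \<phi> where eq: "x = (X, N)" "y = (Y, N')" "f = (b, \<phi>)" by (metis surj_pair)
    from 2 have *: "\<And>x. x \<in> X \<Longrightarrow> is_ptree P (N x)" "\<And>y. y \<in> Y \<Longrightarrow> is_ptree P (N' y)"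
      "b \<in> extensional X" "bij_betw b X Y"
      "\<And>x. x \<in> X \<Longrightarrow> is_iso (ptree_cat P) (N x) (N' (b x)) (\<phi> x)"
      by (auto simp: eq pforests_def)
    have "ealpha (\<phi> x) (tree_root (N x)) \<in>
      hom (gI P) (alpha (N x) (tree_root (N x))) (alpha (N' (b x)) (tree_root (N' (b x))))" if "x \<in> X" for x
      using is_iso_ealpha[OF *(5)[OF that] root[OF *(1)[OF that]]] *(1)[OF that]
        is_iso_map_root[OF *(5)[OF that]] *(2) bij_betw_apply[OF *(4) that] by simp
    then show ?case using * bij_betw_apply[OF *(4)] by (auto simp: eq)
  next
    case (3 x)
    then show ?case by (cases x) (auto simp: pforests_def root PiE_iff intro!: restrict_ext)
  next
    case (4 x y z f g)
    obtain X N Y N' Z N'' a \<phi> b \<psi> where eq: "x = (X, N)" "y = (Y, N')" "z = (Z, N'')"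
      "f = (a, \<phi>)" "g = (b, \<psi>)" by (metis surj_pair)
    from 4 have *: "\<And>x. x \<in> X \<Longrightarrow> is_ptree P (N x)" "\<And>y. y \<in> Y \<Longrightarrow> is_ptree P (N' y)"
      "\<And>z. z \<in> Z \<Longrightarrow> is_ptree P (N'' z)" "bij_betw a X Y" "bij_betw b Y Z"
      "\<And>x. x \<in> X \<Longrightarrow> is_iso (ptree_cat P) (N x) (N' (a x)) (\<phi> x)"
      "\<And>x. x \<in> Y \<Longrightarrow> is_iso (ptree_cat P) (N' x) (N'' (b x)) (\<psi> x)"
      by (auto simp: eq pforests_def)
    have "eA (\<phi> x) (tree_root (N x)) = tree_root (N' (a x))" "a x \<in> Y" if "x \<in> X" for x
      using is_iso_map_root[OF *(6)[OF that]] * bij_betw_apply[OF *(4)] that by auto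
    moreover have "eA (\<psi> x) (tree_root (N' x)) = tree_root (N'' (b x))" "b x \<in> Z" if "x \<in> Y" for x
      using is_iso_map_root[OF *(7)[OF that]] * bij_betw_apply[OF *(5)] that by auto
    ultimately show ?case using * by (auto simp: eq pforests_def root intro!: restrict_ext)
  qed
qed

section \<open>The groupoid of cuts, the functors \<open>r\<close> and \<open>w\<close>, and the
  canonical isomorphism\<close>

lemma pcuts_obj [simp]: "(S, T, c) \<in> obj (pcuts P) \<longleftrightarrow> cut P S T c"
proof
  assume "(S, T, c) \<in> obj (pcuts P)"
  then show "cut P S T c" by unfold_locales (auto simp: pcuts_def)
next
  assume "cut P S T c"
  then interpret cut P S T c .
  show "(S, T, c) \<in> obj (pcuts P)"
    using S.is_ptree T.is_ptree is_emb root_preserving by (simp add: pcuts_def)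
qed

lemma pcuts_simps [simp]:
  "(\<tau>, \<sigma>) \<in> hom (pcuts P) (S, T, c) (S', T', c') \<longleftrightarrow>
     is_iso (ptree_cat P) T T' \<tau> \<and> is_iso (ptree_cat P) S S' \<sigma> \<and>
     pcmp S T T' \<tau> c = pcmp S S' T' c' \<sigma>"
  "cmp (pcuts P) (S, T, c) (S', T', c') (S'', T'', c'') (\<tau>', \<sigma>') (\<tau>, \<sigma>) =
     (pcmp T T' T'' \<tau>' \<tau>, pcmp S S' S'' \<sigma>' \<sigma>)"
  "idt (pcuts P) (S, T, c) = (idt (ptree_cat P) T, idt (ptree_cat P) S)"
  by (auto simp: pcuts_def)

lemma cutD:
  assumes "cut P S T c"
  shows "is_ptree P S" "is_ptree P T" "is_ptree_embedding P S T c"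
    "eA c (tree_root S) = tree_root T"
proof -
  interpret cut P S T c by fact
  show "is_ptree P S" "is_ptree P T" "is_ptree_embedding P S T c"
    "eA c (tree_root S) = tree_root T"
    using S.is_ptree T.is_ptree is_emb root_preserving by simp_all
qed

lemma groupoid_pcuts: "groupoid (pcuts P)"
proof -
  interpret G: groupoid "ptrees P" by (rule groupoid_ptrees)
  note iso_simps = is_iso_embedding cutD
  have G_simps: "is_iso (ptree_cat P) S S (idt (ptree_cat P) S)" if "is_ptree P S" for S
    using G.idt_hom[of S] that by simp
  have G_cmp: "is_iso (ptree_cat P) S U (pcmp S T U g f)"
    if "is_iso (ptree_cat P) S T f" "is_iso (ptree_cat P) T U g" "is_ptree P S" "is_ptree P T"
      "is_ptree P U" for S T U f g
    using G.cmp_hom[of S T U f g] that by simp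
  show ?thesis
  proof (unfold_locales, goal_cases)
    case (1 x)
    then show ?case
      by (cases x) (auto simp: G_simps cutD PT.cmp_idt_left PT.cmp_idt_right)
  next
    case (2 x y z f g)
    obtain S T c S' T' c' S'' T'' c'' \<tau> \<sigma> \<tau>' \<sigma>' where eq: "x = (S, T, c)" "y = (S', T', c')"
      "z = (S'', T'', c'')" "f = (\<tau>, \<sigma>)" "g = (\<tau>', \<sigma>')" by (metis surj_pair)
    from 2 have c: "cut P S T c" "cut P S' T' c'" "cut P S'' T'' c''"
      and iso: "is_iso (ptree_cat P) T T' \<tau>" "is_iso (ptree_cat P) S S' \<sigma>"
        "is_iso (ptree_cat P) T' T'' \<tau>'" "is_iso (ptree_cat P) S' S'' \<sigma>'"
      and comm: "pcmp S T T' \<tau> c = pcmp S S' T' c' \<sigma>"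
        "pcmp S' T' T'' \<tau>' c' = pcmp S' S'' T'' c'' \<sigma>'"
      by (auto simp: eq)
    note mem = cutD[OF c(1)] cutD[OF c(2)] cutD[OF c(3)] iso[THEN is_iso_embedding]
    have "pcmp S T T'' (pcmp T T' T'' \<tau>' \<tau>) c
        = pcmp S T' T'' \<tau>' (pcmp S S' T' c' \<sigma>)"
      unfolding comm(1)[symmetric] by (rule PT.cmp_assoc[symmetric]) (simp_all add: mem)
    also have "\<dots> = pcmp S S' T'' (pcmp S' S'' T'' c'' \<sigma>') \<sigma>"
      unfolding comm(2)[symmetric] by (rule PT.cmp_assoc) (simp_all add: mem)
    also have "\<dots> = pcmp S S'' T'' c'' (pcmp S S' S'' \<sigma>' \<sigma>)"
      by (rule PT.cmp_assoc[symmetric]) (simp_all add: mem)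
    finally show ?case unfolding eq using iso by (simp add: G_cmp mem)
  next
    case (3 x y f)
    then show ?case by (cases x; cases y; cases f) (auto simp: iso_simps PT.cmp_idt_right)
  next
    case (4 x y f)
    then show ?case by (cases x; cases y; cases f) (auto simp: iso_simps PT.cmp_idt_left)
  next
    case (5 x y z u f g h)
    then show ?case
      by (cases x; cases y; cases z; cases u; cases f; cases g; cases h)
        (auto simp: iso_simps intro!: PT.cmp_assoc)
  next
    case (6 x y f)
    obtain S T c S' T' c' \<tau> \<sigma> where eq: "x = (S, T, c)" "y = (S', T', c')" "f = (\<tau>, \<sigma>)"
      by (metis surj_pair)
    from 6 have c: "cut P S T c" "cut P S' T' c'"
      and iso: "is_iso (ptree_cat P) T T' \<tau>" "is_iso (ptree_cat P) S S' \<sigma>"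
      and comm: "pcmp S T T' \<tau> c = pcmp S S' T' c' \<sigma>"
      by (auto simp: eq)
    obtain \<tau>' \<sigma>' where inv: "inverse_arrows (ptree_cat P) T T' \<tau> \<tau>'"
      "inverse_arrows (ptree_cat P) S S' \<sigma> \<sigma>'"
      using iso unfolding is_iso_def by blast
    then have iso': "is_iso (ptree_cat P) T' T \<tau>'" "is_iso (ptree_cat P) S' S \<sigma>'"
      unfolding is_iso_def inverse_arrows_def by blast+
    note mem = cutD[OF c(1)] cutD[OF c(2)] iso[THEN is_iso_embedding] iso'[THEN is_iso_embedding]
    from inv have inv_eq: "pcmp T T' T \<tau>' \<tau> = idt (ptree_cat P) T"
      "pcmp S' S S' \<sigma> \<sigma>' = idt (ptree_cat P) S'"
      "pcmp T' T T' \<tau> \<tau>' = idt (ptree_cat P) T'"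
      "pcmp S S' S \<sigma>' \<sigma> = idt (ptree_cat P) S"
      by (auto simp: inverse_arrows_def)
    \<comment> \<open>The commuting square is composed with \<tau>' on one side and \<sigma>' on the
      other, so the inverse pair is again an arrow of cuts.\<close>
    have "pcmp S' T' T \<tau>' c'
      = pcmp S' T' T \<tau>' (pcmp S' S' T' c' (pcmp S' S S' \<sigma> \<sigma>'))"
      using mem by (simp add: inv_eq PT.cmp_idt_right)
    also have "\<dots> = pcmp S' T' T \<tau>' (pcmp S' S T' (pcmp S T T' \<tau> c) \<sigma>')"
      unfolding comm using mem by (simp add: PT.cmp_assoc)
    also have "\<dots> = pcmp S' S T (pcmp S T T (pcmp T T' T \<tau>' \<tau>) c) \<sigma>'"
      using mem by (simp add: PT.cmp_assoc is_ptree_embedding_cmp)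
    also have "\<dots> = pcmp S' S T c \<sigma>'"
      using mem by (simp add: inv_eq PT.cmp_idt_left)
    finally have "(\<tau>', \<sigma>') \<in> hom (pcuts P) y x" using iso' by (simp add: eq)
    then have "inverse_arrows (pcuts P) x y f (\<tau>', \<sigma>')"
      using 6 by (simp add: inverse_arrows_def inv_eq eq)
    then show ?case unfolding is_iso_def by blast
  qed
qed

lemma gfunctor_r_func: "gfunctor (pcuts P) (ptrees P) r_func"
proof -
  interpret C: groupoid "pcuts P" by (rule groupoid_pcuts)
  interpret G: groupoid "ptrees P" by (rule groupoid_ptrees)
  show ?thesis
    by unfold_locales (auto simp: r_func_def cutD pcuts_def)
qed

text \<open>The equation between composite embeddings is evaluated at a leaf. Its edge part says
  where the base of each branch goes, its colour part gives naturality of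
  \<open>cut_iso\<close>.\<close>

lemma pcuts_hom_leaf:
  assumes "cut P S T c" "cut P S' T' c'" "is_iso (ptree_cat P) S S' \<sigma>" "l \<in> leaves S"
    and comm: "pcmp S T T' \<tau> c = pcmp S S' T' c' \<sigma>"
  shows "eA \<tau> (eA c l) = eA c' (eA \<sigma> l)"
    "cmp (gI P) (alpha S l) (alpha T (eA c l)) (alpha T' (eA c' (eA \<sigma> l))) (ealpha \<tau> (eA c l)) (ealpha c l)
    = cmp (gI P) (alpha S l) (alpha S' (eA \<sigma> l)) (alpha T' (eA c' (eA \<sigma> l))) (ealpha c' (eA \<sigma> l)) (ealpha \<sigma> l)"
    "eA \<sigma> l \<in> leaves S'" "eA \<sigma> l \<in> edges S'" "l \<in> edges S" "eA c l \<in> edges T"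
proof -
  interpret cut P S T c by fact
  show l: "l \<in> edges S" using assms(4) by simp
  then show *: "eA \<tau> (eA c l) = eA c' (eA \<sigma> l)" using fun_cong[OF arg_cong[OF comm, of eA], of l] by simp
  show "cmp (gI P) (alpha S l) (alpha T (eA c l)) (alpha T' (eA c' (eA \<sigma> l))) (ealpha \<tau> (eA c l)) (ealpha c l)
    = cmp (gI P) (alpha S l) (alpha S' (eA \<sigma> l)) (alpha T' (eA c' (eA \<sigma> l))) (ealpha c' (eA \<sigma> l)) (ealpha \<sigma> l)"
    using l * fun_cong[OF arg_cong[OF comm, of ealpha], of l] by simp
  show "eA \<sigma> l \<in> leaves S'"
    using bij_betw_apply[OF is_iso_bij_leaves[OF assms(3)] assms(4)] cutD(1) assms(1,2) by blast
  then show "eA \<sigma> l \<in> edges S'" by (rule leaf_edge)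
  show "eA c l \<in> edges T" using l by simp
qed

lemma gfunctor_w_func: "gfunctor (pcuts P) (pforests P) w_func"
proof -
  interpret C: groupoid "pcuts P" by (rule groupoid_pcuts)
  interpret F: groupoid "pforests P" by (rule groupoid_pforests)
  have branch: "eA c l \<in> edges T" "is_ptree P (ideal_subtree T (eA c l))"
    if "cut P S T c" "l \<in> leaves S" for S T c l
  proof -
    interpret cut P S T c by fact
    show "eA c l \<in> edges T" using that(2) by simp
    then show "is_ptree P (ideal_subtree T (eA c l))" by (intro is_ptree_ideal_subtree T.is_ptree)
  qed
  show ?thesis
  proof (unfold_locales, goal_cases)
    case (1 x)
    then show ?case by (cases x) (auto simp: pforests_def branch finite_leaves cutD)
  next
    case (2 x y f)
    obtain S T c S' T' c' \<tau> \<sigma> where eq: "x = (S, T, c)" "y = (S', T', c')" "f = (\<tau>, \<sigma>)"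
      by (metis surj_pair)
    from 2 have c: "cut P S T c" "cut P S' T' c'"
      and iso: "is_iso (ptree_cat P) T T' \<tau>" "is_iso (ptree_cat P) S S' \<sigma>"
      and comm: "pcmp S T T' \<tau> c = pcmp S S' T' c' \<sigma>"
      by (auto simp: eq)
    note l = pcuts_hom_leaf[OF c iso(2) _ comm]
    have "bij_betw (eA \<sigma>) (leaves S) (leaves S')" using iso(2) c by (auto intro: is_iso_bij_leaves cutD)
    then have "bij_betw (\<lambda>l\<in>leaves S. eA \<sigma> l) (leaves S) (leaves S')"
      by (subst bij_betw_cong[where g = "eA \<sigma>"]) auto
    \<comment> \<open>As \<tau> sends \<open>eA c l\<close> to \<open>eA c' (eA \<sigma> l)\<close>,
      \<open>is_iso_ideal\<close> gives an isomorphism onto the branch at the leaf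
      \<open>eA \<sigma> l\<close>.\<close>
    moreover have "is_iso (ptree_cat P) (ideal_subtree T (eA c l)) (ideal_subtree T' (eA c' (eA \<sigma> l)))
        (emb_restrict \<tau> (ideal_subtree T (eA c l)))" if "l \<in> leaves S" for l
      using is_iso_ideal[OF iso(1), of "eA c l"] l[OF that] c by (auto simp: cutD)
    ultimately show ?case using l(3) by (auto simp: eq pforests_def)
  next
    case (3 x)
    then show ?case by (cases x) (auto simp: pforests_def emb_restrict_idt leaf_edge cutD intro!: restrict_ext)
  next
    case (4 x y z f g)
    obtain S T c S' T' c' S'' T'' c'' \<tau> \<sigma> \<tau>' \<sigma>' where eq: "x = (S, T, c)" "y = (S', T', c')"
      "z = (S'', T'', c'')" "f = (\<tau>, \<sigma>)" "g = (\<tau>', \<sigma>')" by (metis surj_pair)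
    from 4 have c: "cut P S T c" "cut P S' T' c'" "cut P S'' T'' c''"
      and iso: "is_iso (ptree_cat P) T T' \<tau>" "is_iso (ptree_cat P) S S' \<sigma>"
        "is_iso (ptree_cat P) T' T'' \<tau>'" "is_iso (ptree_cat P) S' S'' \<sigma>'"
      and comm: "pcmp S T T' \<tau> c = pcmp S S' T' c' \<sigma>"
        "pcmp S' T' T'' \<tau>' c' = pcmp S' S'' T'' c'' \<sigma>'"
      by (auto simp: eq)
    note l = pcuts_hom_leaf[OF c(1,2) iso(2) _ comm(1)]
    note l' = pcuts_hom_leaf[OF c(2,3) iso(4) _ comm(2)]
    have "emb_restrict (pcmp T T' T'' \<tau>' \<tau>) (ideal_subtree T (eA c l)) =
      pcmp (ideal_subtree T (eA c l)) (ideal_subtree T' (eA c' (eA \<sigma> l)))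
        (ideal_subtree T'' (eA c'' (eA \<sigma>' (eA \<sigma> l))))
        (emb_restrict \<tau>' (ideal_subtree T' (eA c' (eA \<sigma> l)))) (emb_restrict \<tau> (ideal_subtree T (eA c l)))"
      if "l \<in> leaves S" for l
      using emb_restrict_cmp[of T T' T'' \<tau> \<tau>' "eA c l"] l[OF that] l'(1)[OF l(3)[OF that]] iso c
      by (simp add: cutD is_iso_embedding)
    then show ?case using l(3,5) l'(3) by (auto simp: eq pforests_def intro!: restrict_ext)
  qed
qed

text \<open>The index bijections are identities on leaves, so naturality concerns colours only;
  there it is the leafwise equation of an arrow of cuts, rewritten by
  \<open>inv_square_iff\<close>.\<close>

lemma nat_iso_cut_iso:
  "nat_iso (pcuts P) (families (gI P)) (func_comp root_func w_func) (func_comp leaf_func r_func) (cut_iso P)"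
  unfolding nat_iso_def
proof (intro conjI ballI, goal_cases)
  case 1
  show ?case by (rule gfunctor_comp[OF gfunctor_w_func gfunctor_root_func])
next
  case 2
  show ?case by (rule gfunctor_comp[OF gfunctor_r_func gfunctor_leaf_func])
next
  case (3 x)
  obtain S T c where eq: "x = (S, T, c)" by (metis surj_pair)
  interpret cut P S T c using 3 by (simp add: eq)
  have "bij_betw (\<lambda>l\<in>leaves S. l) (leaves S) (leaves S)" by (simp add: bij_betw_def inj_on_def)
  then show ?case
    by (auto simp: eq func_comp_def T.is_tree intro!: I.inv_arr_hom)
next
  case (4 x y f)
  obtain S T c S' T' c' \<tau> \<sigma> where eq: "x = (S, T, c)" "y = (S', T', c')" "f = (\<tau>, \<sigma>)"
    by (metis surj_pair)
  from 4 have c: "cut P S T c" "cut P S' T' c'"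
    and iso: "is_iso (ptree_cat P) T T' \<tau>" "is_iso (ptree_cat P) S S' \<sigma>"
    and comm: "pcmp S T T' \<tau> c = pcmp S S' T' c' \<sigma>"
    by (auto simp: eq)
  interpret c: cut P S T c by fact
  interpret c': cut P S' T' c' by fact
  note l = pcuts_hom_leaf[OF c iso(2) _ comm]
  have "cmp (gI P) (alpha T (eA c l)) (alpha S l) (alpha S' (eA \<sigma> l)) (ealpha \<sigma> l)
      (inv_arr (gI P) (alpha S l) (alpha T (eA c l)) (ealpha c l))
    = cmp (gI P) (alpha T (eA c l)) (alpha T' (eA c' (eA \<sigma> l))) (alpha S' (eA \<sigma> l))
      (inv_arr (gI P) (alpha S' (eA \<sigma> l)) (alpha T' (eA c' (eA \<sigma> l))) (ealpha c' (eA \<sigma> l)))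
      (ealpha \<tau> (eA c l))" if "l \<in> leaves S" for l
    using l[OF that] is_iso_ealpha[OF iso(1), of "eA c l"] is_iso_ealpha[OF iso(2), of l]
    by (subst I.inv_square_iff) auto
  then show ?case using l
    by (auto simp: eq func_comp_def c.T.is_tree c'.T.is_tree intro!: restrict_ext)
qed

end


section \<open>Arrows of the homotopy pullback as gluing data\<close>

section \<open>The induced functor is fully faithful\<close>

context poly
begin

abbreviation hpb where
  "hpb \<equiv> hpullback (pforests P) (ptrees P) (families (gI P)) root_func leaf_func"

abbreviation comparison where
  "comparison \<equiv> hp_induced w_func r_func (cut_iso P)"

lemma groupoid_hpb: "groupoid hpb"
  by (rule groupoid_hpullback[OF gfunctor_root_func gfunctor_leaf_func])

lemma gfunctor_comparison: "gfunctor (pcuts P) hpb comparison"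
  by (rule gfunctor_hp_induced[OF gfunctor_root_func gfunctor_leaf_func gfunctor_w_func
    gfunctor_r_func nat_iso_cut_iso])

lemma comparison_farr [simp]:
  "farr comparison (S, T, c) y (\<tau>, \<sigma>) = ((\<lambda>l\<in>leaves S. eA \<sigma> l,
        \<lambda>l\<in>leaves S. emb_restrict \<tau> (ideal_subtree T (eA c l))), \<sigma>)"
  by (simp add: hp_induced_def)

text \<open>Unpacks an arrow of the homotopy pullback into the input of \<open>glue_exists\<close>:
  the compatibility square forces the reindexing of branches to be \<sigma> on leaves, and its
  colour component becomes the premise \<open>colour\<close>.\<close>

lemma comparison_homD:
  assumes c: "cut P S T c" "cut P S' T' c'"
    and u: "((f, a), \<sigma>) \<in> hom hpb (fob comparison (S, T, c)) (fob comparison (S', T', c'))"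
  shows "is_iso (ptree_cat P) S S' \<sigma>" "f = (\<lambda>l\<in>leaves S. eA \<sigma> l)" "a \<in> extensional (leaves S)"
    and "\<And>l. l \<in> leaves S \<Longrightarrow>
      is_iso (ptree_cat P) (ideal_subtree T (eA c l)) (ideal_subtree T' (eA c' (eA \<sigma> l))) (a l)"
    and "\<And>l. l \<in> leaves S \<Longrightarrow> cmp (gI P) (alpha S l) (alpha T (eA c l)) (alpha T' (eA c' (eA \<sigma> l)))
        (ealpha (a l) (eA c l)) (ealpha c l)
      = cmp (gI P) (alpha S l) (alpha S' (eA \<sigma> l)) (alpha T' (eA c' (eA \<sigma> l)))
        (ealpha c' (eA \<sigma> l)) (ealpha \<sigma> l)"
proof -
  interpret c: cut P S T c by fact
  interpret c': cut P S' T' c' by fact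
  note simps = hpullback_def hp_induced_def pforests_def
  show \<sigma>: "is_iso (ptree_cat P) S S' \<sigma>" using u by (simp add: simps)
  have fa: "(f, a) \<in> hom (pforests P) (fob w_func (S, T, c)) (fob w_func (S', T', c'))"
    using u by (simp add: hpullback_def hp_induced_def)
  then have f: "f \<in> extensional (leaves S)" "bij_betw f (leaves S) (leaves S')"
    by (simp_all add: pforests_def)
  show "a \<in> extensional (leaves S)" using fa by (simp add: pforests_def PiE_iff)
  have f_leaf: "f l \<in> leaves S'" if "l \<in> leaves S" for l using bij_betw_apply[OF f(2) that] .
  have a: "is_iso (ptree_cat P) (ideal_subtree T (eA c l)) (ideal_subtree T' (eA c' (f l))) (a l)"
    if "l \<in> leaves S" for l
    using fa that f_leaf[OF that] by (auto simp: pforests_def PiE_iff)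
  from u have eq: "cmp (families (gI P)) (fob root_func (fob w_func (S, T, c))) (fob leaf_func S) (fob leaf_func S')
      (farr leaf_func S S' \<sigma>) (cut_iso P (S, T, c)) =
    cmp (families (gI P)) (fob root_func (fob w_func (S, T, c))) (fob root_func (fob w_func (S', T', c')))
      (fob leaf_func S') (cut_iso P (S', T', c'))
      (farr root_func (fob w_func (S, T, c)) (fob w_func (S', T', c')) (f, a))"
    by (simp add: simps)
  \<comment> \<open>First components of the square: both canonical isomorphisms have the identity as
    index bijection.\<close>
  have f_eq: "f l = eA \<sigma> l" if "l \<in> leaves S" for l
    using fun_cong[OF arg_cong[OF eq, of fst], of l] that f_leaf by simp
  then show "f = (\<lambda>l\<in>leaves S. eA \<sigma> l)" using f(1) by (auto simp: fun_eq_iff extensional_def)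
  have \<sigma>_leaf: "eA \<sigma> l \<in> leaves S'" "eA \<sigma> l \<in> edges S'" if "l \<in> leaves S" for l
    using f_leaf[OF that] f_eq[OF that] by auto
  show iso: "is_iso (ptree_cat P) (ideal_subtree T (eA c l)) (ideal_subtree T' (eA c' (eA \<sigma> l))) (a l)"
    if "l \<in> leaves S" for l
    using a[OF that] f_eq[OF that] \<sigma>_leaf[OF that] by simp
  fix l assume l: "l \<in> leaves S"
  \<comment> \<open>The root of a branch is its base edge, and an isomorphism preserves
    roots.\<close>
  have root: "eA (a l) (eA c l) = eA c' (eA \<sigma> l)"
    using is_iso_map_root[OF iso[OF l]] l \<sigma>_leaf[OF l]
    by (simp add: is_ptree_ideal_subtree c.T.is_ptree c'.T.is_ptree c.T.is_tree c'.T.is_tree)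
  have al: "ealpha (a l) (eA c l) \<in> hom (gI P) (alpha T (eA c l)) (alpha T' (eA c' (eA \<sigma> l)))"
    using is_iso_ealpha[OF iso[OF l], of "eA c l"] l root \<sigma>_leaf[OF l] by simp
  have "cmp (gI P) (alpha T (eA c l)) (alpha S l) (alpha S' (eA \<sigma> l)) (ealpha \<sigma> l)
      (inv_arr (gI P) (alpha S l) (alpha T (eA c l)) (ealpha c l))
    = cmp (gI P) (alpha T (eA c l)) (alpha T' (eA c' (eA \<sigma> l))) (alpha S' (eA \<sigma> l))
      (inv_arr (gI P) (alpha S' (eA \<sigma> l)) (alpha T' (eA c' (eA \<sigma> l))) (ealpha c' (eA \<sigma> l)))
      (ealpha (a l) (eA c l))"
    using fun_cong[OF arg_cong[OF eq, of snd], of l] l f_leaf[OF l] f_eq[OF l] \<sigma>_leaf[OF l]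
    by (simp add: c.T.is_tree c'.T.is_tree)
  then show "cmp (gI P) (alpha S l) (alpha T (eA c l)) (alpha T' (eA c' (eA \<sigma> l)))
        (ealpha (a l) (eA c l)) (ealpha c l)
      = cmp (gI P) (alpha S l) (alpha S' (eA \<sigma> l)) (alpha T' (eA c' (eA \<sigma> l)))
        (ealpha c' (eA \<sigma> l)) (ealpha \<sigma> l)"
    using al is_iso_ealpha[OF \<sigma>, of l] l \<sigma>_leaf[OF l] by (subst (asm) I.inv_square_iff) auto
qed

text \<open>Gluing \<open>c'\<close> after \<sigma> with the maps \<open>a l\<close>, regarded as
  maps into all of \<open>T'\<close>. The result is so far an embedding only; its inverse is
  obtained from the inverse arrow.\<close>

lemma comparison_lift:
  assumes c: "cut P S T c" "cut P S' T' c'"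
    and u: "((f, a), \<sigma>) \<in> hom hpb (fob comparison (S, T, c)) (fob comparison (S', T', c'))"
  obtains \<tau> where "is_ptree_embedding P T T' \<tau>"
    "pcmp S T T' \<tau> c = pcmp S S' T' c' \<sigma>"
    "\<And>l. l \<in> leaves S \<Longrightarrow> emb_restrict \<tau> (ideal_subtree T (eA c l)) = a l"
proof -
  interpret c: cut P S T c by fact
  interpret c': cut P S' T' c' by fact
  note u = comparison_homD[OF c u]
  interpret \<sigma>: poly_emb P S S' \<sigma> using u(1) by unfold_locales (rule is_iso_embedding)
  have emb: "is_ptree_embedding P S T' (pcmp S S' T' c' \<sigma>)"
    by (rule is_ptree_embedding_cmp)
      (rule c.S.is_ptree c'.S.is_ptree c'.T.is_ptree \<sigma>.is_emb c'.is_emb)+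
  show thesis
  proof (rule c.glue_exists[OF c'.T.is_ptree emb])
    fix l assume l: "l \<in> leaves S"
    then have edges: "l \<in> edges S" "eA c l \<in> edges T" "eA \<sigma> l \<in> edges S'" "eA c' (eA \<sigma> l) \<in> edges T'"
      by auto
    have pt: "is_ptree P (c.branch l)" "is_ptree P (ideal_subtree T' (eA c' (eA \<sigma> l)))"
      using edges by (auto intro: is_ptree_ideal_subtree c.T.is_ptree c'.T.is_ptree)
    show "is_ptree_embedding P (c.branch l) T' (a l)"
      by (rule is_ptree_embedding_from_ideal[OF pt(1) c'.T.is_ptree edges(4) is_iso_embedding[OF u(4)[OF l]]])
    show "eA (a l) (eA c l) = eA (pcmp S S' T' c' \<sigma>) l"
      using is_iso_map_root[OF u(4)[OF l] pt] edges by (simp add: c.T.is_tree c'.T.is_tree)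
    show "cmp (gI P) (alpha S l) (alpha T (eA c l)) (alpha T' (eA (pcmp S S' T' c' \<sigma>) l))
        (ealpha (a l) (eA c l)) (ealpha c l) = ealpha (pcmp S S' T' c' \<sigma>) l"
      using u(5)[OF l] edges by simp
  qed (rule that)
qed

text \<open>By uniqueness of gluing it suffices to compare with the identity on \<open>S\<close> and
  on the branches. There the two components of the equation \<open>vu\<close> apply.\<close>

lemma comparison_lift_inverse:
  assumes c: "cut P S T c" "cut P S' T' c'"
    and u: "((f, a), \<sigma>) \<in> hom hpb (fob comparison (S, T, c)) (fob comparison (S', T', c'))"
    and v: "((g, b), \<rho>) \<in> hom hpb (fob comparison (S', T', c')) (fob comparison (S, T, c))"
    and vu: "cmp hpb (fob comparison (S, T, c)) (fob comparison (S', T', c')) (fob comparison (S, T, c))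
      ((g, b), \<rho>) ((f, a), \<sigma>) = idt hpb (fob comparison (S, T, c))"
    and \<tau>: "is_ptree_embedding P T T' \<tau>"
      "pcmp S T T' \<tau> c = pcmp S S' T' c' \<sigma>"
      "\<And>l. l \<in> leaves S \<Longrightarrow> emb_restrict \<tau> (ideal_subtree T (eA c l)) = a l"
    and \<upsilon>: "is_ptree_embedding P T' T \<upsilon>"
      "pcmp S' T' T \<upsilon> c' = pcmp S' S T c \<rho>"
      "\<And>l. l \<in> leaves S' \<Longrightarrow> emb_restrict \<upsilon> (ideal_subtree T' (eA c' l)) = b l"
  shows "pcmp T T' T \<upsilon> \<tau> = idt (ptree_cat P) T"
proof -
  interpret c: cut P S T c by fact
  interpret c': cut P S' T' c' by fact
  note uD = comparison_homD[OF c u]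
  note vD = comparison_homD[OF c(2,1) v]
  note mem = cutD[OF c(1)] cutD[OF c(2)] \<tau>(1) \<upsilon>(1) is_iso_embedding[OF uD(1)] is_iso_embedding[OF vD(1)]
  note l = pcuts_hom_leaf[OF c uD(1) _ \<tau>(2)]
  note l' = pcuts_hom_leaf[OF c(2,1) vD(1) _ \<upsilon>(2)]
  have \<rho>\<sigma>: "pcmp S S' S \<rho> \<sigma> = idt (ptree_cat P) S"
    using vu by (simp add: hpullback_def hp_induced_def)
  have inv: "eA \<rho> (eA \<sigma> l) = l" if "l \<in> leaves S" for l
    using fun_cong[OF arg_cong[OF \<rho>\<sigma>, of eA], of l] that by simp
  \<comment> \<open>The forest component of \<open>vu\<close> at the index \<open>l\<close>; the
    tree reached in the middle is the branch of \<open>T'\<close> at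
    \<open>eA \<sigma> l\<close>.\<close>
  have ba: "pcmp (c.branch l) (c'.branch (eA \<sigma> l)) (c.branch l) (b (eA \<sigma> l)) (a l)
    = idt (ptree_cat P) (c.branch l)" if "l \<in> leaves S" for l
    using arg_cong[OF vu, of "\<lambda>x. snd (fst x) l"] that l(3)[OF that] inv[OF that]
    by (simp add: hpullback_def hp_induced_def pforests_def uD(2) vD(2))
  show ?thesis
  proof (rule c.glue_unique[OF c.T.is_ptree])
    show "is_ptree_embedding P T T (pcmp T T' T \<upsilon> \<tau>)"
      by (rule is_ptree_embedding_cmp) (simp_all add: mem)
    show "is_ptree_embedding P T T (idt (ptree_cat P) T)"
      by (rule is_ptree_embedding_idt) (simp add: mem)
    have "pcmp S T T (pcmp T T' T \<upsilon> \<tau>) c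
      = pcmp S T' T \<upsilon> (pcmp S S' T' c' \<sigma>)"
      unfolding \<tau>(2)[symmetric] by (rule PT.cmp_assoc[symmetric]) (simp_all add: mem)
    also have "\<dots> = pcmp S S' T (pcmp S' S T c \<rho>) \<sigma>"
      unfolding \<upsilon>(2)[symmetric] by (rule PT.cmp_assoc) (simp_all add: mem)
    also have "\<dots> = pcmp S S T c (pcmp S S' S \<rho> \<sigma>)"
      by (rule PT.cmp_assoc[symmetric]) (simp_all add: mem)
    also have "\<dots> = pcmp S T T (idt (ptree_cat P) T) c"
      using mem by (simp add: \<rho>\<sigma> PT.cmp_idt_right PT.cmp_idt_left)
    finally show "pcmp S T T (pcmp T T' T \<upsilon> \<tau>) c
      = pcmp S T T (idt (ptree_cat P) T) c" .
    show "emb_restrict (pcmp T T' T \<upsilon> \<tau>) (c.branch k) = emb_restrict (idt (ptree_cat P) T) (c.branch k)"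
      if "k \<in> leaves S" for k
      using emb_restrict_cmp[of T T' T \<tau> \<upsilon> "eA c k"] l[OF that] l'(1)[OF l(3)[OF that]]
        inv[OF that] ba[OF that] \<tau>(3)[OF that] \<upsilon>(3)[OF l(3)[OF that]]
      by (simp add: mem emb_restrict_idt)
  qed
qed

lemma fully_faithful_comparison: "fully_faithful (pcuts P) hpb comparison"
  unfolding fully_faithful_def bij_betw_def
proof (intro ballI conjI)
  interpret H: groupoid hpb by (rule groupoid_hpb)
  interpret K: gfunctor "pcuts P" hpb comparison by (rule gfunctor_comparison)
  fix x y :: "('v, 'i, 'ia, 'e, 'ea, 'b, 'ba) pcut"
  assume x: "x \<in> obj (pcuts P)" and y: "y \<in> obj (pcuts P)"
  obtain S T c S' T' c' where eq: "x = (S, T, c)" "y = (S', T', c')" by (metis surj_pair)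
  have c: "cut P S T c" "cut P S' T' c'" using x y by (auto simp: eq)
  show "inj_on (farr comparison x y) (hom (pcuts P) x y)"
  proof (rule inj_onI)
    fix f g assume fg: "f \<in> hom (pcuts P) x y" "g \<in> hom (pcuts P) x y"
      "farr comparison x y f = farr comparison x y g"
    obtain \<tau> \<sigma> \<tau>' \<sigma>' where eq': "f = (\<tau>, \<sigma>)" "g = (\<tau>', \<sigma>')" by (metis surj_pair)
    have \<sigma>: "\<sigma> = \<sigma>'" using fg(3) by (simp add: eq eq')
    have "\<tau> = \<tau>'"
    proof (rule cut.glue_unique[OF c(1)])
      show "is_ptree P T'" using c by (simp add: cutD)
      show "is_ptree_embedding P T T' \<tau>" "is_ptree_embedding P T T' \<tau>'"
        "pcmp S T T' \<tau> c = pcmp S T T' \<tau>' c"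
        using fg(1,2) by (auto simp: eq eq' \<sigma> is_iso_embedding)
      show "emb_restrict \<tau> (ideal_subtree T (eA c l)) = emb_restrict \<tau>' (ideal_subtree T (eA c l))"
        if "l \<in> leaves S" for l
        using arg_cong[OF fg(3), of "\<lambda>x. snd (fst x) l"] that by (simp add: eq eq')
    qed
    then show "f = g" using \<sigma> by (simp add: eq')
  qed
  show "farr comparison x y ` hom (pcuts P) x y = hom hpb (fob comparison x) (fob comparison y)"
  proof
    show "farr comparison x y ` hom (pcuts P) x y \<subseteq> hom hpb (fob comparison x) (fob comparison y)"
      using K.farr_hom x y by blast
    show "hom hpb (fob comparison x) (fob comparison y) \<subseteq> farr comparison x y ` hom (pcuts P) x y"
    proof
      fix u assume u: "u \<in> hom hpb (fob comparison x) (fob comparison y)"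
      then obtain v where v: "inverse_arrows hpb (fob comparison x) (fob comparison y) u v"
        using H.all_iso K.fob_obj x y unfolding is_iso_def by blast
      obtain f a \<sigma> g b \<rho> where eq': "u = ((f, a), \<sigma>)" "v = ((g, b), \<rho>)" by (metis surj_pair)
      have u': "((f, a), \<sigma>) \<in> hom hpb (fob comparison (S, T, c)) (fob comparison (S', T', c'))"
        and v': "((g, b), \<rho>) \<in> hom hpb (fob comparison (S', T', c')) (fob comparison (S, T, c))"
        using u v by (auto simp: inverse_arrows_def eq eq')
      have inv: "cmp hpb (fob comparison (S, T, c)) (fob comparison (S', T', c')) (fob comparison (S, T, c))
          ((g, b), \<rho>) ((f, a), \<sigma>) = idt hpb (fob comparison (S, T, c))"
        "cmp hpb (fob comparison (S', T', c')) (fob comparison (S, T, c)) (fob comparison (S', T', c'))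
          ((f, a), \<sigma>) ((g, b), \<rho>) = idt hpb (fob comparison (S', T', c'))"
        using v by (auto simp: inverse_arrows_def eq eq')
      obtain \<tau> where \<tau>: "is_ptree_embedding P T T' \<tau>"
        "pcmp S T T' \<tau> c = pcmp S S' T' c' \<sigma>"
        "\<And>l. l \<in> leaves S \<Longrightarrow> emb_restrict \<tau> (ideal_subtree T (eA c l)) = a l"
        by (rule comparison_lift[OF c u']) blast
      obtain \<upsilon> where \<upsilon>: "is_ptree_embedding P T' T \<upsilon>"
        "pcmp S' T' T \<upsilon> c' = pcmp S' S T c \<rho>"
        "\<And>l. l \<in> leaves S' \<Longrightarrow> emb_restrict \<upsilon> (ideal_subtree T' (eA c' l)) = b l"
        by (rule comparison_lift[OF c(2,1) v']) blast
      \<comment> \<open>The two composites are instances of one lemma, with the cuts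
        exchanged.\<close>
      have "inverse_arrows (ptree_cat P) T T' \<tau> \<upsilon>"
        using comparison_lift_inverse[OF c u' v' inv(1) \<tau> \<upsilon>]
          comparison_lift_inverse[OF c(2,1) v' u' inv(2) \<upsilon> \<tau>] \<tau>(1) \<upsilon>(1)
        by (simp add: inverse_arrows_def)
      then have "is_iso (ptree_cat P) T T' \<tau>" unfolding is_iso_def by blast
      then have "(\<tau>, \<sigma>) \<in> hom (pcuts P) x y"
        using \<tau>(2) comparison_homD(1)[OF c u'] by (simp add: eq)
      moreover have "u = farr comparison x y (\<tau>, \<sigma>)"
        using comparison_homD(2,3)[OF c u'] \<tau>(3)
        by (auto simp: eq eq' fun_eq_iff extensional_def)
      ultimately show "u \<in> farr comparison x y ` hom (pcuts P) x y" by blast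
    qed
  qed
qed

end


section \<open>Disjoint unions inside the vertex type, grafting and essential surjectivity\<close>

section \<open>Grafting a forest onto the leaves of a tree\<close>

text \<open>Vertices are elements of \<open>'v\<close>, so the disjoint union of a tree and a family
  of trees has to be coded in \<open>'v\<close> again. For an infinite type, a pairing function does
  this.\<close>

lemma ex_inj_option_prod:
  assumes "infinite (UNIV :: 'v set)"
  shows "\<exists>j :: 'v option \<times> 'v \<Rightarrow> 'v. inj j"
proof -
  obtain p :: "'v \<times> 'v \<Rightarrow> 'v" where p: "inj p"
    using card_of_Times_same_infinite[OF assms] card_of_ordIso[of "UNIV \<times> UNIV :: ('v \<times> 'v) set" "UNIV :: 'v set"]
    by (auto simp: bij_betw_def)
  obtain a b :: 'v where ab: "a \<noteq> b"
    by (metis assms finite.simps UNIV_eq_I insertCI)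
  \<comment> \<open>Distinct first coordinates \<open>a\<close> and \<open>b\<close> separate
    \<open>None\<close> from the values \<open>Some x\<close>.\<close>
  define q where "q i = (case i of None \<Rightarrow> (a, a) | Some x \<Rightarrow> (b, x))" for i
  have "inj q" using ab by (auto simp: inj_def q_def split: option.splits)
  then have "inj (\<lambda>u. p (p (q (fst u)), snd u))"
    by (intro injI) (auto simp: inj_eq[OF p] inj_eq intro: prod_eqI)
  then show ?thesis by blast
qed

text \<open>Transporting a structure arrow along a change of colour makes the square commute by
  construction. This dictates the formulas for \<open>iso_s\<close> and \<open>iso_t\<close> of the
  graft.\<close>

lemma (in gfunctor) sqr_transport:
  assumes "d \<in> obj D" "d' \<in> obj D" "x \<in> obj C" "i \<in> hom D d (fob F x)" "a \<in> hom D d d'"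
  shows "sqr D F d x d' x i (cmp D d' d (fob F x) i (inv_arr D d d' a)) a (idt C x)"
  using assms by (simp add: sqr_def farr_idt fob_obj D.cmp_idt_left D.cmp_inv_cancel)

lemma (in groupoid) inv_idt:
  assumes "x \<in> obj C"
  shows "inv_arr C x x (idt C x) = idt C x"
  using cmp_inv_left[of x x "idt C x"] assms
  by (simp add: idt_hom inv_arr_hom cmp_idt_right)

text \<open>Vertices of the grafted tree are tagged by the tree they come from: \<open>None\<close> for \<open>S\<close> and
  \<open>Some x\<close> for \<open>N x\<close>; the root of \<open>N x\<close> becomes the leaf \<open>f x\<close> of \<open>S\<close>.\<close>

locale grafting = poly P + S: poly_tree P S
  for P :: "('i, 'ia, 'e, 'ea, 'b, 'ba) poly_diagram"
    and S :: "('v, 'i, 'ia, 'e, 'b, 'ba) ptree" +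
  fixes X :: "'v set" and N :: "'v \<Rightarrow> ('v, 'i, 'ia, 'e, 'b, 'ba) ptree"
    and f :: "'v \<Rightarrow> 'v" and \<phi> :: "'v \<Rightarrow> 'ia" and j :: "'v option \<times> 'v \<Rightarrow> 'v"
  assumes finite_X: "finite X"
    and N: "x \<in> X \<Longrightarrow> is_ptree P (N x)"
    and f: "bij_betw f X (leaves S)"
    and \<phi>: "x \<in> X \<Longrightarrow> \<phi> x \<in> hom (gI P) (alpha (N x) (tree_root (N x))) (alpha S (f x))"
    and j: "inj j"
begin

definition tags :: "'v option set" where
  "tags = insert None (Some ` X)"

definition part :: "'v option \<Rightarrow> ('v, 'i, 'ia, 'e, 'b, 'ba) ptree" where
  "part i = (case i of None \<Rightarrow> S | Some x \<Rightarrow> N x)"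

text \<open>Grafting identifies the root of \<open>N x\<close> with the leaf \<open>f x\<close>.
  Instead of a quotient, each class has a representative, and for a merged edge it is the leaf of
  \<open>S\<close>.\<close>

definition tag_edge :: "'v option \<Rightarrow> 'v \<Rightarrow> 'v option \<times> 'v" where
  "tag_edge i e = (case i of None \<Rightarrow> (None, e)
     | Some x \<Rightarrow> if e = tree_root (N x) then (None, f x) else (Some x, e))"

text \<open>The arrow from the original colour of an edge to that of its representative: only a
  merged root changes colour, and it does so by \<phi>.\<close>

definition recolour :: "'v option \<Rightarrow> 'v \<Rightarrow> 'ia" where
  "recolour i e = (case i of None \<Rightarrow> idt (gI P) (alpha S e)
     | Some x \<Rightarrow> if e = tree_root (N x) then \<phi> x else idt (gI P) (alpha (N x) e))"

text \<open>The set of representatives chosen by \<open>tag_edge\<close>; the roots of the attached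
  trees are therefore left out.\<close>

definition tagged_edges :: "('v option \<times> 'v) set" where
  "tagged_edges = {(i, e). i \<in> tags \<and> e \<in> edges (part i) \<and> (i \<noteq> None \<longrightarrow> e \<noteq> tree_root (part i))}"

definition tagged_inputs :: "('v option \<times> 'v) set" where
  "tagged_inputs = (SIGMA i:tags. inputs (part i))"

definition tagged_nodes :: "('v option \<times> 'v) set" where
  "tagged_nodes = (SIGMA i:tags. nodes (part i))"

text \<open>Defines a function on the coded vertices by the tag and the original vertex; the
  restriction provides the extensionality required of all tree data.\<close>

definition on_tagged :: "('v option \<times> 'v) set \<Rightarrow> ('v option \<Rightarrow> 'v \<Rightarrow> 'c) \<Rightarrow> 'v \<Rightarrow> 'c" where
  "on_tagged Z g = (\<lambda>z\<in>j ` Z. case inv j z of (i, e) \<Rightarrow> g i e)"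

lemma j_eq_iff [simp]: "j p = j q \<longleftrightarrow> p = q"
  using j by (simp add: inj_eq)

lemma on_tagged [simp]: "(i, e) \<in> Z \<Longrightarrow> on_tagged Z g (j (i, e)) = g i e"
  using j by (simp add: on_tagged_def)

lemma on_tagged_PiE:
  assumes "\<And>i e. (i, e) \<in> Z \<Longrightarrow> g i e \<in> B (j (i, e))"
  shows "on_tagged Z g \<in> (\<Pi>\<^sub>E z\<in>j ` Z. B z)"
  using assms j by (auto simp: on_tagged_def)

definition colour :: "'v option \<times> 'v \<Rightarrow> 'i" where
  "colour = (\<lambda>(i, e). alpha (part i) e)"

text \<open>The inverse of \<open>recolour\<close> enters \<open>iso_s\<close> and
  \<open>iso_t\<close> because the edge in question may have a new colour. It is nontrivial only for
  the node whose output edge is the root of some \<open>N x\<close>; an edge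
  \<open>sm (part i) e\<close> is never a root.\<close>

definition graft :: "('v, 'i, 'ia, 'e, 'b, 'ba) ptree" where
  "graft = \<lparr>
     edges = j ` tagged_edges,
     inputs = j ` tagged_inputs,
     nodes = j ` tagged_nodes,
     sm = on_tagged tagged_inputs (\<lambda>i e. j (tag_edge i (sm (part i) e))),
     pm = on_tagged tagged_inputs (\<lambda>i e. j (i, pm (part i) e)),
     tm = on_tagged tagged_nodes (\<lambda>i n. j (tag_edge i (tm (part i) n))),
     alpha = on_tagged tagged_edges (\<lambda>i e. alpha (part i) e),
     beta = on_tagged tagged_inputs (\<lambda>i e. beta (part i) e),
     gamma = on_tagged tagged_nodes (\<lambda>i n. gamma (part i) n),
     iso_s = on_tagged tagged_inputs (\<lambda>i e. cmp (gI P) (colour (tag_edge i (sm (part i) e)))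
       (alpha (part i) (sm (part i) e)) (fob (sP P) (beta (part i) e)) (iso_s (part i) e)
       (inv_arr (gI P) (alpha (part i) (sm (part i) e)) (colour (tag_edge i (sm (part i) e)))
         (recolour i (sm (part i) e)))),
     iso_p = on_tagged tagged_inputs (\<lambda>i e. iso_p (part i) e),
     iso_t = on_tagged tagged_nodes (\<lambda>i n. cmp (gI P) (colour (tag_edge i (tm (part i) n)))
       (alpha (part i) (tm (part i) n)) (fob (tP P) (gamma (part i) n)) (iso_t (part i) n)
       (inv_arr (gI P) (alpha (part i) (tm (part i) n)) (colour (tag_edge i (tm (part i) n)))
         (recolour i (tm (part i) n))))\<rparr>"

definition part_emb :: "'v option \<Rightarrow> ('v, 'ia, 'ea, 'ba) emb" where
  "part_emb i = \<lparr>
     eA = \<lambda>e\<in>edges (part i). j (tag_edge i e),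
     eM = \<lambda>e\<in>inputs (part i). j (i, e),
     eN = \<lambda>n\<in>nodes (part i). j (i, n),
     ealpha = \<lambda>e\<in>edges (part i). recolour i e,
     ebeta = \<lambda>e\<in>inputs (part i). idt (gE P) (beta (part i) e),
     egamma = \<lambda>n\<in>nodes (part i). idt (gB P) (gamma (part i) n)\<rparr>"

lemma part_simps [simp]: "part None = S" "part (Some x) = N x"
  by (simp_all add: part_def)

lemma tag_edge_None [simp]: "tag_edge None e = (None, e)"
  by (simp add: tag_edge_def)

lemma f_leaf: "x \<in> X \<Longrightarrow> f x \<in> leaves S"
  using f by (rule bij_betw_apply)

lemma part_tree: "i \<in> tags \<Longrightarrow> poly_tree P (part i)"
  using N S.is_ptree by unfold_locales (auto simp: tags_def)

lemma tagged_input_iff [simp]: "(i, e) \<in> tagged_inputs \<longleftrightarrow> i \<in> tags \<and> e \<in> inputs (part i)"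
  and tagged_node_iff [simp]: "(i, e) \<in> tagged_nodes \<longleftrightarrow> i \<in> tags \<and> e \<in> nodes (part i)"
  by (auto simp: tagged_inputs_def tagged_nodes_def)

lemma tag_edge_tagged:
  assumes "i \<in> tags" "e \<in> edges (part i)"
  shows "tag_edge i e \<in> tagged_edges"
  using assms leaf_edge[OF f_leaf]
  by (cases i; cases "e = tree_root (part i)") (auto simp: tags_def tag_edge_def tagged_edges_def)

text \<open>The edge of an input is not a root, so it is its own representative.\<close>

lemma tag_edge_sm:
  assumes "i \<in> tags" "e \<in> inputs (part i)"
  shows "tag_edge i (sm (part i) e) = (i, sm (part i) e)"
proof -
  interpret poly_tree P "part i" using assms(1) by (rule part_tree)
  have "sm (part i) e \<noteq> tree_root (part i)" using assms(2) by simp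
  then show ?thesis by (cases i) (auto simp: tag_edge_def)
qed

text \<open>Redirecting the roots creates no collision of output edges: a leaf \<open>f x\<close> is
  not the output of a node of \<open>S\<close>, and \<open>f\<close> is injective.\<close>

lemma tag_edge_tm_inj:
  assumes "i \<in> tags" "n \<in> nodes (part i)" "i' \<in> tags" "n' \<in> nodes (part i')"
    and eq: "tag_edge i (tm (part i) n) = tag_edge i' (tm (part i') n')"
  shows "i = i' \<and> n = n'"
proof -
  interpret i: poly_tree P "part i" using assms(1) by (rule part_tree)
  interpret i': poly_tree P "part i'" using assms(3) by (rule part_tree)
  have leaf: "f x \<noteq> tm S b" if "x \<in> X" "b \<in> nodes S" for x b
    using f_leaf[OF that(1)] that(2) by (auto simp: leaves_def)
  have "i = i'"
    using assms leaf f by (auto simp: tag_edge_def tags_def bij_betw_def inj_on_def split: option.splits if_splits) metis+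
  moreover have "tm (part i) n = tm (part i) n'"
    using eq \<open>i = i'\<close> by (auto simp: tag_edge_def split: option.splits if_splits)
  ultimately show ?thesis using assms i.tm_eq_iff by blast
qed

lemma recolour_hom:
  assumes "i \<in> tags" "e \<in> edges (part i)"
  shows "recolour i e \<in> hom (gI P) (alpha (part i) e) (colour (tag_edge i e))"
proof -
  interpret poly_tree P "part i" using assms(1) by (rule part_tree)
  have "idt (gI P) (alpha (part i) e) \<in> hom (gI P) (alpha (part i) e) (alpha (part i) e)"
    using assms(2) by (auto intro: I.idt_hom)
  then show ?thesis using assms(1) \<phi>
    by (auto simp: recolour_def colour_def tag_edge_def tags_def split: option.splits)
qed

lemma colour_obj:
  assumes "i \<in> tags" "e \<in> edges (part i)"
  shows "colour (tag_edge i e) \<in> obj (gI P)"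
proof -
  have "tag_edge i e \<in> tagged_edges" using assms by (rule tag_edge_tagged)
  then obtain i' e' where ie: "tag_edge i e = (i', e')" "i' \<in> tags" "e' \<in> edges (part i')"
    by (auto simp: tagged_edges_def)
  interpret poly_tree P "part i'" using ie(2) by (rule part_tree)
  show ?thesis using ie by (simp add: colour_def)
qed

lemma graft_simps [simp]:
  "edges graft = j ` tagged_edges" "inputs graft = j ` tagged_inputs" "nodes graft = j ` tagged_nodes"
  by (simp_all add: graft_def)

lemma graft_edgeE:
  assumes "z \<in> edges graft"
  obtains i e where "z = j (i, e)" "i \<in> tags" "e \<in> edges (part i)"
    "i \<noteq> None \<longrightarrow> e \<noteq> tree_root (part i)"
proof -
  obtain p where "p \<in> tagged_edges" "z = j p" using assms by auto
  then show thesis using that[of "fst p" "snd p"] unfolding tagged_edges_def by auto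
qed

lemma graft_alpha: "i \<in> tags \<Longrightarrow> e \<in> edges (part i) \<Longrightarrow> alpha graft (j (tag_edge i e)) = colour (tag_edge i e)"
  using tag_edge_tagged[of i e] by (cases "tag_edge i e") (simp add: graft_def colour_def)

lemma graft_input:
  assumes "i \<in> tags" "e \<in> inputs (part i)"
  shows "sm graft (j (i, e)) = j (tag_edge i (sm (part i) e))" "pm graft (j (i, e)) = j (i, pm (part i) e)"
    "beta graft (j (i, e)) = beta (part i) e" "iso_p graft (j (i, e)) = iso_p (part i) e"
    "iso_s graft (j (i, e)) = cmp (gI P) (colour (tag_edge i (sm (part i) e)))
       (alpha (part i) (sm (part i) e)) (fob (sP P) (beta (part i) e)) (iso_s (part i) e)
       (inv_arr (gI P) (alpha (part i) (sm (part i) e)) (colour (tag_edge i (sm (part i) e)))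
         (recolour i (sm (part i) e)))"
  using assms by (simp_all add: graft_def)

lemma graft_node:
  assumes "i \<in> tags" "n \<in> nodes (part i)"
  shows "tm graft (j (i, n)) = j (tag_edge i (tm (part i) n))" "gamma graft (j (i, n)) = gamma (part i) n"
    "iso_t graft (j (i, n)) = cmp (gI P) (colour (tag_edge i (tm (part i) n)))
       (alpha (part i) (tm (part i) n)) (fob (tP P) (gamma (part i) n)) (iso_t (part i) n)
       (inv_arr (gI P) (alpha (part i) (tm (part i) n)) (colour (tag_edge i (tm (part i) n)))
         (recolour i (tm (part i) n)))"
  using assms by (simp_all add: graft_def)

text \<open>The roots of the attached trees have been absorbed into leaves of \<open>S\<close>, so
  \<open>tree_root S\<close> is the only edge left without an input over it.\<close>

lemma graft_minus_sm: "edges graft - sm graft ` inputs graft = {j (None, tree_root S)}"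
proof -
  have "z = j (None, tree_root S) \<or> z \<in> sm graft ` inputs graft" if z: "z \<in> edges graft" for z
  proof -
    obtain i e where ie: "z = j (i, e)" "i \<in> tags" "e \<in> edges (part i)"
      "i \<noteq> None \<longrightarrow> e \<noteq> tree_root (part i)"
      using z by (rule graft_edgeE)
    interpret poly_tree P "part i" using ie(2) by (rule part_tree)
    from ie(3) show ?thesis
    proof (cases rule: edge_cases)
      case 1
      then show ?thesis using ie by (cases i) auto
    next
      case (2 e')
      then have "z = sm graft (j (i, e'))" using ie by (simp add: graft_input tag_edge_sm)
      then show ?thesis using 2 ie by auto
    qed
  qed
  moreover have "j (None, tree_root S) \<in> edges graft" by (auto simp: tagged_edges_def tags_def)
  moreover have "j (None, tree_root S) \<notin> sm graft ` inputs graft"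
  proof
    assume "j (None, tree_root S) \<in> sm graft ` inputs graft"
    then obtain i e where ie: "i \<in> tags" "e \<in> inputs (part i)" "j (None, tree_root S) = sm graft (j (i, e))"
      by auto
    then have "i = None" "tree_root S = sm S e" by (auto simp: graft_input tag_edge_sm)
    then show False using S.sm_neq_root ie by auto
  qed
  ultimately show ?thesis unfolding set_eq_iff Diff_iff singleton_iff by metis
qed

lemma is_tree_graft: "is_tree graft"
proof (rule is_treeI[OF _ _ _ _ _ _ _ _ graft_minus_sm])
  have fin: "finite tags" using finite_X by (simp add: tags_def)
  have "finite (inputs (part i))" "finite (nodes (part i))" "finite (edges (part i))" if "i \<in> tags" for i
  proof -
    interpret poly_tree P "part i" using that by (rule part_tree)
    show "finite (inputs (part i))" "finite (nodes (part i))" "finite (edges (part i))"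
      by (rule finite_inputs finite_nodes finite_edges)+
  qed
  moreover from this fin have "finite tagged_edges"
    by (intro finite_subset[of tagged_edges "SIGMA i:tags. edges (part i)"])
      (auto simp: tagged_edges_def)
  ultimately show "finite (edges graft)" "finite (inputs graft)" "finite (nodes graft)"
    using fin by (auto simp: tagged_inputs_def tagged_nodes_def)
  have closed: "sm (part i) e \<in> edges (part i)" "pm (part i) e \<in> nodes (part i)"
    if "i \<in> tags" "e \<in> inputs (part i)" for i e
  proof -
    interpret poly_tree P "part i" using that(1) by (rule part_tree)
    show "sm (part i) e \<in> edges (part i)" "pm (part i) e \<in> nodes (part i)" using that by auto
  qed
  have closed': "tm (part i) n \<in> edges (part i)" if "i \<in> tags" "n \<in> nodes (part i)" for i n
  proof -
    interpret poly_tree P "part i" using that(1) by (rule part_tree)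
    show "tm (part i) n \<in> edges (part i)" using that by auto
  qed
  show "sm graft \<in> inputs graft \<rightarrow>\<^sub>E edges graft" "pm graft \<in> inputs graft \<rightarrow>\<^sub>E nodes graft"
    "tm graft \<in> nodes graft \<rightarrow>\<^sub>E edges graft"
    unfolding graft_simps
    by (auto simp: graft_def closed closed' intro!: on_tagged_PiE tag_edge_tagged)
  show "inj_on (tm graft) (nodes graft)"
    using tag_edge_tm_inj by (auto simp: inj_on_def graft_node)
  show "inj_on (sm graft) (inputs graft)"
  proof (rule inj_onI)
    fix z z' assume "z \<in> inputs graft" "z' \<in> inputs graft" and eq: "sm graft z = sm graft z'"
    then obtain i e i' e' where ie: "z = j (i, e)" "i \<in> tags" "e \<in> inputs (part i)"
      "z' = j (i', e')" "i' \<in> tags" "e' \<in> inputs (part i')" by auto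
    interpret poly_tree P "part i" using ie(2) by (rule part_tree)
    have "i = i'" "sm (part i) e = sm (part i') e'"
      using eq ie by (auto simp: graft_input tag_edge_sm)
    then show "z = z'" using ie sm_eq_iff[of e e'] by simp
  qed
  fix Q z
  assume z: "z \<in> edges graft" and root: "Q (j (None, tree_root S))"
    and step: "\<And>e. \<lbrakk>e \<in> inputs graft; Q (tm graft (pm graft e))\<rbrakk> \<Longrightarrow> Q (sm graft e)"
  have step': "Q (j (tag_edge i (sm (part i) e)))"
    if "i \<in> tags" "e \<in> inputs (part i)" "Q (j (tag_edge i (tm (part i) (pm (part i) e))))" for i e
    using step[of "j (i, e)"] that closed[OF that(1,2)] by (auto simp: graft_input graft_node)
  \<comment> \<open>Induction over the graft in two stages: this one reaches all edges of
    \<open>S\<close>, in particular the leaves where trees are attached.\<close>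
  have Q_S: "Q (j (None, e))" if "e \<in> edges S" for e
    using that
  proof (induction rule: S.tree_induct)
    case (input e)
    then show ?case using step'[of None e] by (simp add: tags_def)
  qed (rule root)
  \<comment> \<open>In \<open>N x\<close> the induction starts at the root, whose representative is
    the leaf \<open>f x\<close> already reached.\<close>
  have Q_part: "Q (j (tag_edge i e))" if i: "i \<in> tags" and e: "e \<in> edges (part i)" for i e
  proof -
    interpret poly_tree P "part i" using i by (rule part_tree)
    from e show ?thesis
    proof (induction rule: tree_induct)
      case root
      show ?case
        using i Q_S[OF leaf_edge[OF f_leaf]] Q_S[OF S.root_edge]
        by (cases i) (auto simp: tag_edge_def tags_def)
    qed (rule step'[OF i])
  qed
  obtain i e where ie: "z = j (i, e)" "i \<in> tags" "e \<in> edges (part i)"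
      "i \<noteq> None \<longrightarrow> e \<noteq> tree_root (part i)"
    using z by (rule graft_edgeE)
  then have "tag_edge i e = (i, e)" by (cases i) (auto simp: tag_edge_def)
  then show "Q z" using Q_part[OF ie(2,3)] ie(1) by simp
qed

lemma graft_inputs_at:
  assumes "i \<in> tags" "n \<in> nodes (part i)"
  shows "inputs_at graft (j (i, n)) = (\<lambda>e. j (i, e)) ` inputs_at (part i) n"
  using assms by (auto simp: inputs_at_def graft_input image_iff)

lemma is_ptree_graft: "is_ptree P graft"
  unfolding is_ptree_iff graft_simps
proof (intro conjI ballI)
  show "is_tree graft" by (rule is_tree_graft)
  show "alpha graft \<in> j ` tagged_edges \<rightarrow>\<^sub>E obj (gI P)"
    using poly_tree.alpha_obj[OF part_tree]
    by (auto simp: graft_def tagged_edges_def intro!: on_tagged_PiE)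
  show "beta graft \<in> j ` tagged_inputs \<rightarrow>\<^sub>E obj (gE P)"
    using poly_tree.beta_obj[OF part_tree] by (auto simp: graft_def intro!: on_tagged_PiE)
  show "gamma graft \<in> j ` tagged_nodes \<rightarrow>\<^sub>E obj (gB P)"
    using poly_tree.gamma_obj[OF part_tree] by (auto simp: graft_def intro!: on_tagged_PiE)
  have ext: "iso_s graft \<in> extensional (j ` tagged_inputs)" "iso_p graft \<in> extensional (j ` tagged_inputs)"
    "iso_t graft \<in> extensional (j ` tagged_nodes)"
    by (simp_all add: graft_def on_tagged_def)
  have S: "iso_s graft (j (i, e)) \<in> hom (gI P) (alpha graft (sm graft (j (i, e))))
      (fob (sP P) (beta graft (j (i, e))))"
    and p: "iso_p graft (j (i, e)) \<in> hom (gB P) (gamma graft (pm graft (j (i, e))))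
      (fob (pP P) (beta graft (j (i, e))))"
    if "i \<in> tags" "e \<in> inputs (part i)" for i e
  proof -
    interpret poly_tree P "part i" using that(1) by (rule part_tree)
    show "iso_s graft (j (i, e)) \<in> hom (gI P) (alpha graft (sm graft (j (i, e))))
      (fob (sP P) (beta graft (j (i, e))))"
      using that colour_obj[of i "sm (part i) e"] recolour_hom[of i "sm (part i) e"]
      by (auto simp: graft_input graft_alpha s.fob_obj intro!: I.cmp_hom[of _ "alpha (part i) (sm (part i) e)"] I.inv_arr_hom)
    show "iso_p graft (j (i, e)) \<in> hom (gB P) (gamma graft (pm graft (j (i, e))))
      (fob (pP P) (beta graft (j (i, e))))"
      using that by (simp add: graft_input graft_node)
  qed
  have T: "iso_t graft (j (i, n)) \<in> hom (gI P) (alpha graft (tm graft (j (i, n))))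
      (fob (tP P) (gamma graft (j (i, n))))" if "i \<in> tags" "n \<in> nodes (part i)" for i n
  proof -
    interpret poly_tree P "part i" using that(1) by (rule part_tree)
    show ?thesis
      using that colour_obj[of i "tm (part i) n"] recolour_hom[of i "tm (part i) n"]
      by (auto simp: graft_node graft_alpha t.fob_obj intro!: I.cmp_hom[of _ "alpha (part i) (tm (part i) n)"] I.inv_arr_hom)
  qed
  show "iso_s graft \<in> (\<Pi>\<^sub>E e\<in>j ` tagged_inputs. hom (gI P) (alpha graft (sm graft e)) (fob (sP P) (beta graft e)))"
    "iso_p graft \<in> (\<Pi>\<^sub>E e\<in>j ` tagged_inputs. hom (gB P) (gamma graft (pm graft e)) (fob (pP P) (beta graft e)))"
    "iso_t graft \<in> (\<Pi>\<^sub>E n\<in>j ` tagged_nodes. hom (gI P) (alpha graft (tm graft n)) (fob (tP P) (gamma graft n)))"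
    using S p T ext unfolding PiE_iff by auto
  fix z assume "z \<in> j ` tagged_nodes"
  then obtain i n where i: "z = j (i, n)" "i \<in> tags" "n \<in> nodes (part i)" by auto
  interpret poly_tree P "part i" using i(2) by (rule part_tree)
  \<comment> \<open>The inputs at a node of the graft are tagged copies of those in its part, with
    the same \<open>beta\<close> and \<open>iso_p\<close>; recolouring affects edges only, so the
    fibre condition carries over.\<close>
  have "fibre_equiv (gE P) (gB P) (pP P) (gamma (part i) n) (inputs_at (part i) n)
      (beta graft \<circ> (\<lambda>e. j (i, e))) (iso_p graft \<circ> (\<lambda>e. j (i, e)))"
    using fibre[OF i(3)]
    by (rule fibre_equiv_cong[THEN iffD1, rotated 2]) (auto simp: inputs_at_def graft_input i)
  then show "fibre_equiv (gE P) (gB P) (pP P) (gamma graft z) (inputs_at graft z) (beta graft) (iso_p graft)"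
    using i by (simp add: graft_node graft_inputs_at fibre_equiv_image inj_on_def)
qed

lemma part_emb_simps [simp]:
  "eA (part_emb i) = (\<lambda>e\<in>edges (part i). j (tag_edge i e))"
  "eM (part_emb i) = (\<lambda>e\<in>inputs (part i). j (i, e))"
  "eN (part_emb i) = (\<lambda>n\<in>nodes (part i). j (i, n))"
  "ealpha (part_emb i) = (\<lambda>e\<in>edges (part i). recolour i e)"
  "ebeta (part_emb i) = (\<lambda>e\<in>inputs (part i). idt (gE P) (beta (part i) e))"
  "egamma (part_emb i) = (\<lambda>n\<in>nodes (part i). idt (gB P) (gamma (part i) n))"
  by (simp_all add: part_emb_def)

lemma is_ptree_embedding_part_emb:
  assumes i: "i \<in> tags"
  shows "is_ptree_embedding P (part i) graft (part_emb i)"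
proof -
  interpret poly_tree P "part i" using i by (rule part_tree)
  show ?thesis
  proof (rule is_ptree_embeddingI, goal_cases)
    case (8 b)
    have "bij_betw (\<lambda>e. j (i, e)) (inputs_at (part i) b) (inputs_at graft (j (i, b)))"
      unfolding graft_inputs_at[OF i 8] by (auto simp: bij_betw_def inj_on_def)
    then show ?case using 8
      by (subst bij_betw_cong[where g = "\<lambda>e. j (i, e)"]) (auto simp: inputs_at_def)
  next
    case (12 e)
    then show ?case using i colour_obj[of i "sm (part i) e"] recolour_hom[of i "sm (part i) e"]
      by (simp add: graft_input graft_alpha s.sqr_transport)
  next
    case (13 e)
    then show ?case using i by (simp add: graft_input graft_node p.sqr_idt)
  next
    case (14 n)
    then show ?case using i colour_obj[of i "tm (part i) n"] recolour_hom[of i "tm (part i) n"]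
      by (simp add: graft_node graft_alpha t.sqr_transport)
  qed (use i in \<open>auto simp: is_tree graft_input graft_node graft_alpha recolour_hom
      tag_edge_tagged intro!: I.idt_hom E.idt_hom B.idt_hom\<close>)
qed

lemma tree_root_graft: "tree_root graft = j (None, tree_root S)"
  using graft_minus_sm unfolding tree_root_def[of graft] by simp

lemma cut_graft: "cut P S graft (part_emb None)"
proof -
  have "is_ptree_embedding P S graft (part_emb None)"
    using is_ptree_embedding_part_emb[of None] by (simp add: tags_def)
  then show ?thesis
    using S.is_ptree is_ptree_graft by unfold_locales (simp_all add: tree_root_graft)
qed

text \<open>The embedding of \<open>N x\<close>, corestricted to the branch at its root, is itself a
  cut, so \<open>is_iso_if_leaves\<close> applies and surjectivity onto the branch need not be shown
  by hand.\<close>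

lemma graft_branch_iso:
  assumes x: "x \<in> X"
  shows "is_iso (ptree_cat P) (N x) (ideal_subtree graft (eA (part_emb None) (f x))) (part_emb (Some x))"
proof -
  have i: "Some x \<in> tags" using x by (simp add: tags_def)
  interpret G: poly_tree P graft by unfold_locales (rule is_ptree_graft)
  interpret N: poly_tree P "N x" using x N by unfold_locales
  let ?r = "eA (part_emb None) (f x)"
  have r: "?r = j (None, f x)" "?r \<in> edges graft"
    using leaf_edge[OF f_leaf[OF x]] tag_edge_tagged[of None "f x"] by (auto simp: tags_def)
  have root: "eA (part_emb (Some x)) (tree_root (N x)) = ?r"
    unfolding r by (simp add: tag_edge_def)
  have emb: "is_ptree_embedding P (N x) graft (part_emb (Some x))"
    using is_ptree_embedding_part_emb[OF i] by simp
  interpret cut P "N x" "ideal_subtree graft ?r" "part_emb (Some x)"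
  proof unfold_locales
    show "is_ptree P (ideal_subtree graft ?r)"
      using is_ptree_graft r(2) by (rule is_ptree_ideal_subtree)
    show "is_ptree_embedding P (N x) (ideal_subtree graft ?r) (part_emb (Some x))"
      using N.is_ptree is_ptree_graft emb root by (rule is_ptree_embedding_into_ideal)
    show "eA (part_emb (Some x)) (tree_root (N x)) = tree_root (ideal_subtree graft ?r)"
      using root r(2) G.is_tree by simp
  qed
  show ?thesis
  proof (rule is_iso_if_leaves)
    fix l assume l: "l \<in> leaves (N x)"
    then have l': "l \<in> edges (N x)" by (rule leaf_edge)
    \<comment> \<open>This includes the case where \<open>N x\<close> is a single edge: then
      \<open>l\<close> is also the root, and its representative \<open>f x\<close> is not an output
      because it is a leaf of \<open>S\<close> and \<open>f\<close> is injective.\<close>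
    have "tag_edge (Some x) l \<noteq> tag_edge i n" if "i \<in> tags" "b \<in> nodes (part i)" "n = tm (part i) b" for i n b
    proof
      assume eq: "tag_edge (Some x) l = tag_edge i n"
      have leaf: "f y \<noteq> tm S b" if "y \<in> X" "b \<in> nodes S" for y b
        using f_leaf[OF that(1)] that(2) by (auto simp: leaves_def)
      have "i = Some x" using eq that x leaf f
        by (auto simp: tag_edge_def tags_def bij_betw_def inj_on_def split: option.splits if_splits)
      moreover from this eq have "l = n" by (auto simp: tag_edge_def split: if_splits)
      ultimately show False using l that by (auto simp: leaves_def)
    qed
    then have "eA (part_emb (Some x)) l \<notin> tm graft ` nodes graft"
      using l' by (auto simp: graft_node)
    moreover have "eA (part_emb (Some x)) l \<in> ideal_edges graft ?r" using map_edge[OF l'] by simp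
    ultimately show "eA (part_emb (Some x)) l \<in> leaves (ideal_subtree graft ?r)"
      using G.ideal_node[of _ ?r] by (auto simp: leaves_def)
  qed
qed

end


text \<open>The preimage of a forest, a tree and a matching of roots with leaves is the cut given by
  the graft. The isomorphism is the identity on the tree and \<open>part_emb (Some x)\<close> on
  each tree of the forest.\<close>

lemma (in poly) ess_surj_comparison:
  assumes "infinite (UNIV :: 'v set)"
  shows "ess_surj (pcuts P :: (('v, 'i, 'ia, 'e, 'ea, 'b, 'ba) pcut, ('v, 'ia, 'ea, 'ba) pcut_arr) cat)
    hpb comparison"
  unfolding ess_surj_def
proof
  interpret H: groupoid hpb by (rule groupoid_hpb)
  interpret K: gfunctor "pcuts P" hpb comparison by (rule gfunctor_comparison)
  fix d :: "('v, 'i, 'ia, 'e, 'b, 'ba) pforest \<times> ('v, 'i, 'ia, 'e, 'b, 'ba) ptree \<times>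
    (('v \<Rightarrow> 'v) \<times> ('v \<Rightarrow> 'ia))"
  assume d: "d \<in> obj hpb"
  obtain X N S f \<phi> where eq: "d = ((X, N), S, (f, \<phi>))" by (metis surj_pair)
  have X: "finite X" and N: "\<And>x. x \<in> X \<Longrightarrow> is_ptree P (N x)" and S: "is_ptree P S"
    and f_ext: "f \<in> extensional X" and f_bij: "bij_betw f X (leaves S)"
    using d by (auto simp: eq hpullback_def pforests_def)
  have fx: "f x \<in> leaves S" "f x \<in> edges S" if "x \<in> X" for x
    using bij_betw_apply[OF f_bij that] leaf_edge by auto
  have \<phi>: "\<phi> x \<in> hom (gI P) (alpha (N x) (tree_root (N x))) (alpha S (f x))" if "x \<in> X" for x
    using d that fx[OF that] by (auto simp: eq hpullback_def pforests_def PiE_iff)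
  obtain j :: "'v option \<times> 'v \<Rightarrow> 'v" where "inj j" using ex_inj_option_prod[OF assms] by blast
  then interpret grafting P S X N f \<phi> j
    using X N S f_bij \<phi> by unfold_locales
  let ?c = "part_emb None"
  let ?x = "(S, graft, ?c)"
  have x: "?x \<in> obj (pcuts P)" using cut_graft by simp
  interpret c: cut P S graft ?c by (rule cut_graft)
  have c_recolour: "ealpha ?c l = idt (gI P) (alpha S l)" if "l \<in> edges S" for l
    using that by (simp add: recolour_def)
  have c_colour: "alpha graft (eA ?c l) = alpha S l" if "l \<in> edges S" for l
    using that graft_alpha[of None l] by (simp add: tags_def colour_def)
  have root: "tree_root (N x) \<in> edges (N x)" if "x \<in> X" for x
  proof -
    interpret poly_tree P "N x" using N[OF that] by unfold_locales
    show ?thesis by simp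
  qed
  have part_root: "ealpha (part_emb (Some x)) (tree_root (N x)) = \<phi> x" if "x \<in> X" for x
    using root[OF that] by (simp add: recolour_def)
  have branch_root: "tree_root (c.branch (f x)) = eA ?c (f x)"
    "eA ?c (f x) \<in> j ` tagged_edges" if "x \<in> X" for x
    using c.map_edge[OF fx(2)[OF that]] c.T.is_tree by (simp_all del: part_emb_simps)
  have id: "is_iso (ptree_cat P) S S (idt (ptree_cat P) S)"
    using groupoid.axioms(1)[OF groupoid_ptrees, THEN category.idt_hom, of S] S by simp
  have "cmp (gI P) (alpha (N x) (tree_root (N x))) (alpha S (f x)) (alpha S (f x))
      (idt (gI P) (alpha S (f x))) (\<phi> x) = \<phi> x" if "x \<in> X" for x
  proof -
    interpret poly_tree P "N x" using N[OF that] by unfold_locales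
    show ?thesis using that fx \<phi> by (intro I.cmp_idt_left) auto
  qed
  moreover have "inv_arr (gI P) (alpha S (f x)) (alpha S (f x)) (idt (gI P) (alpha S (f x)))
      = idt (gI P) (alpha S (f x))" if "x \<in> X" for x
    using fx[OF that] by (intro I.inv_idt) auto
  moreover have "(f, \<lambda>x\<in>X. part_emb (Some x)) \<in> hom (pforests P) (X, N) (fob w_func ?x)"
    using f_ext f_bij fx graft_branch_iso by (auto simp: pforests_def simp del: part_emb_simps)
  \<comment> \<open>The colour square reduces to \<phi> on both sides: the cut has identity colour
    isomorphisms, and \<open>part_emb (Some x)\<close> acts on the root colour by \<phi>.\<close>
  ultimately have u: "((f, \<lambda>x\<in>X. part_emb (Some x)), idt (ptree_cat P) S) \<in> hom hpb d (fob comparison ?x)"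
    using id fx by (auto simp: hpullback_def hp_induced_def eq c_colour c_recolour part_root
        branch_root simp del: part_emb_simps intro!: restrict_ext)
  \<comment> \<open>The arrow just built starts at \<open>d\<close>, while \<open>ess_surj\<close>
    asks for one ending there; it is inverted in the groupoid \<open>hpb\<close>.\<close>
  have "fob comparison ?x \<in> obj hpb" using x by (rule K.fob_obj)
  then have "hom hpb (fob comparison ?x) d \<noteq> {}" using H.inv_arr_hom[OF d _ u] by blast
  then show "\<exists>x\<in>obj (pcuts P). hom hpb (fob comparison x) d \<noteq> {}" using x by blast
qed

theorem lemma5p5:
  fixes P :: "('i, 'ia, 'e, 'ea, 'b, 'ba) poly_diagram"
  assumes "is_poly_diagram P"
    and "infinite (UNIV :: 'v set)"
  shows
    "gfunctor (pcuts P :: (('v, 'i, 'ia, 'e, 'ea, 'b, 'ba) pcut, ('v, 'ia, 'ea, 'ba) pcut_arr) cat)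
       (prod_cat (pforests P) (ptrees P)) (func_pair w_func r_func) \<and>
     gfunctor (pforests P :: (('v, 'i, 'ia, 'e, 'b, 'ba) pforest, ('v, 'ia, 'ea, 'ba) pforest_arr) cat)
       (families (gI P)) root_func \<and>
     gfunctor (ptrees P :: (('v, 'i, 'ia, 'e, 'b, 'ba) ptree, ('v, 'ia, 'ea, 'ba) emb) cat)
       (families (gI P)) leaf_func \<and>
     nat_iso (pcuts P :: (('v, 'i, 'ia, 'e, 'ea, 'b, 'ba) pcut, ('v, 'ia, 'ea, 'ba) pcut_arr) cat)
       (families (gI P)) (func_comp root_func w_func) (func_comp leaf_func r_func) (cut_iso P) \<and>
     equivalence (pcuts P :: (('v, 'i, 'ia, 'e, 'ea, 'b, 'ba) pcut, ('v, 'ia, 'ea, 'ba) pcut_arr) cat)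
       (hpullback (pforests P) (ptrees P) (families (gI P)) root_func leaf_func)
       (hp_induced w_func r_func (cut_iso P))"
proof (intro conjI)
  interpret poly P by unfold_locales fact
  show "gfunctor (pcuts P :: (('v, 'i, 'ia, 'e, 'ea, 'b, 'ba) pcut, ('v, 'ia, 'ea, 'ba) pcut_arr) cat)
       (prod_cat (pforests P) (ptrees P)) (func_pair w_func r_func)"
    by (rule gfunctor_func_pair[OF gfunctor_w_func gfunctor_r_func])
  show "gfunctor (pforests P :: (('v, 'i, 'ia, 'e, 'b, 'ba) pforest, ('v, 'ia, 'ea, 'ba) pforest_arr) cat)
       (families (gI P)) root_func"
    by (rule gfunctor_root_func)
  show "gfunctor (ptrees P :: (('v, 'i, 'ia, 'e, 'b, 'ba) ptree, ('v, 'ia, 'ea, 'ba) emb) cat)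
       (families (gI P)) leaf_func"
    by (rule gfunctor_leaf_func)
  show "nat_iso (pcuts P :: (('v, 'i, 'ia, 'e, 'ea, 'b, 'ba) pcut, ('v, 'ia, 'ea, 'ba) pcut_arr) cat)
       (families (gI P)) (func_comp root_func w_func) (func_comp leaf_func r_func) (cut_iso P)"
    by (rule nat_iso_cut_iso)
  show "equivalence (pcuts P :: (('v, 'i, 'ia, 'e, 'ea, 'b, 'ba) pcut, ('v, 'ia, 'ea, 'ba) pcut_arr) cat)
       (hpullback (pforests P) (ptrees P) (families (gI P)) root_func leaf_func)
       (hp_induced w_func r_func (cut_iso P))"
    by (rule equivalenceI[OF gfunctor_comparison fully_faithful_comparison
      ess_surj_comparison[OF assms(2)]])
qed

end
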